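(* Let $w$ be a strong solution of the Corrected Smagorinsky Model $$w_t-\frac{C_s^4\delta^2}{\mu^{2}}\Delta w_t+w\cdot\nabla w-\nu\Delta w+\nabla q-\nabla\cdot\big((C_s\delta)^2|\nabla w|\nabla w\big)=f(x),\qquad \nabla\cdot w=0\ \text{ in }\Omega,\qquad w=0\ \text{ on }\partial\Omega .$$ Then the following energy estimate holds: $$\frac12\frac{1}{|\Omega|}\frac{d}{dt}\Big(\|w\|^2+\frac{C_s^4\delta^2}{\mu^2}\|\nabla w\|^2\Big)+\frac{1}{|\Omega|}\nu\|\nabla w\|^2+\frac{1}{|\Omega|}(C_s\delta)^2\|\nabla w\|_{L^3}^3=\frac{1}{|\Omega|}\langle f,w\rangle .$$
   Context: $\Omega\subset\mathbb{R}^d$ ($d=2$ or $3$) is a regular bounded flow domain and $|\Omega|$ is its measure. $\nu>0$ is the kinematic viscosity, $C_s,\delta,\mu>0$ are constants, and $f=f(x)$ is a prescribed body force for which the pairings with $f$ make sense. $\|\cdot\|$ and $(\cdot,\cdot)$ are the $L^2(\Omega)$ norm and inner product, $\|\cdot\|_{L^p}$ is the $L^p(\Omega)$ norm, and $\langle f,w\rangle$ is the pairing $\int_\Omega f\cdot w\,dx$. $|\nabla w|$ is the Euclidean (Frobenius) norm of the velocity gradient. Spaces: $X=\{v\in L^3(\Omega):\nabla v\in L^3(\Omega),\ v=0\text{ on }\partial\Omega\}$ (vector fields), $Q=\{q\in L^2(\Omega):\int_\Omega q\,dx=0\}$. Weak form of the model: $(w,p)\in(X,Q)$ satisfies $$(w_t,v)+\tfrac{C_s^4}{\mu^2}\delta^2(\nabla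 w_t,\nabla v)+(w\cdot\nabla w,v)+\nu(\nabla w,\nabla v)-(p,\nabla\cdot v)+\big((C_s\delta)^2|\nabla w|\nabla w,\nabla v\big)=(f,v)\quad\forall v\in X,$$ $$(q,\nabla\cdot w)=0\quad\forall q\in Q .$$ Strong solution: $w$ is a strong solution (with initial value $w_0$) on $[0,T]$ if (1) $w\in L^\infty(0,T;H^1(\Omega))\cap L^2(0,T;W^{1,3}(\Omega))\cap L^2(0,T;L^6(\Omega))$; (2) $w(\cdot,t)\to w_0$ in $L^2(\Omega)$ as $t\to0$; (3) $w$ satisfies the weak form above for all $v\in L^\infty(0,T;H^1(\Omega))\cap L^2(0,T;W^{1,3}(\Omega))\cap L^2(0,T;L^6(\Omega))$ (vanishing on $\partial\Omega$). *)

theory Defs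
  imports "HOL-Analysis.Analysis"
begin

text \<open>
  Functions on \<open>\<Omega>\<close> are total functions on \<open>real^'n\<close> of which only the values in \<open>\<Omega>\<close> matter.
  The gradient of a vector field takes values in \<open>real^'n^'n\<close>, with entry \<open>(i, j)\<close> equal to the
  derivative of component \<open>i\<close> in direction \<open>j\<close>; the norm and inner product of this type are the
  Frobenius ones.
\<close>

subsection \<open>The flow domain\<close>

text \<open>
  ``Regular'' is read as: Lipschitz boundary, i.e. near every boundary point, in suitable Cartesian
  coordinates, \<open>\<Omega>\<close> is the strict epigraph of a Lipschitz function of the coordinates orthogonal
  to \<open>e\<close>.
\<close>

definition lipschitz_boundary :: "(real^'n) set \<Rightarrow> bool" where
  "lipschitz_boundary \<Omega> \<longleftrightarrow>
     (\<forall>x\<in>frontier \<Omega>. \<exists>e r L (g :: real^'n \<Rightarrow> real).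
        norm e = 1 \<and> r > 0 \<and> L-lipschitz_on UNIV g \<and>
        \<Omega> \<inter> ball x r = {y \<in> ball x r. g (y - (y \<bullet> e) *\<^sub>R e) < y \<bullet> e})"

definition flow_domain :: "(real^'n) set \<Rightarrow> bool" where
  "flow_domain \<Omega> \<longleftrightarrow>
     open \<Omega> \<and> connected \<Omega> \<and> \<Omega> \<noteq> {} \<and> bounded \<Omega> \<and> lipschitz_boundary \<Omega>"

subsection \<open>Test functions and weak derivatives\<close>

primrec C_k :: "nat \<Rightarrow> ('a::real_normed_vector \<Rightarrow> 'b::real_normed_vector) \<Rightarrow> bool" where
  "C_k 0 f \<longleftrightarrow> continuous_on UNIV f"
| "C_k (Suc k) f \<longleftrightarrow>
     (\<exists>f'. (\<forall>x. (f has_derivative f' x) (at x)) \<and> (\<forall>v. C_k k (\<lambda>x. f' x v)))"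

definition test_function ::
    "'a::euclidean_space set \<Rightarrow> ('a \<Rightarrow> 'b::real_normed_vector) \<Rightarrow> bool" where
  "test_function U \<phi> \<longleftrightarrow>
     (\<forall>k. C_k k \<phi>) \<and> compact (closure {x. \<phi> x \<noteq> 0}) \<and> closure {x. \<phi> x \<noteq> 0} \<subseteq> U"

definition locally_integrable ::
    "'a::euclidean_space set \<Rightarrow> ('a \<Rightarrow> 'b::euclidean_space) \<Rightarrow> bool" where
  "locally_integrable U f \<longleftrightarrow> (\<forall>K. compact K \<and> K \<subseteq> U \<longrightarrow> integrable (lebesgue_on K) f)"

definition weak_gradient ::
    "(real^'n) set \<Rightarrow> (real^'n \<Rightarrow> real^'n) \<Rightarrow> (real^'n \<Rightarrow> real^'n^'n) \<Rightarrow> bool" where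
  "weak_gradient \<Omega> u G \<longleftrightarrow>
     locally_integrable \<Omega> u \<and> locally_integrable \<Omega> G \<and>
     (\<forall>\<phi> :: real^'n \<Rightarrow> real. test_function \<Omega> \<phi> \<longrightarrow>
        (\<forall>i j. (LINT x|lebesgue_on \<Omega>. u x $ i * frechet_derivative \<phi> (at x) (axis j 1))
             = - (LINT x|lebesgue_on \<Omega>. G x $ i $ j * \<phi> x)))"

text \<open>A representative of the weak gradient, which is unique up to null sets.\<close>

definition grad :: "(real^'n) set \<Rightarrow> (real^'n \<Rightarrow> real^'n) \<Rightarrow> real^'n \<Rightarrow> real^'n^'n" where
  "grad \<Omega> u = (SOME G. weak_gradient \<Omega> u G)"

definition divergence :: "(real^'n) set \<Rightarrow> (real^'n \<Rightarrow> real^'n) \<Rightarrow> real^'n \<Rightarrow> real" where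
  "divergence \<Omega> u x = trace (grad \<Omega> u x)"

definition weak_derivative :: "real \<Rightarrow> (real \<Rightarrow> real) \<Rightarrow> (real \<Rightarrow> real) \<Rightarrow> bool" where
  "weak_derivative T e D \<longleftrightarrow>
     locally_integrable {0<..<T} e \<and> locally_integrable {0<..<T} D \<and>
     (\<forall>\<phi> :: real \<Rightarrow> real. test_function {0<..<T} \<phi> \<longrightarrow>
        (LINT t|lebesgue_on {0<..<T}. e t * deriv \<phi> t)
          = - (LINT t|lebesgue_on {0<..<T}. D t * \<phi> t))"

subsection \<open>Function spaces on the domain\<close>

definition inner_L2 ::
    "(real^'n) set \<Rightarrow> (real^'n \<Rightarrow> 'b::euclidean_space) \<Rightarrow> (real^'n \<Rightarrow> 'b) \<Rightarrow> real" where
  "inner_L2 \<Omega> f g = (LINT x|lebesgue_on \<Omega>. f x \<bullet> g x)"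

definition Lp_space :: "(real^'n) set \<Rightarrow> real \<Rightarrow> (real^'n \<Rightarrow> 'b::euclidean_space) set" where
  "Lp_space \<Omega> p = {f \<in> borel_measurable (lebesgue_on \<Omega>).
     integrable (lebesgue_on \<Omega>) (\<lambda>x. norm (f x) powr p)}"

definition Lp_norm :: "(real^'n) set \<Rightarrow> real \<Rightarrow> (real^'n \<Rightarrow> 'b::euclidean_space) \<Rightarrow> real" where
  "Lp_norm \<Omega> p f = (LINT x|lebesgue_on \<Omega>. norm (f x) powr p) powr (1 / p)"

definition W1p_space :: "(real^'n) set \<Rightarrow> real \<Rightarrow> (real^'n \<Rightarrow> real^'n) set" where
  "W1p_space \<Omega> p =
     {u \<in> Lp_space \<Omega> p. (\<exists>G. weak_gradient \<Omega> u G) \<and> grad \<Omega> u \<in> Lp_space \<Omega> p}"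

definition W1p_norm :: "(real^'n) set \<Rightarrow> real \<Rightarrow> (real^'n \<Rightarrow> real^'n) \<Rightarrow> real" where
  "W1p_norm \<Omega> p u = (Lp_norm \<Omega> p u powr p + Lp_norm \<Omega> p (grad \<Omega> u) powr p) powr (1 / p)"

text \<open>
  Vanishing on the boundary is understood in the Sobolev sense, i.e. as membership in the closure
  of the test functions in \<open>W\<^sup>1\<^sup>,\<^sup>3\<close>.
\<close>

definition velocity_space :: "(real^'n) set \<Rightarrow> (real^'n \<Rightarrow> real^'n) set" where
  "velocity_space \<Omega> = {v \<in> W1p_space \<Omega> 3.
     \<forall>\<epsilon>>0. \<exists>\<phi>. test_function \<Omega> \<phi> \<and> W1p_norm \<Omega> 3 (\<lambda>x. v x - \<phi> x) < \<epsilon>}"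

definition pressure_space :: "(real^'n) set \<Rightarrow> (real^'n \<Rightarrow> real) set" where
  "pressure_space \<Omega> = {q \<in> Lp_space \<Omega> 2. (LINT x|lebesgue_on \<Omega>. q x) = 0}"

subsection \<open>Spaces of time-dependent vector fields\<close>

text \<open>
  Strong (Bochner) measurability in time is expressed through jointly measurable representatives
  of the field and of its weak spatial gradient.
\<close>

definition jointly_measurable ::
    "real \<Rightarrow> (real^'n) set \<Rightarrow> (real \<Rightarrow> real^'n \<Rightarrow> 'b::euclidean_space) \<Rightarrow> bool" where
  "jointly_measurable T \<Omega> u \<longleftrightarrow>
     (\<lambda>(t, x). u t x) \<in> borel_measurable (lebesgue_on {0<..<T} \<Otimes>\<^sub>M lebesgue_on \<Omega>)"

definition strongly_measurable_W1 ::
    "real \<Rightarrow> (real^'n) set \<Rightarrow> (real \<Rightarrow> real^'n \<Rightarrow> real^'n) \<Rightarrow> bool" where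
  "strongly_measurable_W1 T \<Omega> u \<longleftrightarrow>
     jointly_measurable T \<Omega> u \<and>
     (\<exists>G. jointly_measurable T \<Omega> G \<and>
        (AE t in lebesgue_on {0<..<T}. weak_gradient \<Omega> (u t) (G t)))"

definition Linf_H1 :: "real \<Rightarrow> (real^'n) set \<Rightarrow> (real \<Rightarrow> real^'n \<Rightarrow> real^'n) set" where
  "Linf_H1 T \<Omega> = {u. strongly_measurable_W1 T \<Omega> u \<and>
     (AE t in lebesgue_on {0<..<T}. u t \<in> W1p_space \<Omega> 2) \<and>
     (\<exists>C. AE t in lebesgue_on {0<..<T}. W1p_norm \<Omega> 2 (u t) \<le> C)}"

definition L2_W13 :: "real \<Rightarrow> (real^'n) set \<Rightarrow> (real \<Rightarrow> real^'n \<Rightarrow> real^'n) set" where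
  "L2_W13 T \<Omega> = {u. strongly_measurable_W1 T \<Omega> u \<and>
     (AE t in lebesgue_on {0<..<T}. u t \<in> W1p_space \<Omega> 3) \<and>
     integrable (lebesgue_on {0<..<T}) (\<lambda>t. (W1p_norm \<Omega> 3 (u t))\<^sup>2)}"

definition L2_L6 :: "real \<Rightarrow> (real^'n) set \<Rightarrow> (real \<Rightarrow> real^'n \<Rightarrow> real^'n) set" where
  "L2_L6 T \<Omega> = {u. jointly_measurable T \<Omega> u \<and>
     (AE t in lebesgue_on {0<..<T}. u t \<in> Lp_space \<Omega> 6) \<and>
     integrable (lebesgue_on {0<..<T}) (\<lambda>t. (Lp_norm \<Omega> 6 (u t))\<^sup>2)}"

definition solution_class :: "real \<Rightarrow> (real^'n) set \<Rightarrow> (real \<Rightarrow> real^'n \<Rightarrow> real^'n) set" where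
  "solution_class T \<Omega> = {u \<in> Linf_H1 T \<Omega> \<inter> L2_W13 T \<Omega> \<inter> L2_L6 T \<Omega>.
     AE t in lebesgue_on {0<..<T}. u t \<in> velocity_space \<Omega>}"

text \<open>
  \<open>w\<^sub>t\<close> is the weak derivative of \<open>w\<close> in the sense of vector-valued distributions on \<open>(0, T)\<close>; it is
  taken in \<open>L\<^sup>1\<close>-\<open>loc(0, T; H\<^sup>1)\<close>, so that both \<open>(w\<^sub>t, v)\<close> and \<open>(\<nabla>w\<^sub>t, \<nabla>v)\<close> are
  \<open>L\<^sup>2\<close> inner products at almost every time.  Under these integrability conditions the Bochner
  integrals over time are given by the integrals of \<open>w t x\<close> and \<open>wt t x\<close> for almost every fixed \<open>x\<close>.
\<close>

definition time_derivative ::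
    "real \<Rightarrow> (real^'n) set \<Rightarrow> (real \<Rightarrow> real^'n \<Rightarrow> real^'n) \<Rightarrow> (real \<Rightarrow> real^'n \<Rightarrow> real^'n) \<Rightarrow> bool"
  where
  "time_derivative T \<Omega> w wt \<longleftrightarrow>
     strongly_measurable_W1 T \<Omega> wt \<and>
     (AE t in lebesgue_on {0<..<T}. wt t \<in> W1p_space \<Omega> 2) \<and>
     locally_integrable {0<..<T} (\<lambda>t. W1p_norm \<Omega> 2 (wt t)) \<and>
     (\<forall>\<phi> :: real \<Rightarrow> real. test_function {0<..<T} \<phi> \<longrightarrow>
        (AE x in lebesgue_on \<Omega>.
           (LINT t|lebesgue_on {0<..<T}. deriv \<phi> t *\<^sub>R w t x)
             = - (LINT t|lebesgue_on {0<..<T}. \<phi> t *\<^sub>R wt t x)))"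

subsection \<open>The Corrected Smagorinsky Model\<close>

text \<open>The momentum equation at a fixed time, with \<open>w\<close>, \<open>wt\<close>, \<open>p\<close>, \<open>v\<close> functions of \<open>x\<close> only.\<close>

definition momentum_weak_form ::
    "(real^'n) set \<Rightarrow> real \<Rightarrow> real \<Rightarrow> real \<Rightarrow> real \<Rightarrow> (real^'n \<Rightarrow> real^'n) \<Rightarrow>
     (real^'n \<Rightarrow> real^'n) \<Rightarrow> (real^'n \<Rightarrow> real^'n) \<Rightarrow> (real^'n \<Rightarrow> real) \<Rightarrow> (real^'n \<Rightarrow> real^'n) \<Rightarrow> bool"
  where
  "momentum_weak_form \<Omega> \<nu> C\<^sub>s \<delta> \<mu> f w wt p v \<longleftrightarrow>
     inner_L2 \<Omega> wt v
     + C\<^sub>s ^ 4 / \<mu>\<^sup>2 * \<delta>\<^sup>2 * inner_L2 \<Omega> (grad \<Omega> wt) (grad \<Omega> v)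
     + inner_L2 \<Omega> (\<lambda>x. grad \<Omega> w x *v w x) v
     + \<nu> * inner_L2 \<Omega> (grad \<Omega> w) (grad \<Omega> v)
     - inner_L2 \<Omega> p (divergence \<Omega> v)
     + inner_L2 \<Omega> (\<lambda>x. ((C\<^sub>s * \<delta>)\<^sup>2 * norm (grad \<Omega> w x)) *\<^sub>R grad \<Omega> w x) (grad \<Omega> v)
     = inner_L2 \<Omega> f v"

definition strong_solution ::
    "(real^'n) set \<Rightarrow> real \<Rightarrow> real \<Rightarrow> real \<Rightarrow> real \<Rightarrow> real \<Rightarrow> (real^'n \<Rightarrow> real^'n) \<Rightarrow>
     (real^'n \<Rightarrow> real^'n) \<Rightarrow> (real \<Rightarrow> real^'n \<Rightarrow> real^'n) \<Rightarrow> bool"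
  where
  "strong_solution \<Omega> T \<nu> C\<^sub>s \<delta> \<mu> f w\<^sub>0 w \<longleftrightarrow>
     w \<in> solution_class T \<Omega> \<and>
     w\<^sub>0 \<in> Lp_space \<Omega> 2 \<and>
     (\<forall>\<^sub>F t in at_right 0. w t \<in> Lp_space \<Omega> 2) \<and>
     ((\<lambda>t. Lp_norm \<Omega> 2 (\<lambda>x. w t x - w\<^sub>0 x)) \<longlongrightarrow> 0) (at_right 0) \<and>
     (\<exists>wt p. time_derivative T \<Omega> w wt \<and>
        (AE t in lebesgue_on {0<..<T}. p t \<in> pressure_space \<Omega>) \<and>
        (\<forall>v\<in>solution_class T \<Omega>. AE t in lebesgue_on {0<..<T}.
           momentum_weak_form \<Omega> \<nu> C\<^sub>s \<delta> \<mu> f (w t) (wt t) (p t) (v t)) \<and>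
        (AE t in lebesgue_on {0<..<T}. \<forall>q\<in>pressure_space \<Omega>.
           inner_L2 \<Omega> q (divergence \<Omega> (w t)) = 0))"

end

theory Submission
  imports Defs
begin

text \<open>
  Formally the estimate is the momentum equation tested with the solution itself. Since \<open>w\<close> lies in
  the class of test fields, this is legitimate at almost every time, and three facts turn the tested
  equation into the energy equality.

  The pressure term \<open>(p, \<nabla> \<cdot> w)\<close> vanishes by the incompressibility condition, and the eddy
  viscosity term is \<open>(C\<^sub>s \<delta>)\<^sup>2\<close> times the integral of \<open>|\<nabla>w|\<^sup>3\<close> by inspection.

  The convective term \<open>(w \<cdot> \<nabla>w, w)\<close> vanishes (\<open>convective_term_zero\<close>). For a test field \<open>\<phi>\<close> the
  integral of \<open>\<partial>\<^sub>j (\<phi>\<^sub>j \<phi>\<^sub>i\<^sup>2)\<close> is zero. Every term in the expansion of this derivative is a product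
  of three factors, so both the identity and the mean-zero property of the divergence survive the
  passage to the closure of the test fields in \<open>W\<^sup>1\<^sup>,\<^sup>3\<close> (\<open>triple_product_integral_tendsto\<close>). On a
  bounded domain the divergence of \<open>w\<close> is then itself an admissible pressure, hence it is zero almost
  everywhere, and summation over \<open>i\<close> and \<open>j\<close> gives the claim.

  The time derivative terms are half the weak derivative of the energy
  (\<open>solution_energy_derivative\<close>). The energy is a weighted sum of squared \<open>L\<^sup>2\<close> norms of scalar
  fields, the components of \<open>w\<close> and of its gradient. For one such field \<open>U\<close> with weak time derivative \<open>V\<close>, the
  function \<open>U(\<cdot>, x)\<close> is for almost every \<open>x\<close> a constant plus a primitive of \<open>V(\<cdot>, x)\<close>, so that its
  square has the weak derivative \<open>2 U V\<close>; integration over \<open>x\<close> and Fubini finish the argument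
  (\<open>energy_weak_derivative\<close>). The exceptional null set of \<open>x\<close> depends on the test function in time,
  so the du Bois-Reymond lemma is needed in a form that uses countably many test functions only. This
  is why the fundamental lemma of the calculus of variations below is restricted to explicit bumps
  over boxes with rational corners. The same lemma shows that weak gradients are unique almost
  everywhere, and that the gradient commutes with the weak time derivative
  (\<open>gradient_time_derivative\<close>).
\<close>

section \<open>Smooth functions and box bumps\<close>

lemma C_k_mono: "C_k (Suc k) f \<Longrightarrow> C_k k f"
proof (induction k arbitrary: f)
  case 0
  then show ?case
    by (auto intro!: continuous_at_imp_continuous_on dest: has_derivative_continuous)
next
  case (Suc k)
  then show ?case by (metis C_k.simps(2))
qed

lemma C_k_const: "C_k k (\<lambda>x. c)"
proof (induction k arbitrary: c)
  case (Suc k)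
  show ?case unfolding C_k.simps(2)
    by (rule exI[of _ "\<lambda>x v. 0"]) (auto intro: Suc)
qed auto

lemma C_k_compose_linear:
  assumes "bounded_linear L" shows "C_k k f \<Longrightarrow> C_k k (\<lambda>x. L (f x))"
proof (induction k arbitrary: f)
  case 0
  then show ?case using assms by (simp add: bounded_linear.continuous_on)
next
  case (Suc k)
  then obtain f' where "\<And>x. (f has_derivative f' x) (at x)" "\<And>v. C_k k (\<lambda>x. f' x v)"
    by auto
  then show ?case unfolding C_k.simps(2)
    by (intro exI[of _ "\<lambda>x v. L (f' x v)"] conjI allI Suc.IH bounded_linear.has_derivative[OF assms])
qed

lemma C_k_add: "C_k k f \<Longrightarrow> C_k k g \<Longrightarrow> C_k k (\<lambda>x. f x + g x)"
proof (induction k arbitrary: f g)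
  case 0
  then show ?case by (auto intro!: continuous_intros)
next
  case (Suc k)
  then obtain f' g' where f: "\<And>x. (f has_derivative f' x) (at x)" "\<And>v. C_k k (\<lambda>x. f' x v)"
    and g: "\<And>x. (g has_derivative g' x) (at x)" "\<And>v. C_k k (\<lambda>x. g' x v)"
    by auto
  then show ?case unfolding C_k.simps(2)
    by (intro exI[of _ "\<lambda>x v. f' x v + g' x v"] conjI allI has_derivative_add Suc.IH)
qed

lemma C_k_mult:
  fixes f g :: "'a::real_normed_vector \<Rightarrow> real"
  shows "C_k k f \<Longrightarrow> C_k k g \<Longrightarrow> C_k k (\<lambda>x. f x * g x)"
proof (induction k arbitrary: f g)
  case 0
  then show ?case by (auto intro!: continuous_intros)
next
  case (Suc k)
  have mono: "C_k k f" "C_k k g" using Suc.prems by (auto intro: C_k_mono simp del: C_k.simps)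
  from Suc.prems obtain f' g' where f: "\<And>x. (f has_derivative f' x) (at x)" "\<And>v. C_k k (\<lambda>x. f' x v)"
    and g: "\<And>x. (g has_derivative g' x) (at x)" "\<And>v. C_k k (\<lambda>x. g' x v)"
    by auto
  show ?case unfolding C_k.simps(2)
    by (intro exI[of _ "\<lambda>x v. f x * g' x v + f' x v * g x"] conjI allI has_derivative_mult f g C_k_add Suc.IH mono)
qed

lemma C_k_compose_affine:
  fixes L :: "'a::real_normed_vector \<Rightarrow> 'b::real_normed_vector"
  assumes "bounded_linear L"
  shows "C_k k f \<Longrightarrow> C_k k (\<lambda>x. f (L x + c))"
proof (induction k arbitrary: f)
  case 0
  have "continuous_on UNIV (\<lambda>x. L x + c)"
    using assms by (intro continuous_intros linear_continuous_on)
  then show ?case using 0 by (auto intro: continuous_on_compose2)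
next
  case (Suc k)
  then obtain f' where f: "\<And>x. (f has_derivative f' x) (at x)" "\<And>v. C_k k (\<lambda>x. f' x v)"
    by auto
  have "((\<lambda>x. L x + c) has_derivative L) (at x)" for x
    using bounded_linear_imp_has_derivative[OF assms] by (auto intro!: derivative_eq_intros)
  then have "((\<lambda>x. f (L x + c)) has_derivative (\<lambda>v. f' (L x + c) (L v))) (at x)" for x
    by (rule has_derivative_compose) (rule f)
  moreover have "C_k k (\<lambda>x. f' (L x + c) (L v))" for v by (rule Suc.IH[OF f(2)])
  ultimately show ?case unfolding C_k.simps(2)
    by (intro exI[of _ "\<lambda>x v. f' (L x + c) (L v)"]) auto
qed

lemma C_k_prod:
  fixes f :: "'i \<Rightarrow> 'a::real_normed_vector \<Rightarrow> real"
  assumes "\<And>i. i \<in> I \<Longrightarrow> C_k k (f i)"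
  shows "C_k k (\<lambda>x. \<Prod>i\<in>I. f i x)"
  using assms
proof (induction I rule: infinite_finite_induct)
  case (insert i I)
  then have "C_k k (\<lambda>x. f i x * (\<Prod>j\<in>I. f j x))" by (intro C_k_mult) simp_all
  with insert show ?case by simp
qed (simp_all add: C_k_const)

lemma C_k_antiderivative:
  fixes F :: "real \<Rightarrow> real"
  assumes "\<And>t. (F has_real_derivative f t) (at t)" "\<And>k. C_k k f"
  shows "C_k k F"
proof (rule C_k_mono)
  have "(\<lambda>x. f x * v) = (\<lambda>x. v *\<^sub>R f x)" for v by auto
  then have "C_k k (\<lambda>x. f x * v)" for v
    using C_k_compose_linear[OF bounded_linear_scaleR_right, of k f v] assms(2) by simp
  then show "C_k (Suc k) F" unfolding C_k.simps(2)
    by (intro exI[of _ "\<lambda>t v. f t * v"]) (use assms(1) in \<open>auto simp: has_field_derivative_def\<close>)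
qed

text \<open>
  The standard function that is smooth on the whole line although it vanishes exactly on
  the nonpositive half-line; all bumps are built from it.
\<close>

definition flat_exp :: "real \<Rightarrow> real" where
  "flat_exp s = (if s > 0 then exp (- inverse s) else 0)"

text \<open>
  The polynomial factor is what makes the induction on the order work: the family of all
  \<open>p(1/s) exp(-1/s)\<close>, extended by zero, is closed under differentiation, the derivative at zero
  existing because the exponential beats every power of \<open>1/s\<close>.
\<close>

lemma C_k_flat_exp_poly:
  "C_k k (\<lambda>s. poly p (inverse s) * flat_exp s)"
proof (induction k arbitrary: p)
  have lim: "((\<lambda>s. poly p (inverse s) * flat_exp s) \<longlongrightarrow> 0) (at 0)" for p
  proof -
    have *: "((\<lambda>u. poly p u / exp u) \<longlongrightarrow> (0::real)) at_top"
    proof -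
      have "((\<lambda>u. \<Sum>i\<le>degree p. coeff p i * (u ^ i / exp u)) \<longlongrightarrow> (\<Sum>i\<le>degree p. coeff p i * 0)) at_top"
        by (intro tendsto_intros tendsto_power_div_exp_0)
      then show ?thesis by (simp add: poly_altdef sum_divide_distrib)
    qed
    have "((\<lambda>s. poly p (inverse s) / exp (inverse s)) \<longlongrightarrow> 0) (at_right 0)"
      by (rule filterlim_compose[OF * filterlim_inverse_at_top_right])
    then have r: "((\<lambda>s. poly p (inverse s) * flat_exp s) \<longlongrightarrow> 0) (at_right 0)"
      by (rule Lim_transform_eventually)
        (auto simp: eventually_at_filter flat_exp_def exp_minus divide_inverse)
    have "((\<lambda>s. 0) \<longlongrightarrow> 0) (at_left (0::real))" by simp
    then have l: "((\<lambda>s. poly p (inverse s) * flat_exp s) \<longlongrightarrow> 0) (at_left 0)"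
      by (rule Lim_transform_eventually)
        (auto simp: flat_exp_def eventually_at_filter)
    show ?thesis using l r filterlim_at_split by blast
  qed
  have der: "((\<lambda>s. poly p (inverse s) * flat_exp s) has_real_derivative
       poly ((p - pderiv p) * [:0,0,1:]) (inverse s) * flat_exp s) (at s)" for p s
  proof -
    consider "s > 0" | "s < 0" | "s = 0" by linarith
    then show ?thesis
    proof cases
      case 1
      have "((\<lambda>s. poly p (inverse s) * exp (- inverse s)) has_real_derivative
         poly ((p - pderiv p) * [:0,0,1:]) (inverse s) * flat_exp s) (at s)"
        using 1 by (auto intro!: derivative_eq_intros simp: flat_exp_def field_simps power2_eq_square)
      then show ?thesis
        by (rule DERIV_cong_ev[THEN iffD1, rotated -1])
          (use 1 eventually_nhds_in_open[of "{0<..}" s] in \<open>auto elim!: eventually_mono simp: flat_exp_def\<close>)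
    next
      case 2
      have "((\<lambda>s. 0) has_real_derivative 0) (at s)" by simp
      then have "((\<lambda>s. poly p (inverse s) * flat_exp s) has_real_derivative 0) (at s)"
        by (rule DERIV_cong_ev[THEN iffD1, rotated -1])
          (use 2 eventually_nhds_in_open[of "{..<0}" s] in \<open>auto elim!: eventually_mono simp: flat_exp_def\<close>)
      then show ?thesis using 2 by (simp add: flat_exp_def)
    next
      case 3
      have "(\<lambda>h. (poly p (inverse (0 + h)) * flat_exp (0 + h) - poly p (inverse 0) * flat_exp 0) / h)
          = (\<lambda>h. poly (p * [:0,1:]) (inverse h) * flat_exp h)"
        by (auto simp: flat_exp_def field_simps fun_eq_iff)
      then have "((\<lambda>h. (poly p (inverse (0 + h)) * flat_exp (0 + h) - poly p (inverse 0) * flat_exp 0) / h) \<longlongrightarrow> 0) (at 0)"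
        using lim[of "p * [:0,1:]"] by (simp only:)
      then have "((\<lambda>s. poly p (inverse s) * flat_exp s) has_real_derivative 0) (at 0)"
        by (rule DERIV_def[THEN iffD2])
      moreover have "flat_exp 0 = 0" by (simp add: flat_exp_def)
      ultimately show ?thesis unfolding 3 by (simp only: mult_zero_right)
    qed
  qed
  {
    case 0
    then show ?case using der
      by (auto intro!: continuous_at_imp_continuous_on DERIV_isCont)
  next
    case (Suc k)
    let ?q = "(p - pderiv p) * [:0,0,1:]"
    have "C_k k (\<lambda>x. poly ?q (inverse x) * flat_exp x * v)" for v
      using Suc[of "smult v ?q"] by (simp add: mult_ac)
    then show ?case unfolding C_k.simps(2)
      using der by (intro exI[of _ "\<lambda>x v. poly ?q (inverse x) * flat_exp x * v"])
         (auto simp: has_field_derivative_def)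
  }
qed

lemma C_k_flat_exp: "C_k k flat_exp"
  using C_k_flat_exp_poly[of k 1] by simp

lemma flat_exp_bounds: "0 \<le> flat_exp s" "flat_exp s \<le> 1"
  by (auto simp: flat_exp_def)

lemma flat_exp_limit:
  assumes "s > 0" shows "(\<lambda>n. flat_exp (real n * s)) \<longlonglongrightarrow> 1"
proof -
  have "(\<lambda>n. exp (- (inverse s * inverse (real n)))) \<longlonglongrightarrow> exp (- (inverse s * 0))"
    by (intro tendsto_intros lim_inverse_n)
  moreover have "\<forall>\<^sub>F n in sequentially. exp (- (inverse s * inverse (real n))) = flat_exp (real n * s)"
    using eventually_gt_at_top[of 0]
    by eventually_elim (use assms in \<open>auto simp: flat_exp_def\<close>)
  ultimately show ?thesis by (auto intro: Lim_transform_eventually)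
qed

text \<open>
  Each factor vanishes on one side of a face of the box and tends to 1 on the other side as
  \<open>n\<close> grows, so that the bumps converge boundedly to the indicator of the open box.
\<close>

definition bump :: "'a::euclidean_space \<Rightarrow> 'a \<Rightarrow> nat \<Rightarrow> 'a \<Rightarrow> real" where
  "bump a b n x =
     (\<Prod>i\<in>Basis. flat_exp (real n * (x \<bullet> i - a \<bullet> i)) * flat_exp (real n * (b \<bullet> i - x \<bullet> i)))"

lemma C_k_bump: "C_k k (bump a b n)"
proof -
  have 1: "bounded_linear (\<lambda>x. real n * (x \<bullet> i))" for i :: 'a
    by (intro bounded_linear_intros)
  have 2: "bounded_linear (\<lambda>x. - real n * (x \<bullet> i))" for i :: 'a
    by (intro bounded_linear_intros)
  have "C_k k (\<lambda>x. \<Prod>i\<in>Basis. flat_exp (real n * (x \<bullet> i) + (- real n * (a \<bullet> i)))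
      * flat_exp (- real n * (x \<bullet> i) + real n * (b \<bullet> i)))"
    by (intro C_k_prod C_k_mult C_k_compose_affine[OF 1 C_k_flat_exp] C_k_compose_affine[OF 2 C_k_flat_exp])
  then show ?thesis
    by (simp add: bump_def[abs_def] algebra_simps)
qed

lemma bump_nonneg: "0 \<le> bump a b n x"
  unfolding bump_def by (intro prod_nonneg mult_nonneg_nonneg flat_exp_bounds)

lemma bump_le_1: "bump a b n x \<le> 1"
  unfolding bump_def
  by (rule prod_le_1) (simp add: flat_exp_bounds mult_le_one)

lemma bump_eq_0:
  assumes "x \<notin> box a b" shows "bump a b n x = 0"
proof -
  obtain i where i: "i \<in> Basis" "x \<bullet> i \<le> a \<bullet> i \<or> b \<bullet> i \<le> x \<bullet> i"
    using assms by (force simp: mem_box)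
  then have "real n * (x \<bullet> i - a \<bullet> i) \<le> 0 \<or> real n * (b \<bullet> i - x \<bullet> i) \<le> 0"
    by (auto intro: mult_nonneg_nonpos)
  then have "flat_exp (real n * (x \<bullet> i - a \<bullet> i)) * flat_exp (real n * (b \<bullet> i - x \<bullet> i)) = 0"
    by (auto simp: flat_exp_def)
  with i show ?thesis unfolding bump_def by (intro prod_zero) auto
qed

lemma bump_limit: "(\<lambda>n. bump a b n x) \<longlonglongrightarrow> indicator (box a b) x"
proof (cases "x \<in> box a b")
  case True
  have "(\<lambda>n. bump a b n x) \<longlonglongrightarrow> (\<Prod>i\<in>(Basis::'a set). 1 * 1)"
    unfolding bump_def using True
    by (intro tendsto_prod tendsto_mult flat_exp_limit) (auto simp: mem_box)
  then show ?thesis using True by simp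
qed (simp add: bump_eq_0)

lemma closure_support_bump: "closure {x. bump a b n x \<noteq> 0} \<subseteq> cbox a b"
proof (rule closure_minimal)
  show "{x. bump a b n x \<noteq> 0} \<subseteq> cbox a b"
    using bump_eq_0[of _ a b n] box_subset_cbox[of a b] by blast
qed (rule closed_cbox)

lemma test_function_bump: "cbox a b \<subseteq> U \<Longrightarrow> test_function U (bump a b n)"
proof -
  have "compact (cbox a b \<inter> closure {x. bump a b n x \<noteq> 0})"
    by (rule compact_Int_closed) auto
  then show "cbox a b \<subseteq> U \<Longrightarrow> test_function U (bump a b n)"
    unfolding test_function_def using closure_support_bump[of a b n] C_k_bump[of _ a b n]
    by (simp add: Int_absorb1 subset_trans)
qed

lemma bump_measurable: "bump a b n \<in> borel_measurable borel"
  by (rule borel_measurable_continuous_onI) (rule C_k.simps(1)[THEN iffD1], rule C_k_bump)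

section \<open>The fundamental lemma with countably many test functions\<close>

definition rational_point :: "'a::euclidean_space \<Rightarrow> bool" where
  "rational_point a \<longleftrightarrow> (\<forall>i\<in>Basis. a \<bullet> i \<in> \<rat>)"

lemma countable_rational_points: "countable (Collect (rational_point :: 'a::euclidean_space \<Rightarrow> bool))"
proof -
  have "Collect (rational_point :: 'a \<Rightarrow> bool) \<subseteq> (\<lambda>f. \<Sum>i\<in>Basis. f i *\<^sub>R i) ` (Basis \<rightarrow>\<^sub>E \<rat>)"
  proof
    fix a :: 'a assume a: "a \<in> Collect rational_point"
    have "a = (\<Sum>i\<in>Basis. (\<lambda>i\<in>Basis. a \<bullet> i) i *\<^sub>R i)" by (simp add: euclidean_representation)
    moreover have "(\<lambda>i\<in>Basis. a \<bullet> i) \<in> Basis \<rightarrow>\<^sub>E \<rat>" using a by (auto simp: rational_point_def)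
    ultimately show "a \<in> (\<lambda>f. \<Sum>i\<in>Basis. f i *\<^sub>R i) ` (Basis \<rightarrow>\<^sub>E \<rat>)" by blast
  qed
  then show ?thesis
    by (rule countable_subset) (auto intro!: countable_PiE simp: countable_rat)
qed

lemma rational_boxes_sigma:
  "sets (borel :: 'a::euclidean_space measure) =
     sigma_sets UNIV {box a b | a b. rational_point a \<and> rational_point b}" (is "_ = sigma_sets UNIV ?E")
proof
  have "sets (borel :: 'a measure) = sigma_sets UNIV {S. open S}"
    by (simp add: borel_def)
  also have "\<dots> \<subseteq> sigma_sets UNIV ?E"
  proof (rule sigma_sets_mono, rule subsetI)
    fix M :: "'a set" assume "M \<in> {S. open S}"
    then have M: "open M" by simp
    let ?I = "{(a, b). rational_point a \<and> rational_point b \<and> box a b \<subseteq> M}"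
    have "M = (\<Union>(a, b)\<in>?I. box a b)"
    proof (intro equalityI subsetI)
      fix x assume "x \<in> M"
      then obtain e where e: "e > 0" "ball x e \<subseteq> M" using M openE by blast
      obtain a b where "x \<in> box a b" "\<forall>i\<in>Basis. a \<bullet> i \<in> \<rat>" "\<forall>i\<in>Basis. b \<bullet> i \<in> \<rat>" "box a b \<subseteq> ball x e"
        using rational_boxes[OF e(1)] by metis
      then show "x \<in> (\<Union>(a, b)\<in>?I. box a b)" using e
        by (intro UN_I[of "(a, b)"]) (auto simp: rational_point_def)
    qed auto
    moreover have "countable ?I"
      by (rule countable_subset[of _ "Collect rational_point \<times> Collect rational_point"])
        (auto intro: countable_rational_points)
    ultimately show "M \<in> sigma_sets UNIV ?E"
      by (subst \<open>M = _\<close>, intro sigma_sets_UNION countable_image) (auto intro: sigma_sets.Basic)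
  qed
  finally show "sets (borel :: 'a measure) \<subseteq> sigma_sets UNIV ?E" .
  show "sigma_sets UNIV ?E \<subseteq> sets borel"
    by (rule sets.sigma_sets_subset[of _ borel, simplified]) (auto simp: open_box)
qed

lemma rational_box_Int:
  fixes a b c d :: "'a::euclidean_space"
  assumes "rational_point a" "rational_point b" "rational_point c" "rational_point d"
  obtains a' b' where "rational_point a'" "rational_point b'" "box a b \<inter> box c d = box a' b'"
proof -
  let ?a = "\<Sum>i\<in>Basis. max (a \<bullet> i) (c \<bullet> i) *\<^sub>R i" and ?b = "\<Sum>i\<in>Basis. min (b \<bullet> i) (d \<bullet> i) *\<^sub>R i"
  have "box a b \<inter> box c d = box ?a ?b" by (rule box_Int_box)
  then show ?thesis using assms by (intro that[of ?a ?b]) (auto simp: rational_point_def max_def min_def)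
qed

text \<open>
  The sets over which the integral vanishes form a Dynkin system (the hypothesis on the total
  integral gives the complements), and boxes with rational corners are closed under intersection and
  generate the Borel sets.
\<close>

lemma AE_zero_if_rational_box_integrals_zero:
  fixes g :: "'a::euclidean_space \<Rightarrow> real"
  assumes g: "integrable lborel g"
    and total: "integral\<^sup>L lborel g = 0"
    and box: "\<And>a b. rational_point a \<Longrightarrow> rational_point b \<Longrightarrow> (LINT x:box a b|lborel. g x) = 0"
  shows "AE x in lborel. g x = 0"
proof (rule sigma_finite_measure.density_zero[OF sigma_finite_lborel g])
  fix A :: "'a set" assume "A \<in> sets lborel"
  then have A: "A \<in> sigma_sets UNIV {box a b | a b :: 'a. rational_point a \<and> rational_point b}"
    by (simp add: rational_boxes_sigma)
  have S: "Int_stable {box a b | a b :: 'a. rational_point a \<and> rational_point b}"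
    by (auto simp: Int_stable_def) (metis rational_box_Int)
  have E: "{box a b | a b :: 'a. rational_point a \<and> rational_point b} \<subseteq> Pow UNIV" by simp
  have [measurable]: "X \<in> sets borel"
    if "X \<in> sigma_sets UNIV {box a b | a b :: 'a. rational_point a \<and> rational_point b}" for X
    using that by (simp add: rational_boxes_sigma)
  have si: "set_integrable lborel X g" if "X \<in> sets borel" for X
    using integrable_mult_indicator[OF _ g, of X] that by (simp add: set_integrable_def)
  show "(LINT x:A|lborel. g x) = 0"
    using S E A
  proof (induction rule: sigma_sets_induct_disjoint)
    case (compl A)
    then have "A \<in> sets borel" by simp
    have "(LINT x:A \<union> (UNIV - A)|lborel. g x) = (LINT x:A|lborel. g x) + (LINT x:UNIV - A|lborel. g x)"
      using \<open>A \<in> sets borel\<close> by (intro set_integral_Un si) auto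
    then show ?case using compl total by (simp add: set_lebesgue_integral_def)
  next
    case (union A)
    have [measurable]: "A i \<in> sets borel" for i using union(2) by (auto simp: rational_boxes_sigma)
    have "(LINT x:(\<Union>i. A i)|lborel. g x) = (\<Sum>i. (LINT x:A i|lborel. g x))"
      using union by (intro lebesgue_integral_countable_add si) (auto simp: disjoint_family_on_def sets.countable_UN)
    then show ?case using union by simp
  qed (use box in \<open>auto simp: set_lebesgue_integral_def\<close>)
qed

text \<open>
  The fundamental lemma of the calculus of variations, tested by countably many functions
  only. On a box whose closure lies in \<open>U\<close> the function is integrable, dominated convergence
  replaces the bumps by indicators of boxes, and countably many such boxes cover \<open>U\<close>.
\<close>

lemma AE_zero_if_bump_integrals_zero:
  fixes f :: "'a::euclidean_space \<Rightarrow> real"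
  assumes U: "open U" and f: "locally_integrable U f"
    and zero: "\<And>a b n. rational_point a \<Longrightarrow> rational_point b \<Longrightarrow> cbox a b \<subseteq> U \<Longrightarrow>
      (LINT x|lebesgue_on U. f x * bump a b n x) = 0"
  shows "AE x in lebesgue_on U. f x = 0"
proof -
  have U': "U \<in> sets lebesgue" using U by auto
  have box: "AE x in lebesgue. x \<in> box c d \<longrightarrow> f x = 0"
    if c: "rational_point c" and d: "rational_point d" and cd: "cbox c d \<subseteq> U" for c d
  proof -
    have "integrable (lebesgue_on (cbox c d)) f"
      using f cd by (auto simp: locally_integrable_def)
    then have "integrable lebesgue (\<lambda>x. indicator (cbox c d) x *\<^sub>R f x)"
      using integrable_restrict_space[of "cbox c d" lebesgue f] by simp
    then have "integrable lebesgue (\<lambda>x. indicator (box c d) x *\<^sub>R (indicator (cbox c d) x *\<^sub>R f x))"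
      by (rule integrable_mult_indicator[rotated]) auto
    moreover have "(\<lambda>x. indicator (box c d) x *\<^sub>R (indicator (cbox c d) x *\<^sub>R f x)) = (\<lambda>x. indicator (box c d) x * f x)"
      using box_subset_cbox[of c d] by (auto simp: indicator_def fun_eq_iff)
    ultimately have h: "integrable lebesgue (\<lambda>x. indicator (box c d) x * f x)" (is "integrable _ ?h") by (simp only:)
    then obtain g where g[measurable]: "g \<in> borel_measurable lborel" and hg: "AE x in lborel. ?h x = g x"
      using completion_ex_borel_measurable_real[of ?h lborel] by auto
    have hg': "AE x in lebesgue. ?h x = g x" by (rule AE_completion[OF hg])
    have g': "g \<in> borel_measurable lebesgue" using g by (rule measurable_completion)
    have "integrable lebesgue g"
      using integrable_cong_AE[THEN iffD1, OF _ g' hg' h] h by auto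
    then have gi: "integrable lborel g" using g by (simp add: integrable_completion)
    have gbox: "(LINT x:box a b|lborel. g x) = 0" if "rational_point a" "rational_point b" for a b
    proof -
      obtain a' b' where ab: "rational_point a'" "rational_point b'" "box a b \<inter> box c d = box a' b'"
        using rational_box_Int[OF \<open>rational_point a\<close> \<open>rational_point b\<close> c d] by metis
      have "(LINT x:box a b|lborel. g x) = (LINT x|lebesgue. indicator (box a b) x *\<^sub>R g x)"
        unfolding set_lebesgue_integral_def by (subst integral_completion) auto
      also have "\<dots> = (LINT x|lebesgue. indicator (box a b) x *\<^sub>R ?h x)"
        using hg' g' h by (intro integral_cong_AE borel_measurable_scaleR borel_measurable_indicator) auto
      also have "\<dots> = (LINT x|lebesgue. indicator (box a' b') x * ?h x)"
        using ab(3) by (intro Bochner_Integration.integral_cong) (auto simp: indicator_def)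
      also have "\<dots> = 0"
      proof (cases "box a' b' = {}")
        case False
        have "cbox a' b' \<subseteq> cbox c d"
          using ab(3) False by (metis closure_box closure_mono empty_subsetI inf.cobounded2 inf_bot_right)
        then have sub: "cbox a' b' \<subseteq> U" using cd by auto
        have "(LINT x|lebesgue. bump a' b' n x * ?h x) = 0" for n
        proof -
          have "(LINT x|lebesgue. bump a' b' n x * ?h x) = (LINT x|lebesgue. indicator U x *\<^sub>R (f x * bump a' b' n x))"
            using ab(3) sub box_subset_cbox[of a' b'] bump_eq_0[of _ a' b' n]
            by (intro Bochner_Integration.integral_cong) (auto simp: indicator_def)
          also have "\<dots> = (LINT x|lebesgue_on U. f x * bump a' b' n x)"
            using U' by (subst integral_restrict_space) auto
          finally show ?thesis using zero[OF ab(1,2) sub] by simp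
        qed
        moreover have "(\<lambda>n. LINT x|lebesgue. bump a' b' n x * ?h x) \<longlonglongrightarrow> (LINT x|lebesgue. indicator (box a' b') x * ?h x)"
        proof (rule integral_dominated_convergence[where w="\<lambda>x. norm (?h x)"])
          show "(\<lambda>x. bump a' b' n x * ?h x) \<in> borel_measurable lebesgue" for n
          proof (rule borel_measurable_times)
            show "bump a' b' n \<in> borel_measurable lebesgue"
              by (intro measurable_completion) (simp add: bump_measurable)
          qed (rule borel_measurable_integrable[OF h])
          show "(\<lambda>x. indicator (box a' b') x * ?h x) \<in> borel_measurable lebesgue"
            using borel_measurable_integrable[OF h] borel_measurable_indicator[of "box a' b'" lebesgue]
            by (intro borel_measurable_times[of "indicator (box a' b')"]) simp_all
          show "integrable lebesgue (\<lambda>x. norm (?h x))" using h by (rule integrable_norm)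
          show "AE x in lebesgue. (\<lambda>n. bump a' b' n x * ?h x) \<longlonglongrightarrow> indicator (box a' b') x * ?h x"
            by (intro AE_I2 tendsto_mult bump_limit tendsto_const)
          show "AE x in lebesgue. norm (bump a' b' n x * ?h x) \<le> norm (?h x)" for n
            using bump_nonneg[of a' b' n] bump_le_1[of a' b' n]
            by (intro AE_I2) (simp add: abs_mult mult_left_le_one_le)
        qed
        ultimately show ?thesis by (simp only: LIMSEQ_const_iff)
      qed simp
      finally show ?thesis .
    qed
    have "integral\<^sup>L lborel g = (LINT x:box c d|lborel. g x)"
      unfolding set_lebesgue_integral_def using hg
      by (intro integral_cong_AE) (auto simp: indicator_def elim!: eventually_mono)
    then have "AE x in lborel. g x = 0"
      using gi gbox c d by (intro AE_zero_if_rational_box_integrals_zero) auto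
    then have "AE x in lborel. ?h x = 0" using hg by eventually_elim simp
    then show ?thesis by (intro AE_completion) (auto elim!: eventually_mono simp: indicator_def)
  qed
  let ?I = "{(a, b). rational_point a \<and> rational_point b \<and> cbox a b \<subseteq> U}"
  have "countable ?I"
    by (rule countable_subset[of _ "Collect rational_point \<times> Collect rational_point"])
      (auto intro: countable_rational_points)
  then have "AE x in lebesgue. \<forall>p\<in>?I. x \<in> box (fst p) (snd p) \<longrightarrow> f x = 0"
    by (subst AE_ball_countable) (auto intro: box)
  then have "AE x in lebesgue. x \<in> U \<longrightarrow> f x = 0"
  proof eventually_elim
    case (elim x)
    show ?case
    proof
      assume "x \<in> U"
      then obtain e where e: "e > 0" "cball x e \<subseteq> U" using U open_contains_cball by blast
      obtain a b where ab: "x \<in> box a b" "\<forall>i\<in>Basis. a \<bullet> i \<in> \<rat>" "\<forall>i\<in>Basis. b \<bullet> i \<in> \<rat>" "box a b \<subseteq> ball x e"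
        using rational_boxes[OF e(1)] by metis
      have "cbox a b \<subseteq> cball x e"
        using closure_mono[OF ab(4)] ab(1) e(1) closure_box[of a b] by (metis closure_ball empty_iff)
      then have "(a, b) \<in> ?I" using ab e by (auto simp: rational_point_def)
      then show "f x = 0" using elim ab(1) by force
    qed
  qed
  then show ?thesis using U' by (simp add: AE_restrict_space_iff)
qed

section \<open>Calculus of test functions\<close>

lemma continuous_integrable_lebesgue_on_compact:
  fixes f :: "'a::euclidean_space \<Rightarrow> 'b::euclidean_space"
  assumes "compact K" "continuous_on K f"
  shows "integrable (lebesgue_on K) f"
proof -
  have *: "integrable lborel (\<lambda>x. indicator K x *\<^sub>R f x)"
    using assms by (rule borel_integrable_compact)
  then have "integrable lebesgue (\<lambda>x. indicator K x *\<^sub>R f x)"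
    by (subst integrable_completion) auto
  moreover have "K \<in> sets lebesgue" using assms(1) by (simp add: compact_imp_closed)
  ultimately show ?thesis by (simp add: integrable_restrict_space)
qed

lemma C_k_has_derivative:
  assumes "C_k (Suc k) f"
  shows "(f has_derivative frechet_derivative f (at x)) (at x)"
  using assms by (auto simp: frechet_derivative_works[symmetric] differentiable_def)

lemma C_k_frechet_derivative:
  assumes "C_k (Suc k) f"
  shows "C_k k (\<lambda>x. frechet_derivative f (at x) v)"
proof -
  obtain f' where f: "\<And>x. (f has_derivative f' x) (at x)" "\<And>v. C_k k (\<lambda>x. f' x v)"
    using assms by auto
  have "frechet_derivative f (at x) = f' x" for x
    using frechet_derivative_at[OF f(1)] by simp
  then show ?thesis using f(2) by simp
qed

lemma test_function_C_k: "test_function U \<phi> \<Longrightarrow> C_k k \<phi>"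
  by (simp add: test_function_def)

lemma test_function_has_derivative:
  "test_function U \<phi> \<Longrightarrow> (\<phi> has_derivative frechet_derivative \<phi> (at x)) (at x)"
  using C_k_has_derivative[of 0] test_function_C_k by metis

lemma test_function_continuous: "test_function U \<phi> \<Longrightarrow> continuous_on S \<phi>"
  using test_function_C_k[of U \<phi> 0] by (auto intro: continuous_on_subset)

lemma test_function_supp:
  assumes "\<And>k. C_k k \<psi>" "\<And>x. x \<notin> closure {x. \<phi> x \<noteq> 0} \<Longrightarrow> \<psi> x = 0" "test_function U \<phi>"
  shows "test_function U \<psi>"
proof -
  have sub: "closure {x. \<psi> x \<noteq> 0} \<subseteq> closure {x. \<phi> x \<noteq> 0}"
    using assms(2) by (intro closure_minimal) auto
  then have "compact (closure {x. \<phi> x \<noteq> 0} \<inter> closure {x. \<psi> x \<noteq> 0})"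
    using assms(3) by (intro compact_Int_closed) (auto simp: test_function_def)
  then show ?thesis
    using sub assms by (simp add: test_function_def Int_absorb1 subset_trans)
qed

lemma test_function_frechet_derivative:
  assumes "test_function U \<phi>"
  shows "test_function U (\<lambda>x. frechet_derivative \<phi> (at x) v)"
proof (rule test_function_supp[OF _ _ assms])
  show "C_k k (\<lambda>x. frechet_derivative \<phi> (at x) v)" for k
    by (intro C_k_frechet_derivative test_function_C_k[OF assms])
  fix x assume x: "x \<notin> closure {x. \<phi> x \<noteq> 0}"
  have "((\<lambda>_. 0) has_derivative (\<lambda>_. 0)) (at x)" by simp
  then have "(\<phi> has_derivative (\<lambda>_. 0)) (at x)"
  proof (rule has_derivative_transform_within_open)
    show "open (- closure {x. \<phi> x \<noteq> 0})" by auto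
    show "0 = \<phi> y" if "y \<in> - closure {x. \<phi> x \<noteq> 0}" for y
      using that closure_subset[of "{x. \<phi> x \<noteq> 0}"] by auto
  qed (use x in auto)
  then show "frechet_derivative \<phi> (at x) v = 0"
    using frechet_derivative_at by metis
qed

lemma test_function_mult:
  fixes \<phi> \<psi> :: "'a::euclidean_space \<Rightarrow> real"
  assumes "test_function U \<phi>" "\<And>k. C_k k \<psi>"
  shows "test_function U (\<lambda>x. \<phi> x * \<psi> x)"
proof (rule test_function_supp[OF _ _ assms(1)])
  show "\<phi> x * \<psi> x = 0" if "x \<notin> closure {x. \<phi> x \<noteq> 0}" for x
    using that closure_subset[of "{x. \<phi> x \<noteq> 0}"] by auto
qed (intro C_k_mult assms test_function_C_k[OF assms(1)])

lemma test_function_linear: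
  assumes "test_function U \<phi>" "bounded_linear L"
  shows "test_function U (\<lambda>x. L (\<phi> x))"
proof (rule test_function_supp[OF _ _ assms(1)])
  show "L (\<phi> x) = 0" if "x \<notin> closure {x. \<phi> x \<noteq> 0}" for x
  proof -
    have "\<phi> x = 0" using that closure_subset[of "{x. \<phi> x \<noteq> 0}"] by auto
    then show ?thesis using linear_0[OF bounded_linear.linear[OF assms(2)]] by simp
  qed
qed (rule C_k_compose_linear[OF assms(2) test_function_C_k[OF assms(1)]])

lemma test_function_nth:
  fixes \<phi> :: "'a::euclidean_space \<Rightarrow> 'b::real_normed_vector^'m"
  shows "test_function U \<phi> \<Longrightarrow> test_function U (\<lambda>x. \<phi> x $ i)"
  by (rule test_function_linear[OF _ bounded_linear_vec_nth])

lemma test_function_bounded: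
  assumes "test_function U \<phi>"
  obtains B where "B > 0" "\<And>x. norm (\<phi> x) \<le> B"
proof -
  let ?K = "closure {x. \<phi> x \<noteq> 0}"
  have "compact (\<phi> ` ?K)"
    using assms by (intro compact_continuous_image test_function_continuous) (auto simp: test_function_def)
  then obtain B where B: "B > 0" "\<And>y. y \<in> \<phi> ` ?K \<Longrightarrow> norm y \<le> B"
    using compact_imp_bounded bounded_pos by metis
  have "norm (\<phi> x) \<le> B" for x
    using B closure_subset[of "{x. \<phi> x \<noteq> 0}"] by (cases "\<phi> x = 0") auto
  with B(1) show ?thesis by (rule that)
qed

lemma test_function_measurable:
  "test_function U \<phi> \<Longrightarrow> \<phi> \<in> borel_measurable borel"
  by (intro borel_measurable_continuous_onI test_function_continuous)

lemma test_function_measurable_lebesgue_on: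
  "test_function U \<phi> \<Longrightarrow> \<phi> \<in> borel_measurable (lebesgue_on S)"
  by (intro measurable_restrict_space1 measurable_completion) (simp add: test_function_measurable)

lemma test_function_eq_0: "test_function U \<phi> \<Longrightarrow> x \<notin> U \<Longrightarrow> \<phi> x = 0"
  using closure_subset[of "{x. \<phi> x \<noteq> 0}"] by (auto simp: test_function_def)

lemma integrable_mult_compact_support:
  fixes f k :: "'a::euclidean_space \<Rightarrow> real"
  assumes U: "U \<in> sets lebesgue" and f: "locally_integrable U f" and K: "compact K" "K \<subseteq> U"
    and k: "k \<in> borel_measurable (lebesgue_on U)" and B: "\<And>x. \<bar>k x\<bar> \<le> B"
    and out: "\<And>x. x \<notin> K \<Longrightarrow> k x = 0"
  shows "integrable (lebesgue_on U) (\<lambda>x. f x * k x)"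
proof -
  have "integrable (lebesgue_on K) (\<lambda>x. k x * f x)"
  proof (rule Bochner_Integration.integrable_bound)
    have *: "integrable (lebesgue_on K) f" using f K by (auto simp: locally_integrable_def)
    then show "integrable (lebesgue_on K) (\<lambda>x. B * f x)" by simp
    show "(\<lambda>x. k x * f x) \<in> borel_measurable (lebesgue_on K)"
      by (rule borel_measurable_times[OF measurable_restrict_mono[OF k K(2)] borel_measurable_integrable[OF *]])
    show "AE x in lebesgue_on K. norm (k x * f x) \<le> norm (B * f x)"
      using B by (intro AE_I2) (auto simp: abs_mult intro!: mult_right_mono intro: order_trans[OF _ abs_ge_self])
  qed
  then have "integrable lebesgue (\<lambda>x. indicator K x *\<^sub>R (k x * f x))"
    using integrable_restrict_space[of K lebesgue "\<lambda>x. k x * f x"] K(1) by (simp add: compact_imp_closed)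
  moreover have "(\<lambda>x. indicator K x *\<^sub>R (k x * f x)) = (\<lambda>x. indicator U x *\<^sub>R (f x * k x))"
    using out K(2) by (auto simp: indicator_def fun_eq_iff)
  ultimately show ?thesis
    using U integrable_restrict_space[of U lebesgue "\<lambda>x. f x * k x"] by simp
qed

lemma integrable_mult_test_function:
  fixes f \<phi> :: "'a::euclidean_space \<Rightarrow> real"
  assumes U: "U \<in> sets lebesgue" and f: "locally_integrable U f" and \<phi>: "test_function U \<phi>"
  shows "integrable (lebesgue_on U) (\<lambda>x. f x * \<phi> x)"
proof -
  obtain B where B: "\<And>x. \<bar>\<phi> x\<bar> \<le> B" using test_function_bounded[OF \<phi>] by (metis real_norm_def)
  have K: "compact (closure {x. \<phi> x \<noteq> 0})" "closure {x. \<phi> x \<noteq> 0} \<subseteq> U"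
    using \<phi> by (auto simp: test_function_def)
  have "\<phi> x = 0" if "x \<notin> closure {x. \<phi> x \<noteq> 0}" for x
    using that closure_subset[of "{x. \<phi> x \<noteq> 0}"] by auto
  then show ?thesis
    by (rule integrable_mult_compact_support[OF U f K test_function_measurable_lebesgue_on[OF \<phi>] B])
qed

text \<open>
  By translation invariance every difference quotient of \<open>\<phi>\<close> has integral zero. The quotients
  are bounded by the mean value theorem, vanish outside a fixed ball, and converge to the derivative.
\<close>

lemma integral_frechet_derivative_test_function:
  fixes \<phi> :: "'a::euclidean_space \<Rightarrow> real"
  assumes U: "U \<in> sets lebesgue" and \<phi>: "test_function U \<phi>"
  shows "(LINT x|lebesgue_on U. frechet_derivative \<phi> (at x) v) = 0"
proof -
  let ?D = "\<lambda>x. frechet_derivative \<phi> (at x) v"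
  have D: "test_function U ?D" by (rule test_function_frechet_derivative[OF \<phi>])
  obtain B where B: "B > 0" "\<And>x. \<bar>?D x\<bar> \<le> B" using test_function_bounded[OF D] by (metis real_norm_def)
  obtain R where R: "\<And>x. \<phi> x \<noteq> 0 \<Longrightarrow> norm x \<le> R"
  proof -
    have "bounded {x. \<phi> x \<noteq> 0}"
      using \<phi> bounded_subset[OF compact_imp_bounded closure_subset] by (auto simp: test_function_def)
    then show ?thesis using that by (auto simp: bounded_iff)
  qed
  have \<phi>m[measurable]: "\<phi> \<in> borel_measurable borel" and Dm[measurable]: "?D \<in> borel_measurable borel"
    using test_function_measurable[OF \<phi>] test_function_measurable[OF D] by auto
  have \<phi>i: "integrable lborel \<phi>"
  proof -
    have "integrable lborel (\<lambda>x. indicator (closure {x. \<phi> x \<noteq> 0}) x *\<^sub>R \<phi> x)"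
      using \<phi> by (intro borel_integrable_compact test_function_continuous) (auto simp: test_function_def)
    moreover have "(\<lambda>x. indicator (closure {x. \<phi> x \<noteq> 0}) x *\<^sub>R \<phi> x) = \<phi>"
      using closure_subset[of "{x. \<phi> x \<noteq> 0}"] by (auto simp: indicator_def fun_eq_iff)
    ultimately show ?thesis by simp
  qed
  have shift: "integrable lborel (\<lambda>x. \<phi> (x + c))" "(LINT x|lborel. \<phi> (x + c)) = integral\<^sup>L lborel \<phi>" for c
  proof -
    have *: "distr lborel borel ((+) c) = (lborel :: 'a measure)" by (rule lborel_distr_plus)
    show "integrable lborel (\<lambda>x. \<phi> (x + c))"
      using integrable_distr_eq[of "(+) c" lborel borel \<phi>] \<phi>i * by (simp add: add.commute)
    show "(LINT x|lborel. \<phi> (x + c)) = integral\<^sup>L lborel \<phi>"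
      using integral_distr[of "(+) c" lborel borel \<phi>] * by (simp add: add.commute)
  qed
  \<comment> \<open>Step lengths tending to zero and at most 1, so that all shifted supports lie in one ball.\<close>
  define h where "h n = inverse (real (Suc n))" for n
  have h: "0 < h n" "h n \<le> 1" for n by (auto simp: h_def field_simps)
  define q where "q n x = (\<phi> (x + h n *\<^sub>R v) - \<phi> x) / h n" for n x
  have der: "((\<lambda>s. \<phi> (x + s *\<^sub>R v)) has_real_derivative ?D (x + s *\<^sub>R v)) (at s)" for x s
  proof -
    have "((\<lambda>s. x + s *\<^sub>R v) has_derivative (\<lambda>s. s *\<^sub>R v)) (at s)"
      by (auto intro!: derivative_eq_intros)
    then have *: "((\<lambda>s. \<phi> (x + s *\<^sub>R v)) has_derivative (\<lambda>r. frechet_derivative \<phi> (at (x + s *\<^sub>R v)) (r *\<^sub>R v))) (at s)"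
      by (rule has_derivative_compose) (rule test_function_has_derivative[OF \<phi>])
    have "linear (frechet_derivative \<phi> (at (x + s *\<^sub>R v)))"
      using test_function_has_derivative[OF \<phi>] has_derivative_linear by blast
    then show ?thesis using * by (simp add: has_field_derivative_def linear_cmul mult_commute_abs)
  qed
  have qlim: "(\<lambda>n. q n x) \<longlonglongrightarrow> ?D x" for x
  proof -
    have "((\<lambda>s. (\<phi> (x + s *\<^sub>R v) - \<phi> x) / s) \<longlongrightarrow> ?D x) (at 0)"
      using der[of x 0] by (simp add: DERIV_def)
    moreover have "filterlim h (at 0) sequentially"
      unfolding filterlim_at using LIMSEQ_inverse_real_of_nat h(1) by (auto simp: h_def[abs_def])
    ultimately show ?thesis unfolding q_def by (rule filterlim_compose)
  qed
  have qbound: "\<bar>q n x\<bar> \<le> B" for n x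
  proof -
    obtain s where "\<phi> (x + h n *\<^sub>R v) - \<phi> (x + 0 *\<^sub>R v) = (h n - 0) * ?D (x + s *\<^sub>R v)"
      using MVT2[of 0 "h n" "\<lambda>s. \<phi> (x + s *\<^sub>R v)" "\<lambda>s. ?D (x + s *\<^sub>R v)"] h(1) der by blast
    then have "q n x = ?D (x + s *\<^sub>R v)" using h(1)[of n] by (simp add: q_def)
    then show ?thesis using B(2) by metis
  qed
  have qdom: "\<bar>q n x\<bar> \<le> indicator (cball 0 (R + norm v)) x * B" for n x
  proof (cases "norm x \<le> R + norm v")
    case False
    have "norm (x + h n *\<^sub>R v) \<ge> norm x - norm (h n *\<^sub>R v)" by (rule norm_diff_ineq)
    moreover have "norm (h n *\<^sub>R v) \<le> norm v" using h[of n] by (simp add: mult_left_le_one_le)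
    ultimately have "\<not> norm (x + h n *\<^sub>R v) \<le> R" "\<not> norm x \<le> R"
      using False norm_ge_zero[of v] by linarith+
    then have "\<phi> (x + h n *\<^sub>R v) = 0" "\<phi> x = 0" using R by blast+
    then show ?thesis using B(1) by (simp add: q_def)
  qed (use qbound in auto)
  have "(\<lambda>n. integral\<^sup>L lborel (q n)) \<longlonglongrightarrow> integral\<^sup>L lborel ?D"
  proof (rule integral_dominated_convergence[where w="\<lambda>x. indicator (cball 0 (R + norm v)) x * B"])
    show "integrable lborel (\<lambda>x. indicator (cball 0 (R + norm v)) x * B)"
      using emeasure_bounded_finite[OF bounded_cball]
      by (intro integrable_mult_left integrable_real_indicator) (auto simp: less_top)
    show "q n \<in> borel_measurable lborel" for n unfolding q_def by measurable
  qed (use qlim qdom Dm in auto)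
  moreover have "integral\<^sup>L lborel (q n) = 0" for n
    unfolding q_def using shift[of "h n *\<^sub>R v"] \<phi>i by simp
  ultimately have "integral\<^sup>L lborel ?D = 0" by (simp add: LIMSEQ_const_iff)
  then have "integral\<^sup>L lebesgue ?D = 0" by (subst integral_completion) auto
  moreover have "(\<lambda>x. indicator U x *\<^sub>R ?D x) = ?D"
    using test_function_eq_0[OF D] by (auto simp: indicator_def fun_eq_iff)
  ultimately show ?thesis using U by (simp add: integral_restrict_space)
qed

section \<open>Weak gradients\<close>

lemma locally_integrable_bounded_linear:
  assumes "bounded_linear L" "locally_integrable U f"
  shows "locally_integrable U (\<lambda>x. L (f x))"
  unfolding locally_integrable_def
proof (intro allI impI)
  fix K assume "compact K \<and> K \<subseteq> U"
  with assms(2) have "integrable (lebesgue_on K) f" by (simp add: locally_integrable_def)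
  then show "integrable (lebesgue_on K) (\<lambda>x. L (f x))" by (rule integrable_bounded_linear[OF assms(1)])
qed

lemma locally_integrable_nth:
  fixes f :: "'a::euclidean_space \<Rightarrow> 'b::euclidean_space^'m"
  shows "locally_integrable U f \<Longrightarrow> locally_integrable U (\<lambda>x. f x $ i)"
  by (rule locally_integrable_bounded_linear[OF bounded_linear_vec_nth])

lemma locally_integrable_diff:
  "locally_integrable U f \<Longrightarrow> locally_integrable U g \<Longrightarrow> locally_integrable U (\<lambda>x. f x - g x)"
  unfolding locally_integrable_def by (simp add: Bochner_Integration.integrable_diff)

lemma locally_integrable_continuous:
  fixes f :: "'a::euclidean_space \<Rightarrow> 'b::euclidean_space"
  assumes "continuous_on UNIV f"
  shows "locally_integrable U f"
  unfolding locally_integrable_def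
  by (intro allI impI continuous_integrable_lebesgue_on_compact continuous_on_subset[OF assms]) auto

lemma weak_gradientD:
  assumes "weak_gradient \<Omega> u G" "test_function \<Omega> \<phi>"
  shows "(LINT x|lebesgue_on \<Omega>. u x $ i * frechet_derivative \<phi> (at x) (axis j 1))
    = - (LINT x|lebesgue_on \<Omega>. G x $ i $ j * \<phi> x)"
  using assms unfolding weak_gradient_def by blast

lemma weak_gradient_locally_integrable:
  assumes "weak_gradient \<Omega> u G"
  shows "locally_integrable \<Omega> (\<lambda>x. u x $ i)" "locally_integrable \<Omega> (\<lambda>x. G x $ i $ j)"
proof -
  have "locally_integrable \<Omega> u" "locally_integrable \<Omega> G"
    using assms unfolding weak_gradient_def by blast+
  then show "locally_integrable \<Omega> (\<lambda>x. u x $ i)" "locally_integrable \<Omega> (\<lambda>x. G x $ i $ j)"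
    by (simp_all add: locally_integrable_nth)
qed

text \<open>
  This makes the choice hidden in \<open>grad\<close> harmless: any weak gradient at hand, such as a
  jointly measurable representative or the classical Jacobian of a test field, may replace it under
  integrals.
\<close>

lemma weak_gradient_unique:
  fixes \<Omega> :: "(real^'n) set"
  assumes \<Omega>: "open \<Omega>" and G: "weak_gradient \<Omega> u G" and H: "weak_gradient \<Omega> u H"
  shows "AE x in lebesgue_on \<Omega>. G x = H x"
proof -
  have [simp]: "\<Omega> \<in> sets lebesgue" using \<Omega> by auto
  note lG = weak_gradient_locally_integrable(2)[OF G] and lH = weak_gradient_locally_integrable(2)[OF H]
  have "AE x in lebesgue_on \<Omega>. G x $ i $ j - H x $ i $ j = 0" for i j
  proof (rule AE_zero_if_bump_integrals_zero[OF \<Omega> locally_integrable_diff[OF lG lH]])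
    fix a b :: "real^'n" and n assume "cbox a b \<subseteq> \<Omega>"
    then have t: "test_function \<Omega> (bump a b n)" by (rule test_function_bump)
    have "(LINT x|lebesgue_on \<Omega>. G x $ i $ j * bump a b n x) = (LINT x|lebesgue_on \<Omega>. H x $ i $ j * bump a b n x)"
      using weak_gradientD[OF G t, of i j] weak_gradientD[OF H t, of i j] by linarith
    then show "(LINT x|lebesgue_on \<Omega>. (G x $ i $ j - H x $ i $ j) * bump a b n x) = 0"
      using integrable_mult_test_function[OF _ lG t, of i j] integrable_mult_test_function[OF _ lH t, of i j]
      by (simp add: left_diff_distrib)
  qed
  then have "AE x in lebesgue_on \<Omega>. \<forall>i j. G x $ i $ j - H x $ i $ j = 0"
    by (simp add: AE_all_countable)
  then show ?thesis by eventually_elim (simp add: vec_eq_iff)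
qed

lemma weak_gradient_grad: "weak_gradient \<Omega> u G \<Longrightarrow> weak_gradient \<Omega> u (grad \<Omega> u)"
  unfolding grad_def by (rule someI[of "weak_gradient \<Omega> u"])

lemma grad_eq_weak_gradient:
  fixes \<Omega> :: "(real^'n) set"
  assumes "open \<Omega>" "weak_gradient \<Omega> u G"
  shows "AE x in lebesgue_on \<Omega>. grad \<Omega> u x = G x"
  using weak_gradient_unique[OF assms(1) weak_gradient_grad[OF assms(2)] assms(2)] .

lemma weak_gradient_diff:
  fixes \<Omega> :: "(real^'n) set"
  assumes \<Omega>: "\<Omega> \<in> sets lebesgue" and G: "weak_gradient \<Omega> u G" and H: "weak_gradient \<Omega> v H"
  shows "weak_gradient \<Omega> (\<lambda>x. u x - v x) (\<lambda>x. G x - H x)"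
  unfolding weak_gradient_def
proof (intro conjI allI impI)
  show "locally_integrable \<Omega> (\<lambda>x. u x - v x)" "locally_integrable \<Omega> (\<lambda>x. G x - H x)"
    using G H by (simp_all add: weak_gradient_def locally_integrable_diff)
  fix \<phi> :: "real^'n \<Rightarrow> real" and i j :: 'n
  assume t: "test_function \<Omega> \<phi>"
  let ?D = "\<lambda>x. frechet_derivative \<phi> (at x) (axis j 1)"
  have t': "test_function \<Omega> ?D" by (rule test_function_frechet_derivative[OF t])
  have "integrable (lebesgue_on \<Omega>) (\<lambda>x. u x $ i * ?D x)" "integrable (lebesgue_on \<Omega>) (\<lambda>x. v x $ i * ?D x)"
    "integrable (lebesgue_on \<Omega>) (\<lambda>x. G x $ i $ j * \<phi> x)" "integrable (lebesgue_on \<Omega>) (\<lambda>x. H x $ i $ j * \<phi> x)"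
    by (intro integrable_mult_test_function \<Omega> t t' weak_gradient_locally_integrable[OF G] weak_gradient_locally_integrable[OF H])+
  then show "(LINT x|lebesgue_on \<Omega>. (u x - v x) $ i * ?D x) = - (LINT x|lebesgue_on \<Omega>. (G x - H x) $ i $ j * \<phi> x)"
    using weak_gradientD[OF G t, of i j] weak_gradientD[OF H t, of i j] by (simp add: left_diff_distrib)
qed

lemma frechet_derivative_nth:
  assumes "(\<phi> has_derivative frechet_derivative \<phi> (at x)) (at x)"
  shows "frechet_derivative (\<lambda>x. \<phi> x $ i) (at x) v = frechet_derivative \<phi> (at x) v $ i"
proof -
  have "(\<lambda>v. frechet_derivative \<phi> (at x) v $ i) = frechet_derivative (\<lambda>x. \<phi> x $ i) (at x)"
    by (rule frechet_derivative_at, rule bounded_linear.has_derivative[OF bounded_linear_vec_nth assms])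
  then show ?thesis by (rule fun_cong[OF sym])
qed

lemma frechet_derivative_mult:
  fixes f g :: "'a::real_normed_vector \<Rightarrow> real"
  assumes "(f has_derivative frechet_derivative f (at x)) (at x)"
    "(g has_derivative frechet_derivative g (at x)) (at x)"
  shows "frechet_derivative (\<lambda>x. f x * g x) (at x) v =
    f x * frechet_derivative g (at x) v + frechet_derivative f (at x) v * g x"
  by (rule fun_cong[OF frechet_derivative_at[OF has_derivative_mult[OF assms], symmetric]])

lemma test_function_jacobian:
  fixes \<Omega> :: "(real^'n) set"
  assumes "test_function \<Omega> \<phi>"
  shows "test_function \<Omega> (\<lambda>x. jacobian \<phi> (at x) $ i $ j)"
proof -
  have "test_function \<Omega> (\<lambda>x. frechet_derivative \<phi> (at x) (axis j 1) $ i)"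
    by (rule test_function_nth[OF test_function_frechet_derivative[OF assms]])
  then show ?thesis by (simp add: jacobian_def matrix_def)
qed

lemma continuous_jacobian:
  fixes \<Omega> :: "(real^'n) set"
  assumes "test_function \<Omega> \<phi>"
  shows "continuous_on S (\<lambda>x. jacobian \<phi> (at x))"
proof -
  have "continuous_on S (\<lambda>x. \<chi> i j. jacobian \<phi> (at x) $ i $ j)"
    by (intro continuous_on_vec_lambda test_function_continuous[OF test_function_jacobian[OF assms]])
  then show ?thesis by simp
qed

lemma frechet_derivative_component:
  fixes \<Omega> :: "(real^'n) set"
  assumes "test_function \<Omega> \<phi>"
  shows "frechet_derivative (\<lambda>x. \<phi> x $ i) (at x) (axis j 1) = jacobian \<phi> (at x) $ i $ j"
  by (simp add: frechet_derivative_nth[OF test_function_has_derivative[OF assms]] jacobian_def matrix_def)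

text \<open>
  The product rule turns the defining identity into the statement that the derivative of the
  test function \<open>\<phi>\<^sub>i \<psi>\<close> has integral zero.
\<close>

lemma weak_gradient_test_function:
  fixes \<Omega> :: "(real^'n) set"
  assumes \<Omega>: "\<Omega> \<in> sets lebesgue" and \<phi>: "test_function \<Omega> \<phi>"
  shows "weak_gradient \<Omega> \<phi> (\<lambda>x. jacobian \<phi> (at x))"
  unfolding weak_gradient_def
proof (intro conjI allI impI)
  show l: "locally_integrable \<Omega> \<phi>" "locally_integrable \<Omega> (\<lambda>x. jacobian \<phi> (at x))"
    by (rule locally_integrable_continuous, rule test_function_continuous[OF \<phi>])
      (rule locally_integrable_continuous, rule continuous_jacobian[OF \<phi>])
  fix \<psi> :: "real^'n \<Rightarrow> real" and i j :: 'n
  assume t: "test_function \<Omega> \<psi>"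
  let ?D = "\<lambda>x. frechet_derivative \<psi> (at x) (axis j 1)"
  have t': "test_function \<Omega> ?D" by (rule test_function_frechet_derivative[OF t])
  have p: "test_function \<Omega> (\<lambda>x. \<phi> x $ i)" by (rule test_function_nth[OF \<phi>])
  have i: "integrable (lebesgue_on \<Omega>) (\<lambda>x. \<phi> x $ i * ?D x)"
    "integrable (lebesgue_on \<Omega>) (\<lambda>x. jacobian \<phi> (at x) $ i $ j * \<psi> x)"
    by (intro integrable_mult_test_function \<Omega> t t' locally_integrable_nth l)+
  have "(LINT x|lebesgue_on \<Omega>. \<phi> x $ i * ?D x + jacobian \<phi> (at x) $ i $ j * \<psi> x) =
     (LINT x|lebesgue_on \<Omega>. frechet_derivative (\<lambda>x. \<phi> x $ i * \<psi> x) (at x) (axis j 1))"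
    by (simp add: frechet_derivative_mult test_function_has_derivative[OF p] test_function_has_derivative[OF t]
        frechet_derivative_component[OF \<phi>])
  also have "\<dots> = 0"
    by (intro integral_frechet_derivative_test_function \<Omega> test_function_mult p test_function_C_k[OF t])
  finally show "(LINT x|lebesgue_on \<Omega>. \<phi> x $ i * ?D x) = - (LINT x|lebesgue_on \<Omega>. jacobian \<phi> (at x) $ i $ j * \<psi> x)"
    using i by simp
qed

section \<open>Trilinear integrals under cubic convergence\<close>

text \<open>
  A substitute for the three-factor Hoelder inequality. Each of the seven error terms contains
  a small factor \<open>a\<close>; if \<open>P\<close> bounds the other two, then \<open>|a| P\<^sup>2\<close> is at most \<open>l P\<^sup>3\<close> when
  \<open>|a| \<le> l P\<close>, and at most \<open>|a|\<^sup>3 / l\<^sup>2\<close> otherwise. The parameter \<open>l\<close> is free, so that the second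
  group of cubes, which does not become small, can be suppressed.
\<close>

lemma triple_product_perturbation:
  fixes X Y Z x y z l :: real
  assumes "l > 0"
  shows "\<bar>(X + x) * (Y + y) * (Z + z) - X * Y * Z\<bar>
    \<le> 7 * ((\<bar>x\<bar>^3 + \<bar>y\<bar>^3 + \<bar>z\<bar>^3) / l^2 +
        l * (\<bar>X\<bar>^3 + \<bar>Y\<bar>^3 + \<bar>Z\<bar>^3 + \<bar>x\<bar>^3 + \<bar>y\<bar>^3 + \<bar>z\<bar>^3))"
proof -
  define s S where "s = \<bar>x\<bar>^3 + \<bar>y\<bar>^3 + \<bar>z\<bar>^3"
    and "S = \<bar>X\<bar>^3 + \<bar>Y\<bar>^3 + \<bar>Z\<bar>^3 + \<bar>x\<bar>^3 + \<bar>y\<bar>^3 + \<bar>z\<bar>^3"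
  have s0: "0 \<le> s / l^2" by (simp add: s_def)
  have S0: "0 \<le> l * S" using assms by (intro mult_nonneg_nonneg) (simp_all add: S_def)
  have main: "\<bar>a * b * c\<bar> \<le> s / l^2 + l * S"
    if as: "\<bar>a\<bar>^3 \<le> s" and b: "\<bar>b\<bar>^3 \<le> S" and c: "\<bar>c\<bar>^3 \<le> S" for a b c
  proof -
    define P where "P = max \<bar>b\<bar> \<bar>c\<bar>"
    have P3: "P^3 \<le> S" using b c by (simp add: P_def max_def)
    have P: "0 \<le> P" "\<bar>b\<bar> \<le> P" "\<bar>c\<bar> \<le> P" by (simp_all add: P_def)
    have "\<bar>a * b * c\<bar> = \<bar>a\<bar> * (\<bar>b\<bar> * \<bar>c\<bar>)" by (simp add: abs_mult)
    also have "\<dots> \<le> \<bar>a\<bar> * (P * P)"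
      using P by (intro mult_left_mono mult_mono) simp_all
    also have "\<dots> \<le> s / l^2 + l * S"
    proof (cases "\<bar>a\<bar> \<le> l * P")
      case True
      then have "\<bar>a\<bar> * (P * P) \<le> l * P * (P * P)" using P by (intro mult_right_mono) simp_all
      also have "\<dots> = l * P^3" by (simp add: power3_eq_cube)
      also have "\<dots> \<le> l * S" using P3 assms by (intro mult_left_mono) simp_all
      finally show ?thesis using s0 by linarith
    next
      case False
      then have "P \<le> \<bar>a\<bar> / l" using assms by (simp add: field_simps)
      then have "\<bar>a\<bar> * (P * P) \<le> \<bar>a\<bar> * (\<bar>a\<bar> / l * (\<bar>a\<bar> / l))"
        using P assms by (intro mult_left_mono mult_mono) simp_all
      also have "\<dots> = \<bar>a\<bar>^3 / l^2" by (simp add: power3_eq_cube power2_eq_square)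
      also have "\<dots> \<le> s / l^2" using as by (intro divide_right_mono) simp_all
      finally show ?thesis using S0 by linarith
    qed
    finally show ?thesis .
  qed
  have *: "\<bar>x\<bar>^3 \<le> s" "\<bar>y\<bar>^3 \<le> s" "\<bar>z\<bar>^3 \<le> s" by (simp_all add: s_def)
  have **: "\<bar>x\<bar>^3 \<le> S" "\<bar>y\<bar>^3 \<le> S" "\<bar>z\<bar>^3 \<le> S" "\<bar>X\<bar>^3 \<le> S" "\<bar>Y\<bar>^3 \<le> S" "\<bar>Z\<bar>^3 \<le> S"
    by (simp_all add: S_def)
  have "(X + x) * (Y + y) * (Z + z) - X * Y * Z =
      x * Y * Z + y * X * Z + z * X * Y + x * y * Z + x * z * Y + y * z * X + x * y * z"
    by algebra
  also have "\<bar>\<dots>\<bar> \<le> \<bar>x * Y * Z\<bar> + \<bar>y * X * Z\<bar> + \<bar>z * X * Y\<bar> + \<bar>x * y * Z\<bar> + \<bar>x * z * Y\<bar> + \<bar>y * z * X\<bar> + \<bar>x * y * z\<bar>"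
    by (intro order_trans[OF abs_triangle_ineq] add_right_mono abs_triangle_ineq)
  also have "\<dots> \<le> (s / l^2 + l * S) + (s / l^2 + l * S) + (s / l^2 + l * S) + (s / l^2 + l * S)
      + (s / l^2 + l * S) + (s / l^2 + l * S) + (s / l^2 + l * S)"
    by (intro add_mono main * **)
  also have "\<dots> = 7 * (s / l^2 + l * S)" by simp
  finally show ?thesis by (simp only: s_def S_def)
qed


lemma cube_sum_integrable:
  fixes X Y :: "'a \<Rightarrow> real"
  assumes [measurable]: "X \<in> borel_measurable M" "Y \<in> borel_measurable M"
    and i: "integrable M (\<lambda>x. \<bar>X x\<bar>^3)" "integrable M (\<lambda>x. \<bar>Y x\<bar>^3)"
  shows "integrable M (\<lambda>x. \<bar>X x + Y x\<bar>^3)"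
proof (rule Bochner_Integration.integrable_bound)
  show "integrable M (\<lambda>x. 8 * (\<bar>X x\<bar>^3 + \<bar>Y x\<bar>^3))" using i by simp
  have "\<bar>X x + Y x\<bar>^3 \<le> 8 * (\<bar>X x\<bar>^3 + \<bar>Y x\<bar>^3)" for x
  proof -
    let ?m = "max \<bar>X x\<bar> \<bar>Y x\<bar>"
    have "\<bar>X x + Y x\<bar>^3 \<le> (2 * ?m)^3" by (intro power_mono) auto
    also have "\<dots> = 8 * ?m^3" by (simp add: power_mult_distrib)
    also have "?m^3 \<le> \<bar>X x\<bar>^3 + \<bar>Y x\<bar>^3" by (simp add: max_def)
    finally show ?thesis by simp
  qed
  then show "AE x in M. norm (\<bar>X x + Y x\<bar>^3) \<le> norm (8 * (\<bar>X x\<bar>^3 + \<bar>Y x\<bar>^3))"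
    by (intro AE_I2) simp
qed measurable

lemma triple_product_integrable:
  fixes X Y Z :: "'a \<Rightarrow> real"
  assumes [measurable]: "X \<in> borel_measurable M" "Y \<in> borel_measurable M" "Z \<in> borel_measurable M"
    and i: "integrable M (\<lambda>x. \<bar>X x\<bar>^3)" "integrable M (\<lambda>x. \<bar>Y x\<bar>^3)" "integrable M (\<lambda>x. \<bar>Z x\<bar>^3)"
  shows "integrable M (\<lambda>x. X x * Y x * Z x)"
proof (rule Bochner_Integration.integrable_bound)
  show "integrable M (\<lambda>x. 14 * (\<bar>X x\<bar>^3 + \<bar>Y x\<bar>^3 + \<bar>Z x\<bar>^3))" using i by simp
  show "AE x in M. norm (X x * Y x * Z x) \<le> norm (14 * (\<bar>X x\<bar>^3 + \<bar>Y x\<bar>^3 + \<bar>Z x\<bar>^3))"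
  proof (intro AE_I2)
    fix x
    show "norm (X x * Y x * Z x) \<le> norm (14 * (\<bar>X x\<bar>^3 + \<bar>Y x\<bar>^3 + \<bar>Z x\<bar>^3))"
      using triple_product_perturbation[of 1 0 "X x" 0 "Y x" 0 "Z x"] by simp
  qed
qed measurable

text \<open>
  The error bound is \<open>7 (s n / l\<^sup>2 + l (S + s n))\<close> with \<open>s n\<close> tending to zero, so \<open>l\<close> is chosen
  first, depending on the required accuracy, and then \<open>n\<close>.
\<close>

lemma triple_product_integral_tendsto:
  fixes X Y Z :: "'a \<Rightarrow> real" and Xn Yn Zn :: "nat \<Rightarrow> 'a \<Rightarrow> real"
  assumes m: "X \<in> borel_measurable M" "Y \<in> borel_measurable M" "Z \<in> borel_measurable M"
    "\<And>n. Xn n \<in> borel_measurable M" "\<And>n. Yn n \<in> borel_measurable M" "\<And>n. Zn n \<in> borel_measurable M"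
    and i: "integrable M (\<lambda>x. \<bar>X x\<bar>^3)" "integrable M (\<lambda>x. \<bar>Y x\<bar>^3)" "integrable M (\<lambda>x. \<bar>Z x\<bar>^3)"
    and id: "\<And>n. integrable M (\<lambda>x. \<bar>Xn n x - X x\<bar>^3)" "\<And>n. integrable M (\<lambda>x. \<bar>Yn n x - Y x\<bar>^3)"
      "\<And>n. integrable M (\<lambda>x. \<bar>Zn n x - Z x\<bar>^3)"
    and lim: "(\<lambda>n. LINT x|M. \<bar>Xn n x - X x\<bar>^3) \<longlonglongrightarrow> 0" "(\<lambda>n. LINT x|M. \<bar>Yn n x - Y x\<bar>^3) \<longlonglongrightarrow> 0"
      "(\<lambda>n. LINT x|M. \<bar>Zn n x - Z x\<bar>^3) \<longlonglongrightarrow> 0"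
  shows "(\<lambda>n. LINT x|M. Xn n x * Yn n x * Zn n x) \<longlonglongrightarrow> (LINT x|M. X x * Y x * Z x)"
proof -
  define s where "s n = (LINT x|M. \<bar>Xn n x - X x\<bar>^3) + (LINT x|M. \<bar>Yn n x - Y x\<bar>^3) + (LINT x|M. \<bar>Zn n x - Z x\<bar>^3)" for n
  define S where "S = (LINT x|M. \<bar>X x\<bar>^3) + (LINT x|M. \<bar>Y x\<bar>^3) + (LINT x|M. \<bar>Z x\<bar>^3)"
  have S0: "0 \<le> S" by (simp add: S_def)
  have s: "s \<longlonglongrightarrow> 0" unfolding s_def using tendsto_add[OF tendsto_add[OF lim(1,2)] lim(3)] by simp
  have bound: "\<bar>(LINT x|M. Xn n x * Yn n x * Zn n x) - (LINT x|M. X x * Y x * Z x)\<bar> \<le> 7 * (s n / l^2 + l * (S + s n))"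
    if l: "l > 0" for l n
  proof -
    have d: "integrable M (\<lambda>x. \<bar>X x + (Xn n x - X x)\<bar>^3)" "integrable M (\<lambda>x. \<bar>Y x + (Yn n x - Y x)\<bar>^3)"
      "integrable M (\<lambda>x. \<bar>Z x + (Zn n x - Z x)\<bar>^3)"
      by (intro cube_sum_integrable borel_measurable_diff m i id)+
    then have dn: "integrable M (\<lambda>x. Xn n x * Yn n x * Zn n x)"
      by (intro triple_product_integrable m) simp_all
    have d0: "integrable M (\<lambda>x. X x * Y x * Z x)" by (intro triple_product_integrable m i)
    let ?b = "\<lambda>x. 7 * ((\<bar>Xn n x - X x\<bar>^3 + \<bar>Yn n x - Y x\<bar>^3 + \<bar>Zn n x - Z x\<bar>^3) / l^2 +
        l * (\<bar>X x\<bar>^3 + \<bar>Y x\<bar>^3 + \<bar>Z x\<bar>^3 + \<bar>Xn n x - X x\<bar>^3 + \<bar>Yn n x - Y x\<bar>^3 + \<bar>Zn n x - Z x\<bar>^3))"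
    have "\<bar>(LINT x|M. Xn n x * Yn n x * Zn n x) - (LINT x|M. X x * Y x * Z x)\<bar>
        = \<bar>LINT x|M. Xn n x * Yn n x * Zn n x - X x * Y x * Z x\<bar>"
      using dn d0 by simp
    also have "\<dots> \<le> (LINT x|M. \<bar>Xn n x * Yn n x * Zn n x - X x * Y x * Z x\<bar>)"
      by (rule integral_abs_bound)
    also have "\<dots> \<le> integral\<^sup>L M ?b"
    proof (rule integral_mono)
      show "integrable M (\<lambda>x. \<bar>Xn n x * Yn n x * Zn n x - X x * Y x * Z x\<bar>)" using dn d0 by simp
      show "integrable M ?b" using i id[of n] by simp
      show "\<bar>Xn n x * Yn n x * Zn n x - X x * Y x * Z x\<bar> \<le> ?b x" for x
        using triple_product_perturbation[OF l, of "X x" "Xn n x - X x" "Y x" "Yn n x - Y x" "Z x" "Zn n x - Z x"]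
        by simp
    qed
    also have "\<dots> = 7 * (s n / l^2 + l * (S + s n))"
      using i id[of n] by (simp add: s_def S_def add_divide_distrib distrib_left)
    finally show ?thesis .
  qed
  show ?thesis
  proof (rule LIMSEQ_I)
    fix e :: real assume e: "0 < e"
    \<comment> \<open>With this choice the part \<open>7 l S\<close> of the bound that persists in the limit is at most \<open>e / 4\<close>.\<close>
    define l where "l = e / (28 * (S + 1))"
    have l: "l > 0" using e S0 by (simp add: l_def)
    have "(\<lambda>n. 7 * (s n / l^2 + l * (S + s n))) \<longlonglongrightarrow> 7 * (0 / l^2 + l * (S + 0))"
      using l by (intro tendsto_intros s) auto
    moreover have "7 * (0 / l^2 + l * (S + 0)) < e"
    proof -
      have "7 * (0 / l^2 + l * (S + 0)) = e / 4 * (S / (S + 1))"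
        using S0 by (simp add: l_def divide_simps)
      also have "\<dots> \<le> e / 4 * 1" using e S0 by (intro mult_left_mono) auto
      finally show ?thesis using e by simp
    qed
    ultimately have "\<forall>\<^sub>F n in sequentially. 7 * (s n / l^2 + l * (S + s n)) < e"
      by (rule order_tendstoD(2))
    then obtain N where "\<And>n. n \<ge> N \<Longrightarrow> 7 * (s n / l^2 + l * (S + s n)) < e"
      by (auto simp: eventually_sequentially)
    then show "\<exists>N. \<forall>n\<ge>N. norm ((LINT x|M. Xn n x * Yn n x * Zn n x) - (LINT x|M. X x * Y x * Z x)) < e"
      using bound[OF l] by (intro exI[of _ N]) (auto intro: le_less_trans)
  qed
qed

section \<open>The convective term\<close>

lemma finite_measure_lebesgue_on_bounded:
  assumes "open \<Omega>" "bounded \<Omega>" shows "finite_measure (lebesgue_on \<Omega>)"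
proof (rule finite_measureI)
  have "\<Omega> \<in> sets borel" using assms(1) by auto
  then have "emeasure lebesgue \<Omega> < \<infinity>" using emeasure_bounded_finite[OF assms(2)] by simp
  then show "emeasure (lebesgue_on \<Omega>) (space (lebesgue_on \<Omega>)) \<noteq> \<infinity>"
    using assms(1) by (simp add: emeasure_restrict_space)
qed

lemma Lp_norm_powr:
  assumes "p > 0"
  shows "Lp_norm \<Omega> p f powr p = (LINT x|lebesgue_on \<Omega>. norm (f x) powr p)"
proof -
  have "0 \<le> (LINT x|lebesgue_on \<Omega>. norm (f x) powr p)" by (intro integral_nonneg_AE AE_I2) simp
  then show ?thesis using assms by (simp add: Lp_norm_def powr_powr)
qed

lemma W1p_norm_powr:
  assumes "p > 0"
  shows "W1p_norm \<Omega> p u powr p =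
    (LINT x|lebesgue_on \<Omega>. norm (u x) powr p) + (LINT x|lebesgue_on \<Omega>. norm (grad \<Omega> u x) powr p)"
  using assms by (simp add: W1p_norm_def Lp_norm_powr powr_powr integral_nonneg_AE)

lemma Lp_norm_square: "(Lp_norm \<Omega> 2 f)\<^sup>2 = (LINT x|lebesgue_on \<Omega>. (norm (f x))\<^sup>2)"
  using Lp_norm_powr[of 2 \<Omega> f] by (simp add: Lp_norm_def)

lemma Lp_norm_cube: "(Lp_norm \<Omega> 3 f) ^ 3 = (LINT x|lebesgue_on \<Omega>. norm (f x) ^ 3)"
  using Lp_norm_powr[of 3 \<Omega> f] by (simp add: Lp_norm_def)

lemma Lp_space_3_iff:
  "f \<in> Lp_space \<Omega> 3 \<longleftrightarrow> f \<in> borel_measurable (lebesgue_on \<Omega>) \<and> integrable (lebesgue_on \<Omega>) (\<lambda>x. norm (f x) ^ 3)"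
  by (simp add: Lp_space_def)

lemma Lp_space_2_iff:
  "f \<in> Lp_space \<Omega> 2 \<longleftrightarrow> f \<in> borel_measurable (lebesgue_on \<Omega>) \<and> integrable (lebesgue_on \<Omega>) (\<lambda>x. (norm (f x))\<^sup>2)"
  by (simp add: Lp_space_def)

lemma norm_diff_cube_integrable:
  fixes f g :: "'a \<Rightarrow> 'b::euclidean_space"
  assumes [measurable]: "f \<in> borel_measurable M" "g \<in> borel_measurable M"
    and i: "integrable M (\<lambda>x. norm (f x) ^ 3)" "integrable M (\<lambda>x. norm (g x) ^ 3)"
  shows "integrable M (\<lambda>x. norm (f x - g x) ^ 3)"
proof (rule Bochner_Integration.integrable_bound)
  show "integrable M (\<lambda>x. \<bar>norm (f x) + norm (g x)\<bar> ^ 3)"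
    by (rule cube_sum_integrable) (simp_all add: i)
  show "AE x in M. norm (norm (f x - g x) ^ 3) \<le> norm (\<bar>norm (f x) + norm (g x)\<bar> ^ 3)"
    by (intro AE_I2) (simp add: power_mono norm_triangle_ineq4)
qed measurable

lemma (in finite_measure) bounded_cube_integrable:
  fixes f :: "'a \<Rightarrow> 'b::euclidean_space"
  assumes [measurable]: "f \<in> borel_measurable M" and B: "\<And>x. norm (f x) \<le> B"
  shows "integrable M (\<lambda>x. norm (f x) ^ 3)"
proof (rule integrable_const_bound)
  show "AE x in M. norm (norm (f x) ^ 3) \<le> B ^ 3"
    using B by (intro AE_I2) (simp add: power_mono)
qed measurable

lemma jacobian_bounded:
  fixes \<phi> :: "real^'n \<Rightarrow> real^'n"
  assumes "test_function \<Omega> \<phi>"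
  obtains B where "\<And>x. norm (jacobian \<phi> (at x)) \<le> B"
proof -
  have ex: "\<exists>B. \<forall>x. \<bar>jacobian \<phi> (at x) $ i $ j\<bar> \<le> B" for i j
    using test_function_bounded[OF test_function_jacobian[OF assms, of i j]] by (metis real_norm_def)
  define B where "B i j = (SOME B. \<forall>x. \<bar>jacobian \<phi> (at x) $ i $ j\<bar> \<le> B)" for i j
  have B: "\<bar>jacobian \<phi> (at x) $ i $ j\<bar> \<le> B i j" for i j x
    using someI_ex[OF ex[of i j]] by (simp add: B_def)
  have "norm (jacobian \<phi> (at x)) \<le> (\<Sum>i\<in>UNIV. \<Sum>j\<in>UNIV. B i j)" for x
  proof -
    have "norm (jacobian \<phi> (at x)) \<le> (\<Sum>i\<in>UNIV. norm (jacobian \<phi> (at x) $ i))"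
      unfolding norm_vec_def by (rule L2_set_le_sum) simp
    also have "\<dots> \<le> (\<Sum>i\<in>UNIV. \<Sum>j\<in>UNIV. \<bar>jacobian \<phi> (at x) $ i $ j\<bar>)"
      by (intro sum_mono norm_le_l1_cart)
    also have "\<dots> \<le> (\<Sum>i\<in>UNIV. \<Sum>j\<in>UNIV. B i j)" by (intro sum_mono B)
    finally show ?thesis .
  qed
  then show ?thesis by (rule that)
qed

lemma continuous_measurable_lebesgue_on:
  fixes f :: "'a::euclidean_space \<Rightarrow> 'b::euclidean_space"
  assumes "continuous_on UNIV f" shows "f \<in> borel_measurable (lebesgue_on S)"
  by (intro measurable_restrict_space1 measurable_completion)
    (simp add: borel_measurable_continuous_onI[OF assms])

text \<open>
  This is where the completeness of Lebesgue measure enters: functions such as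
  \<open>grad \<Omega> u\<close>, which are only determined up to null sets, inherit measurability.
\<close>

lemma borel_measurable_lebesgue_on_cong_AE:
  fixes f g :: "'a::euclidean_space \<Rightarrow> 'b::euclidean_space"
  assumes S: "S \<in> sets lebesgue" and f: "f \<in> borel_measurable (lebesgue_on S)"
    and eq: "AE x in lebesgue_on S. f x = g x"
  shows "g \<in> borel_measurable (lebesgue_on S)"
proof -
  obtain N where N: "N \<in> null_sets (lebesgue_on S)" "{x \<in> S. f x \<noteq> g x} \<subseteq> N"
    using eq by (auto simp: eventually_ae_filter)
  have "f \<in> borel_measurable (lebesgue_on (S - N))"
    using borel_measurable_diff_null[OF N(1) S] f by blast
  then have "g \<in> borel_measurable (lebesgue_on (S - N))"
    using measurable_lebesgue_cong[of "S - N" f g borel] N(2) by blast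
  then show ?thesis using borel_measurable_diff_null[OF N(1) S] by blast
qed

lemma integral_lebesgue_on_cong_AE:
  fixes f g :: "'a::euclidean_space \<Rightarrow> 'b::euclidean_space"
  assumes "S \<in> sets lebesgue" "f \<in> borel_measurable (lebesgue_on S)"
    and "AE x in lebesgue_on S. f x = g x"
  shows "integral\<^sup>L (lebesgue_on S) f = integral\<^sup>L (lebesgue_on S) g"
  by (rule integral_cong_AE[OF assms(2) borel_measurable_lebesgue_on_cong_AE[OF assms] assms(3)])

lemma integrable_lebesgue_on_cong_AE:
  fixes f g :: "'a::euclidean_space \<Rightarrow> 'b::euclidean_space"
  assumes "S \<in> sets lebesgue" "integrable (lebesgue_on S) f"
    and "AE x in lebesgue_on S. f x = g x"
  shows "integrable (lebesgue_on S) g"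
  using integrable_cong_AE[OF borel_measurable_integrable[OF assms(2)]
      borel_measurable_lebesgue_on_cong_AE[OF assms(1) borel_measurable_integrable[OF assms(2)] assms(3)] assms(3)]
    assms(2) by simp

text \<open>
  The gradient of the difference \<open>v - \<phi>\<close> that occurs in the Sobolev norm is only known as some
  weak gradient; by uniqueness it is the difference of the weak gradient of \<open>v\<close> and the Jacobian of
  \<open>\<phi>\<close>. The result is stated with integrals of cubes, the form in which the trilinear limit
  uses it.
\<close>

lemma velocity_space_approx:
  fixes \<Omega> :: "(real^'n) set"
  assumes \<Omega>: "open \<Omega>" "bounded \<Omega>" and v: "v \<in> velocity_space \<Omega>"
  obtains \<phi> :: "nat \<Rightarrow> real^'n \<Rightarrow> real^'n" where "\<And>n. test_function \<Omega> (\<phi> n)"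
    "\<And>n. integrable (lebesgue_on \<Omega>) (\<lambda>x. norm (\<phi> n x - v x) ^ 3)"
    "\<And>n. integrable (lebesgue_on \<Omega>) (\<lambda>x. norm (jacobian (\<phi> n) (at x) - grad \<Omega> v x) ^ 3)"
    "(\<lambda>n. LINT x|lebesgue_on \<Omega>. norm (\<phi> n x - v x) ^ 3) \<longlonglongrightarrow> 0"
    "(\<lambda>n. LINT x|lebesgue_on \<Omega>. norm (jacobian (\<phi> n) (at x) - grad \<Omega> v x) ^ 3) \<longlonglongrightarrow> 0"
proof -
  let ?M = "lebesgue_on \<Omega>"
  interpret finite_measure ?M by (rule finite_measure_lebesgue_on_bounded[OF \<Omega>])
  have \<Omega>s: "\<Omega> \<in> sets lebesgue" using \<Omega>(1) by auto
  \<comment> \<open>The cube root makes the sum of the two integrals of cubes smaller than \<open>1 / (n + 1)\<close>.\<close>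
  define e where "e n = inverse (real (Suc n)) powr (1 / 3)" for n
  have e: "e n > 0" "e n powr 3 = inverse (real (Suc n))" for n by (auto simp: e_def powr_powr)
  have "\<exists>\<phi>. test_function \<Omega> \<phi> \<and> W1p_norm \<Omega> 3 (\<lambda>x. v x - \<phi> x) < e n" for n
    using v e(1)[of n] unfolding velocity_space_def by blast
  then have "\<exists>\<phi>. \<forall>n. test_function \<Omega> (\<phi> n) \<and> W1p_norm \<Omega> 3 (\<lambda>x. v x - \<phi> n x) < e n"
    by (intro choice allI)
  then obtain \<phi> where \<phi>: "\<And>n. test_function \<Omega> (\<phi> n)" "\<And>n. W1p_norm \<Omega> 3 (\<lambda>x. v x - \<phi> n x) < e n"
    by blast
  have v3: "v \<in> Lp_space \<Omega> 3" "grad \<Omega> v \<in> Lp_space \<Omega> 3" and gv: "weak_gradient \<Omega> v (grad \<Omega> v)"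
    using v weak_gradient_grad by (auto simp: velocity_space_def W1p_space_def)
  have i1: "integrable ?M (\<lambda>x. norm (\<phi> n x - v x) ^ 3)" for n
  proof -
    obtain B where "\<And>x. norm (\<phi> n x) \<le> B" using test_function_bounded[OF \<phi>(1)[of n]] by metis
    then show ?thesis
      using v3(1) test_function_measurable_lebesgue_on[OF \<phi>(1)[of n], of \<Omega>]
      by (intro norm_diff_cube_integrable bounded_cube_integrable[of "\<phi> n" B]) (simp_all add: Lp_space_3_iff)
  qed
  have mJ: "(\<lambda>x. jacobian (\<phi> n) (at x)) \<in> borel_measurable ?M" for n
    by (rule continuous_measurable_lebesgue_on[OF continuous_jacobian[OF \<phi>(1)]])
  have i2: "integrable ?M (\<lambda>x. norm (jacobian (\<phi> n) (at x) - grad \<Omega> v x) ^ 3)" for n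
  proof -
    obtain B where "\<And>x. norm (jacobian (\<phi> n) (at x)) \<le> B" using jacobian_bounded[OF \<phi>(1)[of n]] by metis
    then show ?thesis
      using v3(2) mJ[of n]
      by (intro norm_diff_cube_integrable bounded_cube_integrable[of "\<lambda>x. jacobian (\<phi> n) (at x)" B]) (simp_all add: Lp_space_3_iff)
  qed
  have est: "(LINT x|?M. norm (\<phi> n x - v x) ^ 3)
      + (LINT x|?M. norm (jacobian (\<phi> n) (at x) - grad \<Omega> v x) ^ 3) < inverse (real (Suc n))" for n
  proof -
    have "W1p_norm \<Omega> 3 (\<lambda>x. v x - \<phi> n x) powr 3 < e n powr 3"
      using \<phi>(2)[of n] by (intro powr_less_mono2) (simp_all add: W1p_norm_def)
    moreover have "(LINT x|?M. norm (jacobian (\<phi> n) (at x) - grad \<Omega> v x) ^ 3)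
       = (LINT x|?M. norm (grad \<Omega> (\<lambda>x. v x - \<phi> n x) x) powr 3)"
    proof (rule integral_lebesgue_on_cong_AE[OF \<Omega>s])
      have "AE x in ?M. grad \<Omega> (\<lambda>x. v x - \<phi> n x) x = grad \<Omega> v x - jacobian (\<phi> n) (at x)"
        by (intro grad_eq_weak_gradient \<Omega> weak_gradient_diff \<Omega>s gv weak_gradient_test_function \<phi>)
      then show "AE x in ?M. norm (jacobian (\<phi> n) (at x) - grad \<Omega> v x) ^ 3
          = norm (grad \<Omega> (\<lambda>x. v x - \<phi> n x) x) powr 3"
        by eventually_elim (simp add: norm_minus_commute)
    qed (rule borel_measurable_integrable[OF i2])
    moreover have "(LINT x|?M. norm (\<phi> n x - v x) ^ 3) = (LINT x|?M. norm (v x - \<phi> n x) powr 3)"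
      by (simp add: norm_minus_commute)
    ultimately show ?thesis
      using W1p_norm_powr[of 3 \<Omega> "\<lambda>x. v x - \<phi> n x"] e(2)[of n] by simp
  qed
  have nn: "0 \<le> (LINT x|?M. norm (\<phi> n x - v x) ^ 3)"
     "0 \<le> (LINT x|?M. norm (jacobian (\<phi> n) (at x) - grad \<Omega> v x) ^ 3)" for n
    by (intro integral_nonneg_AE AE_I2; simp)+
  have le: "(LINT x|?M. norm (\<phi> n x - v x) ^ 3) \<le> inverse (real (Suc n))"
     "(LINT x|?M. norm (jacobian (\<phi> n) (at x) - grad \<Omega> v x) ^ 3) \<le> inverse (real (Suc n))" for n
    using est[of n] nn[of n] by linarith+
  have lim1: "(\<lambda>n. LINT x|?M. norm (\<phi> n x - v x) ^ 3) \<longlonglongrightarrow> 0"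
    by (rule real_tendsto_sandwich[OF _ _ tendsto_const LIMSEQ_inverse_real_of_nat])
      (rule always_eventually, rule allI, rule nn le)+
  have lim2: "(\<lambda>n. LINT x|?M. norm (jacobian (\<phi> n) (at x) - grad \<Omega> v x) ^ 3) \<longlonglongrightarrow> 0"
    by (rule real_tendsto_sandwich[OF _ _ tendsto_const LIMSEQ_inverse_real_of_nat])
      (rule always_eventually, rule allI, rule nn le)+
  show ?thesis by (rule that[OF \<phi>(1) i1 i2 lim1 lim2])
qed


lemma component_cube:
  fixes F :: "'a \<Rightarrow> 'b::euclidean_space"
  assumes i: "integrable M (\<lambda>x. norm (F x) ^ 3)" and [measurable]: "f \<in> borel_measurable M"
    and le: "\<And>x. \<bar>f x\<bar> \<le> norm (F x)"
  shows "integrable M (\<lambda>x. \<bar>f x\<bar> ^ 3)" "(LINT x|M. \<bar>f x\<bar> ^ 3) \<le> (LINT x|M. norm (F x) ^ 3)"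
proof -
  show "integrable M (\<lambda>x. \<bar>f x\<bar> ^ 3)"
    by (rule Bochner_Integration.integrable_bound[OF i]) (auto intro!: AE_I2 power_mono le)
  then show "(LINT x|M. \<bar>f x\<bar> ^ 3) \<le> (LINT x|M. norm (F x) ^ 3)"
    by (intro integral_mono i) (auto intro!: power_mono le)
qed

lemma component_cube_tendsto_0:
  fixes F :: "nat \<Rightarrow> 'a \<Rightarrow> 'b::euclidean_space"
  assumes i: "\<And>n. integrable M (\<lambda>x. norm (F n x) ^ 3)" and m: "\<And>n. f n \<in> borel_measurable M"
    and le: "\<And>n x. \<bar>f n x\<bar> \<le> norm (F n x)"
    and lim: "(\<lambda>n. LINT x|M. norm (F n x) ^ 3) \<longlonglongrightarrow> 0"
  shows "(\<lambda>n. LINT x|M. \<bar>f n x\<bar> ^ 3) \<longlonglongrightarrow> 0"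
proof (rule real_tendsto_sandwich[OF _ _ tendsto_const lim])
  show "\<forall>\<^sub>F n in sequentially. (LINT x|M. \<bar>f n x\<bar> ^ 3) \<le> (LINT x|M. norm (F n x) ^ 3)"
    using component_cube(2)[OF i m le] by simp
qed simp

lemma abs_nth_le_norm: "\<bar>x $ i\<bar> \<le> norm (x :: real^'n)"
  by (rule component_le_norm_cart)

lemma abs_nth_nth_le_norm: "\<bar>A $ i $ j\<bar> \<le> norm (A :: real^'n^'m)"
  using order_trans[OF component_le_norm_cart Finite_Cartesian_Product.norm_nth_le] by blast

lemma borel_measurable_vec_nth:
  fixes f :: "'a \<Rightarrow> 'b::euclidean_space^'m"
  shows "f \<in> borel_measurable M \<Longrightarrow> (\<lambda>x. f x $ i) \<in> borel_measurable M"
  by (rule borel_measurable_continuous_on[OF linear_continuous_on[OF bounded_linear_vec_nth]])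

text \<open>
  Both identities hold for test fields because \<open>\<partial>\<^sub>j (\<phi>\<^sub>j \<phi>\<^sub>i\<^sup>2)\<close> and \<open>\<partial>\<^sub>j \<phi>\<^sub>j\<close> have integral zero, and
  they pass to the limit as trilinear integrals; for the second one, and for the integrability of the
  gradient, two of the three factors are the constant 1.
\<close>

lemma velocity_space_identities:
  fixes \<Omega> :: "(real^'n) set"
  assumes \<Omega>: "open \<Omega>" "bounded \<Omega>" and v: "v \<in> velocity_space \<Omega>"
  shows "2 * (LINT x|lebesgue_on \<Omega>. grad \<Omega> v x $ i $ j * v x $ j * v x $ i)
     + (LINT x|lebesgue_on \<Omega>. grad \<Omega> v x $ j $ j * v x $ i * v x $ i) = 0"
    and "(LINT x|lebesgue_on \<Omega>. grad \<Omega> v x $ j $ j) = 0"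
    and "integrable (lebesgue_on \<Omega>) (\<lambda>x. grad \<Omega> v x $ k $ j * v x $ l * v x $ i)"
    and "integrable (lebesgue_on \<Omega>) (\<lambda>x. grad \<Omega> v x $ k $ j)"
proof -
  let ?M = "lebesgue_on \<Omega>"
  interpret finite_measure ?M by (rule finite_measure_lebesgue_on_bounded[OF \<Omega>])
  have \<Omega>s: "\<Omega> \<in> sets lebesgue" using \<Omega>(1) by auto
  obtain \<phi> :: "nat \<Rightarrow> real^'n \<Rightarrow> real^'n" where \<phi>: "\<And>n. test_function \<Omega> (\<phi> n)"
    "\<And>n. integrable ?M (\<lambda>x. norm (\<phi> n x - v x) ^ 3)"
    "\<And>n. integrable ?M (\<lambda>x. norm (jacobian (\<phi> n) (at x) - grad \<Omega> v x) ^ 3)"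
    "(\<lambda>n. LINT x|?M. norm (\<phi> n x - v x) ^ 3) \<longlonglongrightarrow> 0"
    "(\<lambda>n. LINT x|?M. norm (jacobian (\<phi> n) (at x) - grad \<Omega> v x) ^ 3) \<longlonglongrightarrow> 0"
    by (rule velocity_space_approx[OF \<Omega> v]) (rule that)
  have "v \<in> Lp_space \<Omega> 3" "grad \<Omega> v \<in> Lp_space \<Omega> 3"
    using v by (auto simp: velocity_space_def W1p_space_def)
  then have v3: "v \<in> borel_measurable ?M" "grad \<Omega> v \<in> borel_measurable ?M"
    "integrable ?M (\<lambda>x. norm (v x) ^ 3)" "integrable ?M (\<lambda>x. norm (grad \<Omega> v x) ^ 3)"
    by (auto simp: Lp_space_3_iff)
  have mp: "\<phi> n \<in> borel_measurable ?M" "(\<lambda>x. jacobian (\<phi> n) (at x)) \<in> borel_measurable ?M" for n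
    by (rule test_function_measurable_lebesgue_on[OF \<phi>(1)])
      (rule continuous_measurable_lebesgue_on[OF continuous_jacobian[OF \<phi>(1)]])
  have mv: "(\<lambda>x. v x $ i) \<in> borel_measurable ?M" "(\<lambda>x. grad \<Omega> v x $ i $ j) \<in> borel_measurable ?M"
    "(\<lambda>x. \<phi> n x $ i) \<in> borel_measurable ?M" "(\<lambda>x. jacobian (\<phi> n) (at x) $ i $ j) \<in> borel_measurable ?M" for i j n
    by (intro borel_measurable_vec_nth v3 mp)+
  have iv: "integrable ?M (\<lambda>x. \<bar>v x $ i\<bar> ^ 3)" "integrable ?M (\<lambda>x. \<bar>grad \<Omega> v x $ i $ j\<bar> ^ 3)" for i j
    by (rule component_cube(1)[OF v3(3) mv(1) abs_nth_le_norm], rule component_cube(1)[OF v3(4) mv(2) abs_nth_nth_le_norm])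
  have le: "\<bar>\<phi> n x $ i - v x $ i\<bar> \<le> norm (\<phi> n x - v x)"
     "\<bar>jacobian (\<phi> n) (at x) $ i $ j - grad \<Omega> v x $ i $ j\<bar> \<le> norm (jacobian (\<phi> n) (at x) - grad \<Omega> v x)" for n x i j
    using abs_nth_le_norm[of "\<phi> n x - v x" i] abs_nth_nth_le_norm[of "jacobian (\<phi> n) (at x) - grad \<Omega> v x" i j] by simp_all
  have md: "(\<lambda>x. \<phi> n x $ i - v x $ i) \<in> borel_measurable ?M"
    "(\<lambda>x. jacobian (\<phi> n) (at x) $ i $ j - grad \<Omega> v x $ i $ j) \<in> borel_measurable ?M" for n i j
    by (intro borel_measurable_diff mv)+
  have idv: "integrable ?M (\<lambda>x. \<bar>\<phi> n x $ i - v x $ i\<bar> ^ 3)"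
    "integrable ?M (\<lambda>x. \<bar>jacobian (\<phi> n) (at x) $ i $ j - grad \<Omega> v x $ i $ j\<bar> ^ 3)" for n i j
    by (rule component_cube(1)[OF \<phi>(2) md(1) le(1)], rule component_cube(1)[OF \<phi>(3) md(2) le(2)])
  have lim: "(\<lambda>n. LINT x|?M. \<bar>\<phi> n x $ i - v x $ i\<bar> ^ 3) \<longlonglongrightarrow> 0"
    "(\<lambda>n. LINT x|?M. \<bar>jacobian (\<phi> n) (at x) $ i $ j - grad \<Omega> v x $ i $ j\<bar> ^ 3) \<longlonglongrightarrow> 0" for i j
    by (rule component_cube_tendsto_0[OF \<phi>(2) md(1) le(1) \<phi>(4)], rule component_cube_tendsto_0[OF \<phi>(3) md(2) le(2) \<phi>(5)])
  have L: "(\<lambda>n. LINT x|?M. jacobian (\<phi> n) (at x) $ k $ j * \<phi> n x $ l * \<phi> n x $ i)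
     \<longlonglongrightarrow> (LINT x|?M. grad \<Omega> v x $ k $ j * v x $ l * v x $ i)" for i j k l
    by (rule triple_product_integral_tendsto) (rule mv iv idv lim)+
  have id: "2 * (LINT x|?M. jacobian (\<phi> n) (at x) $ i $ j * \<phi> n x $ j * \<phi> n x $ i)
     + (LINT x|?M. jacobian (\<phi> n) (at x) $ j $ j * \<phi> n x $ i * \<phi> n x $ i) = 0" for n
  proof -
    note t = test_function_nth[OF \<phi>(1)[of n]]
    note tJ = test_function_jacobian[OF \<phi>(1)[of n]]
    have ti: "test_function \<Omega> (\<lambda>x. \<phi> n x $ i * \<phi> n x $ i)"
      by (intro test_function_mult t test_function_C_k[OF t])
    have 0: "(LINT x|?M. frechet_derivative (\<lambda>x. \<phi> n x $ j * (\<phi> n x $ i * \<phi> n x $ i)) (at x) (axis j 1)) = 0"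
      by (intro integral_frechet_derivative_test_function \<Omega>s test_function_mult t test_function_C_k[OF ti])
    have 1: "frechet_derivative (\<lambda>x. \<phi> n x $ j * (\<phi> n x $ i * \<phi> n x $ i)) (at x) (axis j 1) =
       2 * (jacobian (\<phi> n) (at x) $ i $ j * \<phi> n x $ j * \<phi> n x $ i) + jacobian (\<phi> n) (at x) $ j $ j * \<phi> n x $ i * \<phi> n x $ i" for x
      unfolding frechet_derivative_mult[OF test_function_has_derivative[OF t] test_function_has_derivative[OF ti]]
        frechet_derivative_mult[OF test_function_has_derivative[OF t] test_function_has_derivative[OF t]]
        frechet_derivative_component[OF \<phi>(1)] by (simp add: algebra_simps)
    have ib: "integrable ?M (\<lambda>x. jacobian (\<phi> n) (at x) $ k $ j * \<phi> n x $ l * \<phi> n x $ i)" for k l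
    proof -
      have "test_function \<Omega> (\<lambda>x. jacobian (\<phi> n) (at x) $ k $ j * \<phi> n x $ l)"
        by (intro test_function_mult tJ test_function_C_k[OF t])
      then show ?thesis
        using locally_integrable_continuous[OF test_function_continuous[OF t[of i]], of \<Omega>]
        by (subst mult.commute) (rule integrable_mult_test_function[OF \<Omega>s])
    qed
    show ?thesis using 0 ib[of i j] ib[of j i] unfolding 1 by simp
  qed
  have "(\<lambda>n. 2 * (LINT x|?M. jacobian (\<phi> n) (at x) $ i $ j * \<phi> n x $ j * \<phi> n x $ i)
     + (LINT x|?M. jacobian (\<phi> n) (at x) $ j $ j * \<phi> n x $ i * \<phi> n x $ i)) \<longlonglongrightarrow>
     2 * (LINT x|?M. grad \<Omega> v x $ i $ j * v x $ j * v x $ i)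
     + (LINT x|?M. grad \<Omega> v x $ j $ j * v x $ i * v x $ i)"
    by (intro tendsto_intros L)
  then show "2 * (LINT x|?M. grad \<Omega> v x $ i $ j * v x $ j * v x $ i)
     + (LINT x|?M. grad \<Omega> v x $ j $ j * v x $ i * v x $ i) = 0"
    by (simp add: id LIMSEQ_const_iff)
  have L1: "(\<lambda>n. LINT x|?M. jacobian (\<phi> n) (at x) $ j $ j * 1 * 1) \<longlonglongrightarrow> (LINT x|?M. grad \<Omega> v x $ j $ j * 1 * 1)"
    by (rule triple_product_integral_tendsto) (rule mv iv idv lim | simp)+
  have "(LINT x|?M. jacobian (\<phi> n) (at x) $ j $ j) = 0" for n
    using integral_frechet_derivative_test_function[OF \<Omega>s test_function_nth[OF \<phi>(1)[of n], of j], of "axis j 1"]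
    by (simp add: frechet_derivative_component[OF \<phi>(1)])
  then show "(LINT x|?M. grad \<Omega> v x $ j $ j) = 0"
    using L1 by (simp add: LIMSEQ_const_iff)
  show "integrable ?M (\<lambda>x. grad \<Omega> v x $ k $ j * v x $ l * v x $ i)"
    by (rule triple_product_integrable) (rule mv iv)+
  have "integrable ?M (\<lambda>x. grad \<Omega> v x $ k $ j * 1 * 1)"
    by (rule triple_product_integrable) (rule mv iv | simp)+
  then show "integrable ?M (\<lambda>x. grad \<Omega> v x $ k $ j)" by simp
qed

text \<open>
  The divergence may be used as the pressure that tests it: it is square integrable because a
  square is at most 1 plus a cube and \<open>\<Omega>\<close> has finite measure, and it has mean zero.
\<close>

lemma divergence_zero_AE:
  fixes \<Omega> :: "(real^'n) set"
  assumes \<Omega>: "open \<Omega>" "bounded \<Omega>" and v: "v \<in> velocity_space \<Omega>"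
    and div: "\<And>q. q \<in> pressure_space \<Omega> \<Longrightarrow> inner_L2 \<Omega> q (divergence \<Omega> v) = 0"
  shows "AE x in lebesgue_on \<Omega>. divergence \<Omega> v x = 0"
proof -
  let ?M = "lebesgue_on \<Omega>" and ?d = "divergence \<Omega> v"
  interpret finite_measure ?M by (rule finite_measure_lebesgue_on_bounded[OF \<Omega>])
  have d: "?d x = (\<Sum>j\<in>UNIV. grad \<Omega> v x $ j $ j)" for x
    by (simp add: divergence_def trace_def)
  have "grad \<Omega> v \<in> Lp_space \<Omega> 3" using v by (auto simp: velocity_space_def W1p_space_def)
  then have g: "grad \<Omega> v \<in> borel_measurable ?M" "integrable ?M (\<lambda>x. norm (grad \<Omega> v x) ^ 3)"
    by (auto simp: Lp_space_3_iff)
  have md: "?d \<in> borel_measurable ?M"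
    unfolding d by (intro borel_measurable_sum borel_measurable_vec_nth g(1))
  have int0: "integral\<^sup>L ?M ?d = 0"
    unfolding d using velocity_space_identities(2,4)[OF \<Omega> v] by (subst Bochner_Integration.integral_sum) auto
  have sq: "integrable ?M (\<lambda>x. (?d x)\<^sup>2)"
  proof (rule Bochner_Integration.integrable_bound)
    let ?C = "real CARD('n)"
    show "integrable ?M (\<lambda>x. ?C\<^sup>2 * (1 + norm (grad \<Omega> v x) ^ 3))" using g(2) by simp
    have "(?d x)\<^sup>2 \<le> ?C\<^sup>2 * (1 + norm (grad \<Omega> v x) ^ 3)" for x
    proof -
      have "\<bar>?d x\<bar> \<le> (\<Sum>j\<in>(UNIV::'n set). norm (grad \<Omega> v x))"
        unfolding d by (rule order_trans[OF sum_abs]) (intro sum_mono abs_nth_nth_le_norm)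
      then have "\<bar>?d x\<bar>\<^sup>2 \<le> (?C * norm (grad \<Omega> v x))\<^sup>2" by (intro power_mono) simp_all
      also have "\<dots> = ?C\<^sup>2 * (norm (grad \<Omega> v x))\<^sup>2" by (simp add: power_mult_distrib)
      also have "\<dots> \<le> ?C\<^sup>2 * (1 + norm (grad \<Omega> v x) ^ 3)"
      proof (intro mult_left_mono)
        show "(norm (grad \<Omega> v x))\<^sup>2 \<le> 1 + norm (grad \<Omega> v x) ^ 3"
        proof (cases "norm (grad \<Omega> v x) \<le> 1")
          case True
          then have "(norm (grad \<Omega> v x))\<^sup>2 \<le> 1" by (simp add: power_le_one)
          then show ?thesis using zero_le_power[OF norm_ge_zero, of "grad \<Omega> v x" 3] by linarith
        next
          case False
          then have "(norm (grad \<Omega> v x))\<^sup>2 \<le> norm (grad \<Omega> v x) ^ 3" by (intro power_increasing) auto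
          then show ?thesis by linarith
        qed
      qed simp
      finally show ?thesis by simp
    qed
    then show "AE x in ?M. norm ((?d x)\<^sup>2) \<le> norm (?C\<^sup>2 * (1 + norm (grad \<Omega> v x) ^ 3))"
      by (intro AE_I2) (simp add: abs_of_nonneg)
  qed (use md in simp)
  have "?d \<in> pressure_space \<Omega>"
    using md sq int0 by (simp add: pressure_space_def Lp_space_2_iff)
  then have "(LINT x|?M. (?d x)\<^sup>2) = 0"
    using div[of ?d] by (simp add: inner_L2_def power2_eq_square)
  then have "AE x in ?M. (?d x)\<^sup>2 = 0"
    using integral_nonneg_eq_0_iff_AE[OF sq] by simp
  then show ?thesis by eventually_elim simp
qed

text \<open>
  Summing the identities for the test fields over \<open>i\<close> and \<open>j\<close> expresses the convective term by
  the integral of \<open>(\<nabla> \<cdot> v) |v|\<^sup>2\<close>.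
\<close>

lemma convective_term_zero:
  fixes \<Omega> :: "(real^'n) set"
  assumes \<Omega>: "open \<Omega>" "bounded \<Omega>" and v: "v \<in> velocity_space \<Omega>"
    and div: "\<And>q. q \<in> pressure_space \<Omega> \<Longrightarrow> inner_L2 \<Omega> q (divergence \<Omega> v) = 0"
  shows "inner_L2 \<Omega> (\<lambda>x. grad \<Omega> v x *v v x) v = 0"
proof -
  let ?M = "lebesgue_on \<Omega>" and ?G = "grad \<Omega> v"
  note I = velocity_space_identities[OF \<Omega> v]
  have div0: "AE x in ?M. divergence \<Omega> v x = 0" by (rule divergence_zero_AE[OF \<Omega> v div])
  have "inner_L2 \<Omega> (\<lambda>x. ?G x *v v x) v = (LINT x|?M. (\<Sum>i\<in>UNIV. \<Sum>j\<in>UNIV. ?G x $ i $ j * v x $ j * v x $ i))"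
    by (simp add: inner_L2_def inner_vec_def matrix_vector_mult_def sum_distrib_right)
  also have "\<dots> = (\<Sum>i\<in>UNIV. \<Sum>j\<in>UNIV. LINT x|?M. ?G x $ i $ j * v x $ j * v x $ i)"
    by (simp add: I(3))
  also have "2 * \<dots> = - (\<Sum>i\<in>UNIV. \<Sum>j\<in>UNIV. LINT x|?M. ?G x $ j $ j * v x $ i * v x $ i)"
  proof -
    have "2 * (LINT x|?M. ?G x $ i $ j * v x $ j * v x $ i) = - (LINT x|?M. ?G x $ j $ j * v x $ i * v x $ i)" for i j
      using I(1)[of i j] by linarith
    then show ?thesis by (simp add: sum_distrib_left sum_negf)
  qed
  also have "(\<Sum>i\<in>UNIV. \<Sum>j\<in>UNIV. LINT x|?M. ?G x $ j $ j * v x $ i * v x $ i)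
     = (LINT x|?M. (\<Sum>i\<in>UNIV. divergence \<Omega> v x * v x $ i * v x $ i))"
    by (simp add: I(3) divergence_def trace_def sum_distrib_right)
  also have "\<dots> = 0"
  proof (rule integral_eq_zero_AE)
    show "AE x in ?M. (\<Sum>i\<in>UNIV. divergence \<Omega> v x * v x $ i * v x $ i) = 0"
      using div0 by eventually_elim simp
  qed
  finally show ?thesis by simp
qed

section \<open>Primitives of balanced bumps\<close>

lemma integral_lebesgue_on_subset:
  fixes f :: "'a::euclidean_space \<Rightarrow> real"
  assumes "A \<subseteq> S" "A \<in> sets lebesgue" "S \<in> sets lebesgue" "\<And>x. x \<in> S \<Longrightarrow> x \<notin> A \<Longrightarrow> f x = 0"
  shows "integral\<^sup>L (lebesgue_on S) f = integral\<^sup>L (lebesgue_on A) f"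
proof -
  have "integral\<^sup>L (lebesgue_on S) f = integral\<^sup>L (lebesgue_on S) (\<lambda>x. if x \<in> A then f x else 0)"
    by (rule Bochner_Integration.integral_cong) (use assms(4) in auto)
  then show ?thesis using integral_restrict[OF assms(1-3), of f] by simp
qed

lemma integrable_lebesgue_on_subset:
  fixes f :: "'a::euclidean_space \<Rightarrow> 'b::euclidean_space"
  assumes f: "integrable (lebesgue_on S) f" and "A \<subseteq> S" "A \<in> sets lebesgue" "S \<in> sets lebesgue"
  shows "integrable (lebesgue_on A) f"
proof -
  have "integrable lebesgue (\<lambda>x. indicator S x *\<^sub>R f x)"
    using f assms(4) by (simp add: integrable_restrict_space)
  then have "integrable lebesgue (\<lambda>x. indicator A x *\<^sub>R (indicator S x *\<^sub>R f x))"
    by (rule integrable_mult_indicator[OF assms(3)])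
  moreover have "(\<lambda>x. indicator A x *\<^sub>R (indicator S x *\<^sub>R f x)) = (\<lambda>x. indicator A x *\<^sub>R f x)"
    using assms(2) by (auto simp: indicator_def fun_eq_iff)
  ultimately show ?thesis using assms(3) by (simp add: integrable_restrict_space)
qed

lemma test_function_deriv:
  fixes \<phi> :: "real \<Rightarrow> real"
  assumes "test_function U \<phi>"
  shows "(\<phi> has_real_derivative deriv \<phi> t) (at t)" "test_function U (deriv \<phi>)"
    "deriv \<phi> t = frechet_derivative \<phi> (at t) 1"
proof -
  have lin: "frechet_derivative \<phi> (at t) = (\<lambda>h. frechet_derivative \<phi> (at t) 1 * h)" for t
  proof
    fix h
    have "linear (frechet_derivative \<phi> (at t))"
      using test_function_has_derivative[OF assms] has_derivative_linear by blast
    from linear_cmul[OF this, of h 1] show "frechet_derivative \<phi> (at t) h = frechet_derivative \<phi> (at t) 1 * h"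
      by (simp add: mult.commute)
  qed
  have "(\<phi> has_derivative (\<lambda>h. frechet_derivative \<phi> (at t) 1 * h)) (at t)" for t
    using test_function_has_derivative[OF assms, of t] lin[of t] by simp
  then have d: "(\<phi> has_real_derivative frechet_derivative \<phi> (at t) 1) (at t)" for t
    by (simp add: has_field_derivative_def)
  have e: "deriv \<phi> t = frechet_derivative \<phi> (at t) 1" for t by (rule DERIV_imp_deriv[OF d])
  then show "deriv \<phi> t = frechet_derivative \<phi> (at t) 1" .
  show "(\<phi> has_real_derivative deriv \<phi> t) (at t)" unfolding e by (rule d)
  have "deriv \<phi> = (\<lambda>t. frechet_derivative \<phi> (at t) 1)" using d by (auto intro: DERIV_imp_deriv)
  then show "test_function U (deriv \<phi>)" using test_function_frechet_derivative[OF assms] by simp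
qed

lemma compact_subset_open_interval:
  fixes K :: "real set"
  assumes "compact K" "K \<subseteq> {0<..<T}" "0 < T"
  obtains \<alpha> \<beta> where "0 < \<alpha>" "\<alpha> < \<beta>" "\<beta> < T" "K \<subseteq> {\<alpha><..<\<beta>}"
proof (cases "K = {}")
  case True
  then show ?thesis using that[of "T / 3" "2 * T / 3"] assms by simp
next
  case False
  obtain l where l: "l \<in> K" "\<And>t. t \<in> K \<Longrightarrow> l \<le> t" using compact_attains_inf[OF assms(1) False] by blast
  obtain r where r: "r \<in> K" "\<And>t. t \<in> K \<Longrightarrow> t \<le> r" using compact_attains_sup[OF assms(1) False] by blast
  have b: "0 < l" "l < T" "0 < r" "r < T" "l \<le> r" using l r assms(2) by auto
  have "K \<subseteq> {l / 2<..<(r + T) / 2}" using l(2) r(2) b by fastforce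
  then show ?thesis using that[of "l / 2" "(r + T) / 2"] b by simp
qed

definition bump_mass :: "real \<Rightarrow> real \<Rightarrow> nat \<Rightarrow> real" where
  "bump_mass a b n = (LINT t|lborel. bump a b n t)"

text \<open>
  The combination of two bumps that has mean zero, hence a primitive with compact support.
\<close>

definition balanced_bump :: "real \<Rightarrow> real \<Rightarrow> nat \<Rightarrow> real \<Rightarrow> real \<Rightarrow> nat \<Rightarrow> real \<Rightarrow> real" where
  "balanced_bump a b n c d m t = bump_mass c d m * bump a b n t - bump_mass a b n * bump c d m t"

lemma bump_integrable: "integrable lborel (bump a b n)"
proof (rule Bochner_Integration.integrable_bound)
  show "integrable lborel (indicator (cbox a b) :: 'a \<Rightarrow> real)"
    using emeasure_bounded_finite[OF bounded_cbox] by (intro integrable_real_indicator) (auto simp: less_top)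
  show "AE x in lborel. norm (bump a b n x) \<le> norm (indicator (cbox a b) x :: real)"
    using bump_nonneg[of a b n] bump_le_1[of a b n] bump_eq_0[of _ a b n] box_subset_cbox[of a b]
    by (intro AE_I2) (force simp: indicator_def)
qed (simp add: bump_measurable)

lemma bump_mass_pos:
  assumes "a < b" shows "bump_mass a b 1 > 0"
proof -
  have "bump_mass a b 1 \<noteq> 0"
  proof
    assume "bump_mass a b 1 = 0"
    then have "AE t in lborel. bump a b 1 t = 0"
      unfolding bump_mass_def using integral_nonneg_eq_0_iff_AE[OF bump_integrable] bump_nonneg by blast
    moreover have "bump a b 1 t \<noteq> 0" if "t \<in> {a<..<b}" for t
      using that by (simp add: bump_def flat_exp_def)
    ultimately have "AE t in lborel. t \<notin> {a<..<b}" by (auto elim!: eventually_mono)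
    then have "{a<..<b} \<in> null_sets lborel" by (subst AE_iff_null_sets) simp_all
    then have "emeasure lborel {a<..<b} = 0" by (simp add: null_sets_def)
    then show False using assms by (simp add: ennreal_eq_0_iff)
  qed
  moreover have "bump_mass a b 1 \<ge> 0" unfolding bump_mass_def by (simp add: bump_nonneg)
  ultimately show ?thesis by simp
qed

lemma bump_zero_outside: "t \<le> a \<or> b \<le> t \<Longrightarrow> bump a b n t = 0" for t :: real
  by (rule bump_eq_0) (auto simp: box_real)

lemma balanced_bump_primitive_exists:
  fixes a b c d :: real
  shows "\<exists>B. (\<forall>t. (B has_real_derivative balanced_bump a b n c d m t) (at t)) \<and>
    (\<forall>t. t \<notin> {min a c..max b d} \<longrightarrow> B t = 0)"
proof (cases "min a c \<le> max b d")
  case True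
  let ?g = "balanced_bump a b n c d m" and ?l = "min a c" and ?r = "max b d"
  have cont: "continuous_on UNIV ?g"
    unfolding balanced_bump_def using C_k_bump[of 0] by (intro continuous_intros) simp_all
  then have "\<And>x. isCont ?g x" by (simp add: continuous_on_eq_continuous_at)
  then obtain F where "\<And>t. (F has_vector_derivative ?g t) (at t)"
    using einterval_antiderivative[of "-\<infinity>" \<infinity> ?g] by auto
  then have F: "\<And>t. (F has_real_derivative ?g t) (at t)"
    by (simp add: has_real_derivative_iff_has_vector_derivative)
  have out: "?g t = 0" if "t \<le> ?l \<or> ?r \<le> t" for t
    using that by (auto simp: balanced_bump_def bump_zero_outside)
  have const: "\<exists>k. \<forall>x\<in>S. F x = k" if "convex S" "\<And>x. x \<in> S \<Longrightarrow> x \<le> ?l \<or> ?r \<le> x" for S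
  proof (rule has_field_derivative_zero_constant[OF that(1)])
    fix x assume "x \<in> S"
    then have "?g x = 0" using out that(2) by blast
    then show "(F has_field_derivative 0) (at x within S)"
      using F[of x] has_field_derivative_at_within by metis
  qed
  have left: "F t = F ?l" if "t \<le> ?l" for t using const[of "{..?l}"] that by auto
  have right: "F t = F ?r" if "?r \<le> t" for t using const[of "{?r..}"] that by auto
  have "F ?r - F ?l = (LINT t|lborel. ?g t * indicator {?l..?r} t)"
    using True F cont by (subst integral_FTC_Icc_real) (auto simp: continuous_on_eq_continuous_at)
  also have "\<dots> = (LINT t|lborel. ?g t)"
  proof (intro Bochner_Integration.integral_cong refl)
    show "?g t * indicator {?l..?r} t = ?g t" for t
      using out[of t] by (cases "t \<in> {?l..?r}") (auto simp del: min.bounded_iff max.bounded_iff)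
  qed
  also have "\<dots> = 0"
    unfolding balanced_bump_def by (simp add: bump_integrable bump_mass_def)
  finally have lr: "F ?r = F ?l" by simp
  show ?thesis
  proof (intro exI[of _ "\<lambda>t. F t - F ?l"] conjI allI impI)
    show "((\<lambda>t. F t - F ?l) has_real_derivative ?g t) (at t)" for t
      using F by (auto intro!: derivative_eq_intros)
    show "F t - F ?l = 0" if "t \<notin> {?l..?r}" for t
    proof (cases "t < ?l")
      case True
      then show ?thesis using left[of t] by linarith
    next
      case False
      then have "?r \<le> t" using that by auto
      then show ?thesis using right[of t] lr by linarith
    qed
  qed
next
  case False
  then have "balanced_bump a b n c d m t = 0" for t
    using bump_zero_outside[of t a b] bump_zero_outside[of t c d] by (force simp: balanced_bump_def)
  then show ?thesis by (intro exI[of _ "\<lambda>t. 0"]) auto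
qed

text \<open>
  For intervals with rational ends these primitives form a countable family of test functions,
  and it is this family that the du Bois-Reymond argument uses.
\<close>

definition bump_primitive :: "real \<Rightarrow> real \<Rightarrow> nat \<Rightarrow> real \<Rightarrow> real \<Rightarrow> nat \<Rightarrow> real \<Rightarrow> real" where
  "bump_primitive a b n c d m = (SOME B. (\<forall>t. (B has_real_derivative balanced_bump a b n c d m t) (at t)) \<and>
    (\<forall>t. t \<notin> {min a c..max b d} \<longrightarrow> B t = 0))"

lemma bump_primitive:
  "(bump_primitive a b n c d m has_real_derivative balanced_bump a b n c d m t) (at t)"
  "t \<notin> {min a c..max b d} \<Longrightarrow> bump_primitive a b n c d m t = 0"
  using someI_ex[OF balanced_bump_primitive_exists[of a b n c d m]] unfolding bump_primitive_def by blast+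

lemma deriv_bump_primitive: "deriv (bump_primitive a b n c d m) t = balanced_bump a b n c d m t"
  by (rule DERIV_imp_deriv[OF bump_primitive(1)])

lemma test_function_bump_primitive:
  assumes "{a, b, c, d} \<subseteq> {\<alpha><..<\<beta>}"
  shows "test_function {\<alpha><..<\<beta>} (bump_primitive a b n c d m)"
proof -
  let ?B = "bump_primitive a b n c d m" and ?J = "{min a c..max b d}"
  have sub: "closure {x. ?B x \<noteq> 0} \<subseteq> ?J"
  proof (rule closure_minimal)
    show "{x. ?B x \<noteq> 0} \<subseteq> ?J" using bump_primitive(2)[of _ a c b d n m] by blast
  qed simp
  have "?J \<subseteq> {\<alpha><..<\<beta>}" using assms by (auto simp: min_def max_def split: if_splits)
  then have sub': "closure {x. ?B x \<noteq> 0} \<subseteq> {\<alpha><..<\<beta>}" using sub by blast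
  have "compact (?J \<inter> closure {x. ?B x \<noteq> 0})" by (intro compact_Int_closed) auto
  moreover have "C_k k (balanced_bump a b n c d m)" for k
  proof -
    have "balanced_bump a b n c d m = (\<lambda>t. bump_mass c d m *\<^sub>R bump a b n t + (- bump_mass a b n) *\<^sub>R bump c d m t)"
      by (simp add: balanced_bump_def fun_eq_iff)
    moreover have "C_k k \<dots>"
      by (rule C_k_add; rule C_k_compose_linear[OF bounded_linear_scaleR_right C_k_bump])
    ultimately show ?thesis by simp
  qed
  then have "C_k k ?B" for k by (rule C_k_antiderivative[OF bump_primitive(1)])
  ultimately show ?thesis
    using sub sub' by (simp add: test_function_def Int_absorb1)
qed

section \<open>The du Bois-Reymond lemma and squares of primitives\<close>

lemma integrable_bounded_mult:
  fixes k v :: "'a \<Rightarrow> real"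
  assumes v: "integrable M v" and k: "k \<in> borel_measurable M" and B: "\<And>x. \<bar>k x\<bar> \<le> B"
  shows "integrable M (\<lambda>x. k x * v x)"
proof (rule Bochner_Integration.integrable_bound)
  show "integrable M (\<lambda>x. B * v x)" using v by simp
  show "AE x in M. norm (k x * v x) \<le> norm (B * v x)"
  proof (intro AE_I2)
    fix x
    have "\<bar>k x\<bar> * \<bar>v x\<bar> \<le> \<bar>B\<bar> * \<bar>v x\<bar>" using B[of x] by (intro mult_right_mono) simp_all
    then show "norm (k x * v x) \<le> norm (B * v x)" by (simp add: abs_mult)
  qed
  show "(\<lambda>x. k x * v x) \<in> borel_measurable M" using k borel_measurable_integrable[OF v] by (rule borel_measurable_times)
qed

text \<open>
  The primitive that vanishes at the left end of an interval, written as an integral over a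
  fixed measure so that Fubini's theorem applies to it directly.
\<close>

definition primitive_on :: "real measure \<Rightarrow> (real \<Rightarrow> real) \<Rightarrow> real \<Rightarrow> real" where
  "primitive_on M v t = (LINT s|M. indicator {..t} s * v s)"

context
  fixes \<alpha> \<beta> :: real and M :: "real measure"
  assumes M_def: "M = lebesgue_on {\<alpha><..<\<beta>}"
begin

lemma finite_measure_M: "finite_measure M"
  unfolding M_def by (rule finite_measure_lebesgue_on_bounded) auto

lemma space_M: "space M = {\<alpha><..<\<beta>}"
  by (simp add: M_def)

lemma pair_sigma_finite_M: "pair_sigma_finite M M"
proof -
  interpret finite_measure M by (rule finite_measure_M)
  show ?thesis by unfold_locales
qed

lemma id_measurable_M: "(\<lambda>t. t) \<in> borel_measurable M"
  unfolding M_def by (rule continuous_measurable_lebesgue_on) auto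

lemma indicator_measurable_M: "A \<in> sets borel \<Longrightarrow> (\<lambda>t. indicator A t :: real) \<in> borel_measurable M"
  by (rule measurable_compose[OF id_measurable_M]) simp

lemma indicator_order_measurable:
  "(\<lambda>p. indicator {..fst p} (snd p) :: real) \<in> borel_measurable (M \<Otimes>\<^sub>M M)"
proof -
  have "fst \<in> borel_measurable (M \<Otimes>\<^sub>M M)" "snd \<in> borel_measurable (M \<Otimes>\<^sub>M M)"
    using measurable_compose[OF measurable_fst id_measurable_M, of M] measurable_compose[OF measurable_snd id_measurable_M, of M]
    by simp_all
  then have "Measurable.pred (M \<Otimes>\<^sub>M M) (\<lambda>p. snd p \<le> fst p)"
    unfolding pred_def by (intro borel_measurable_le)
  then have "(\<lambda>p. if snd p \<le> fst p then 1 else 0 :: real) \<in> borel_measurable (M \<Otimes>\<^sub>M M)"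
    by (intro measurable_If) (simp_all add: pred_def)
  then show ?thesis by (simp add: indicator_def of_bool_def)
qed

lemma truncated_integrable:
  fixes v :: "real \<Rightarrow> real"
  assumes "integrable M v" "A \<in> sets borel"
  shows "integrable M (\<lambda>s. indicator A s * v s)"
  by (rule integrable_bounded_mult[OF assms(1) indicator_measurable_M[OF assms(2)], of 1]) (simp add: indicator_def)

lemma primitive_on_bound:
  assumes v: "integrable M v"
  shows "\<bar>primitive_on M v t\<bar> \<le> (LINT s|M. \<bar>v s\<bar>)"
proof -
  have "\<bar>primitive_on M v t\<bar> \<le> (LINT s|M. \<bar>indicator {..t} s * v s\<bar>)"
    unfolding primitive_on_def by (rule integral_abs_bound)
  also have "\<dots> \<le> (LINT s|M. \<bar>v s\<bar>)"
    using truncated_integrable[OF v, of "{..t}"] v by (intro integral_mono) (auto simp: indicator_def)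
  finally show ?thesis .
qed

lemma primitive_on_measurable:
  assumes v: "integrable M v"
  shows "primitive_on M v \<in> borel_measurable M"
proof -
  interpret finite_measure M by (rule finite_measure_M)
  have "(\<lambda>p. indicator {..fst p} (snd p) * v (snd p)) \<in> borel_measurable (M \<Otimes>\<^sub>M M)"
    by (intro borel_measurable_times indicator_order_measurable
        measurable_compose[OF measurable_snd borel_measurable_integrable[OF v]])
  then have "(\<lambda>t. LINT s|M. indicator {..t} s * v s) \<in> borel_measurable M"
    by (intro borel_measurable_lebesgue_integral) (simp add: case_prod_beta')
  then show ?thesis by (simp add: primitive_on_def[abs_def])
qed

lemma integrable_mult_primitive:
  assumes v: "integrable M v" and z: "integrable M z"
  shows "integrable M (\<lambda>t. z t * primitive_on M v t)"
  using integrable_bounded_mult[OF z primitive_on_measurable[OF v] primitive_on_bound[OF v]]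
  by (simp add: mult.commute)

text \<open>
  Fubini's theorem for the triangle \<open>s \<le> t\<close>. It replaces integration by parts for absolutely
  continuous functions.
\<close>

lemma integral_mult_primitive:
  assumes v: "integrable M v" and z: "integrable M z"
  shows "(LINT t|M. z t * primitive_on M v t) = (LINT s|M. v s * (LINT t|M. indicator {s..} t * z t))"
proof -
  interpret P: pair_sigma_finite M M by (rule pair_sigma_finite_M)
  let ?f = "\<lambda>p. z (fst p) * (indicator {..fst p} (snd p) * v (snd p))"
  have m: "?f \<in> borel_measurable (M \<Otimes>\<^sub>M M)"
    by (intro borel_measurable_times indicator_order_measurable
        measurable_compose[OF measurable_snd borel_measurable_integrable[OF v]]
        measurable_compose[OF measurable_fst borel_measurable_integrable[OF z]])
  have i: "integrable (M \<Otimes>\<^sub>M M) ?f"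
  proof (rule P.Fubini_integrable[OF m])
    show "AE t in M. integrable M (\<lambda>s. z (fst (t, s)) * (indicator {..fst (t, s)} (snd (t, s)) * v (snd (t, s))))"
      using truncated_integrable[OF v] by simp
    \<comment> \<open>The integral of the absolute value over \<open>s\<close> is \<open>|z t|\<close> times the primitive of \<open>|v|\<close>.\<close>
    have "integrable M (\<lambda>t. z t * primitive_on M (\<lambda>s. \<bar>v s\<bar>) t)"
      using v z by (intro integrable_mult_primitive) simp_all
    then have "integrable M (\<lambda>t. \<bar>z t * primitive_on M (\<lambda>s. \<bar>v s\<bar>) t\<bar>)" by (rule integrable_abs)
    moreover have "0 \<le> primitive_on M (\<lambda>s. \<bar>v s\<bar>) t" for t
      unfolding primitive_on_def by (intro integral_nonneg_AE AE_I2) simp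
    ultimately show "integrable M (\<lambda>t. LINT s|M. norm (z (fst (t, s)) * (indicator {..fst (t, s)} (snd (t, s)) * v (snd (t, s)))))"
      by (simp add: abs_mult primitive_on_def)
  qed
  have "(LINT t|M. z t * primitive_on M v t) = (LINT t|M. LINT s|M. z t * (indicator {..t} s * v s))"
    by (simp add: primitive_on_def)
  also have "\<dots> = (LINT s|M. LINT t|M. z t * (indicator {..t} s * v s))"
    using P.Fubini_integral[of "\<lambda>t s. z t * (indicator {..t} s * v s)"] i by (simp add: case_prod_beta')
  also have "\<dots> = (LINT s|M. LINT t|M. v s * (indicator {s..} t * z t))"
    by (intro Bochner_Integration.integral_cong refl) (simp add: indicator_def)
  finally show ?thesis by simp
qed

lemma primitive_on_add:
  assumes "integrable M v" "integrable M w"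
  shows "primitive_on M (\<lambda>s. v s + w s) t = primitive_on M v t + primitive_on M w t"
  using truncated_integrable[OF assms(1), of "{..t}"] truncated_integrable[OF assms(2), of "{..t}"]
  by (simp add: primitive_on_def distrib_left)

lemma primitive_on_cmult: "primitive_on M (\<lambda>s. c * v s) t = c * primitive_on M v t"
  by (simp add: primitive_on_def mult.left_commute)

text \<open>
  Apply the exchange of integrals with \<open>z\<close> equal to \<open>v\<close> cut off at \<open>t\<close>. The inner integral over
  \<open>s \<le> r \<le> t\<close> is \<open>W t - W s\<close>, so the integral \<open>A\<close> of \<open>v W\<close> up to \<open>t\<close> satisfies
  \<open>A = (W t)\<^sup>2 - A\<close>.
\<close>

lemma primitive_on_square:
  assumes v: "integrable M v"
  shows "(primitive_on M v t)\<^sup>2 = primitive_on M (\<lambda>s. 2 * (v s * primitive_on M v s)) t"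
proof -
  let ?W = "primitive_on M v"
  let ?z = "\<lambda>s. indicator {..t} s * v s"
  have z: "integrable M ?z" by (intro truncated_integrable v) simp
  have inner: "v s * (LINT r|M. indicator {s..} r * ?z r) = ?z s * (?W t - ?W s)" for s
  proof (cases "s \<le> t")
    case True
    have "(LINT r|M. indicator {s..} r * ?z r) = (LINT r|M. ?z r - indicator {..s} r * v r)"
    proof (rule integral_cong_AE)
      have "AE r in M. r \<noteq> s"
        unfolding M_def by (subst AE_restrict_space_iff) (auto intro!: AE_completion eventually_mono[OF AE_lborel_singleton])
      then show "AE r in M. indicator {s..} r * ?z r = ?z r - indicator {..s} r * v r"
        by eventually_elim (use True in \<open>auto simp: indicator_def\<close>)
    qed (use borel_measurable_integrable[OF v] indicator_measurable_M in auto)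
    also have "\<dots> = ?W t - ?W s"
      using truncated_integrable[OF v, of "{..s}"] z by (simp add: primitive_on_def)
    finally show ?thesis using True by simp
  next
    case False
    then have "(\<lambda>r. indicator {s..} r * ?z r) = (\<lambda>r. 0)" by (auto simp: indicator_def fun_eq_iff)
    then have "(LINT r|M. indicator {s..} r * ?z r) = 0" by simp
    then show ?thesis using False by simp
  qed
  have zW: "integrable M (\<lambda>s. ?z s * ?W s)" by (rule integrable_mult_primitive[OF v z])
  have "(LINT s|M. ?z s * ?W s) = (LINT s|M. ?z s * (?W t - ?W s))"
    using integral_mult_primitive[OF v z] by (simp only: inner)
  also have "\<dots> = (LINT s|M. ?z s * ?W t) - (LINT s|M. ?z s * ?W s)"
    using z zW by (simp add: right_diff_distrib)
  also have "(LINT s|M. ?z s * ?W t) = (?W t)\<^sup>2"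
    by (simp add: primitive_on_def power2_eq_square)
  finally have "2 * (LINT s|M. ?z s * ?W s) = (?W t)\<^sup>2" by simp
  moreover have "primitive_on M (\<lambda>s. 2 * (v s * ?W s)) t = 2 * (LINT s|M. ?z s * ?W s)"
    by (simp add: primitive_on_cmult) (simp add: primitive_on_def mult.assoc)
  ultimately show ?thesis by simp
qed

lemma integral_deriv_test_function_from:
  assumes \<phi>: "test_function {\<alpha><..<\<beta>} \<phi>" and s: "s \<in> {\<alpha><..<\<beta>}"
  shows "(LINT t|M. indicator {s..} t * deriv \<phi> t) = - \<phi> s"
proof -
  note D = test_function_deriv[OF \<phi>]
  have m: "(\<lambda>t. deriv \<phi> t * indicator {s..\<beta>} t) \<in> borel_measurable lborel"
    using test_function_measurable[OF D(2)] by simp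
  have "(LINT t|M. indicator {s..} t * deriv \<phi> t) = (LINT t|lebesgue. deriv \<phi> t * indicator {s..\<beta>} t)"
    unfolding M_def
    by (subst integral_restrict_space, simp, intro Bochner_Integration.integral_cong refl)
      (use s test_function_eq_0[OF D(2)] in \<open>auto simp: indicator_def\<close>)
  also have "\<dots> = (LINT t|lborel. deriv \<phi> t * indicator {s..\<beta>} t)"
    by (rule integral_completion[OF m])
  also have "\<dots> = \<phi> \<beta> - \<phi> s"
    using s D(1) test_function_continuous[OF D(2), of UNIV]
    by (intro integral_FTC_Icc_real) (auto simp: continuous_on_eq_continuous_at)
  finally show ?thesis using test_function_eq_0[OF \<phi>, of \<beta>] by simp
qed

lemma integral_deriv_mult_primitive:
  assumes \<phi>: "test_function {\<alpha><..<\<beta>} \<phi>" and v: "integrable M v"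
  shows "(LINT t|M. deriv \<phi> t * primitive_on M v t) = - (LINT t|M. \<phi> t * v t)"
proof -
  interpret finite_measure M by (rule finite_measure_M)
  note D = test_function_deriv[OF \<phi>]
  obtain B where "\<And>x. norm (deriv \<phi> x) \<le> B" using test_function_bounded[OF D(2)] by blast
  then have i: "integrable M (deriv \<phi>)"
    using test_function_measurable_lebesgue_on[OF D(2)] unfolding M_def[symmetric]
    by (intro integrable_const_bound[of _ B]) (auto simp: M_def)
  have "(LINT t|M. deriv \<phi> t * primitive_on M v t) = (LINT s|M. v s * (LINT t|M. indicator {s..} t * deriv \<phi> t))"
    by (rule integral_mult_primitive[OF v i])
  also have "\<dots> = (LINT s|M. - (\<phi> s * v s))"
    using integral_deriv_test_function_from[OF \<phi>]
    by (intro Bochner_Integration.integral_cong refl) (simp add: space_M)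
  finally show ?thesis by simp
qed

text \<open>
  The square of \<open>c + W\<close> is again a constant plus a primitive, namely of \<open>2 (c + W) v\<close>.
\<close>

lemma integral_deriv_mult_square:
  assumes \<phi>: "test_function {\<alpha><..<\<beta>} \<phi>" and v: "integrable M v" and u: "u \<in> borel_measurable M"
    and eq: "AE t in M. u t = c + primitive_on M v t"
  shows "(LINT t|M. deriv \<phi> t * (u t)\<^sup>2) = - (LINT t|M. \<phi> t * (2 * (u t * v t)))"
proof -
  interpret finite_measure M by (rule finite_measure_M)
  let ?W = "primitive_on M v"
  note D = test_function_deriv[OF \<phi>]
  have vW: "integrable M (\<lambda>s. 2 * (v s * ?W s))" using integrable_mult_primitive[OF v v] by simp
  have cv: "integrable M (\<lambda>s. 2 * c * v s)" using v by simp
  let ?V = "\<lambda>s. 2 * c * v s + 2 * (v s * ?W s)"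
  have V: "integrable M ?V" using vW cv by simp
  have sq: "(c + ?W t)\<^sup>2 = c\<^sup>2 + primitive_on M ?V t" for t
    by (simp add: primitive_on_add[OF cv vW] primitive_on_cmult[of "2 * c"] primitive_on_square[OF v, symmetric] power2_sum)
  obtain B where "\<And>x. norm (deriv \<phi> x) \<le> B" using test_function_bounded[OF D(2)] by blast
  then have i: "integrable M (deriv \<phi>)"
    using test_function_measurable_lebesgue_on[OF D(2)]
    by (intro integrable_const_bound[of _ B]) (auto simp: M_def)
  have i0: "(LINT t|M. deriv \<phi> t) = 0"
    using integral_frechet_derivative_test_function[OF _ \<phi>, of 1] by (simp add: M_def D(3))
  have m: "u \<in> borel_measurable M" "v \<in> borel_measurable M" "?W \<in> borel_measurable M"
    "deriv \<phi> \<in> borel_measurable M" "\<phi> \<in> borel_measurable M"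
    using u v primitive_on_measurable[OF v] i test_function_measurable_lebesgue_on[OF \<phi>] by (auto simp: M_def)
  have "(LINT t|M. deriv \<phi> t * (u t)\<^sup>2) = (LINT t|M. deriv \<phi> t * (c + ?W t)\<^sup>2)"
    by (rule integral_cong_AE) (use m eq in auto)
  also have "\<dots> = (LINT t|M. c\<^sup>2 * deriv \<phi> t + deriv \<phi> t * primitive_on M ?V t)"
    by (simp add: sq algebra_simps)
  also have "\<dots> = - (LINT t|M. \<phi> t * ?V t)"
    using i i0 integrable_mult_primitive[OF V i] integral_deriv_mult_primitive[OF \<phi> V] by simp
  also have "(LINT t|M. \<phi> t * ?V t) = (LINT t|M. \<phi> t * (2 * (u t * v t)))"
  proof (rule integral_cong_AE)
    show "AE t in M. \<phi> t * ?V t = \<phi> t * (2 * (u t * v t))"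
      using eq by eventually_elim (simp add: algebra_simps)
  qed (use m in auto)
  finally show ?thesis .
qed

text \<open>
  Subtracting the primitive of \<open>v\<close> from \<open>u\<close> leaves a function \<open>g\<close> that is orthogonal to all
  balanced bumps. Hence the ratio of the integral of \<open>g\<close> against a bump to the mass of the bump is the
  same constant for all bumps, and the fundamental lemma shows that \<open>g\<close> is this constant.
\<close>

lemma du_Bois_Reymond:
  assumes \<alpha>\<beta>: "\<alpha> < \<beta>" and u: "integrable M u" and v: "integrable M v"
    and test: "\<And>a b n c d m. {a, b, c, d} \<subseteq> \<rat> \<Longrightarrow> {a, b, c, d} \<subseteq> {\<alpha><..<\<beta>} \<Longrightarrow>
      (LINT t|M. balanced_bump a b n c d m t * u t) = - (LINT t|M. bump_primitive a b n c d m t * v t)"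
  obtains c where "AE t in M. u t = c + primitive_on M v t"
proof -
  interpret finite_measure M by (rule finite_measure_M)
  let ?g = "\<lambda>t. u t - primitive_on M v t"
  have one: "integrable M (\<lambda>t. 1 :: real)" by simp
  have g: "integrable M ?g"
    using u integrable_mult_primitive[OF v one] by simp
  have bm: "bump a b n \<in> borel_measurable M" for a b n
    unfolding M_def by (rule measurable_restrict_space1[OF measurable_completion]) (simp add: bump_measurable)
  have bb: "\<bar>bump a b n t\<bar> \<le> 1" for a b n and t :: real
    using bump_nonneg[of a b n t] bump_le_1[of a b n t] by simp
  have bg: "integrable M (\<lambda>t. bump a b n t * f t)" if "integrable M f" for a b n f
    by (rule integrable_bounded_mult[OF that bm bb])
  have key: "bump_mass c d m * (LINT t|M. bump a b n t * ?g t) = bump_mass a b n * (LINT t|M. bump c d m t * ?g t)"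
    if r: "{a, b, c, d} \<subseteq> \<rat>" and s: "{a, b, c, d} \<subseteq> {\<alpha><..<\<beta>}" for a b n c d m
  proof -
    have \<phi>: "test_function {\<alpha><..<\<beta>} (bump_primitive a b n c d m)" by (rule test_function_bump_primitive[OF s])
    have iu: "integrable M (\<lambda>t. balanced_bump a b n c d m t * f t)" if "integrable M f" for f
      unfolding balanced_bump_def left_diff_distrib mult.assoc using bg[OF that] by simp
    have iW: "integrable M (primitive_on M v)" using integrable_mult_primitive[OF v one] by simp
    have "(LINT t|M. balanced_bump a b n c d m t * primitive_on M v t) = - (LINT t|M. bump_primitive a b n c d m t * v t)"
      using integral_deriv_mult_primitive[OF \<phi> v] by (simp add: deriv_bump_primitive)
    then have "(LINT t|M. balanced_bump a b n c d m t * ?g t) = 0"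
      using test[OF r s, of n m] iu[OF u] iu[OF iW] by (simp add: right_diff_distrib)
    then show ?thesis
      using bg[OF g] by (simp add: balanced_bump_def left_diff_distrib mult.assoc)
  qed
  \<comment> \<open>A reference bump of positive mass inside the interval, which fixes the constant.\<close>
  obtain c0 where c0: "c0 \<in> \<rat>" "\<alpha> < c0" "c0 < \<beta>" using Rats_dense_in_real[OF \<alpha>\<beta>] by blast
  obtain d0 where d0: "d0 \<in> \<rat>" "c0 < d0" "d0 < \<beta>" using Rats_dense_in_real[OF c0(3)] by blast
  have mass: "bump_mass c0 d0 1 > 0" by (rule bump_mass_pos[OF d0(2)])
  define C where "C = (LINT t|M. bump c0 d0 1 t * ?g t) / bump_mass c0 d0 1"
  have massM: "(LINT t|M. bump a b n t) = bump_mass a b n" if "{a..b} \<subseteq> {\<alpha><..<\<beta>}" for a b n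
  proof -
    have "(LINT t|M. bump a b n t) = (LINT t|lebesgue. bump a b n t)"
      unfolding M_def
    proof (subst integral_restrict_space, simp, intro Bochner_Integration.integral_cong refl)
      show "indicator {\<alpha><..<\<beta>} t *\<^sub>R bump a b n t = bump a b n t" for t
      proof (cases "t \<in> {a..b}")
        case True
        then show ?thesis using that by (auto simp: indicator_def)
      next
        case False
        then have "bump a b n t = 0" by (intro bump_zero_outside) auto
        then show ?thesis by simp
      qed
    qed
    then show ?thesis by (simp add: integral_completion bump_measurable bump_mass_def)
  qed
  have "AE t in lebesgue_on {\<alpha><..<\<beta>}. ?g t - C = 0"
  proof (rule AE_zero_if_bump_integrals_zero)
    have gC: "integrable M (\<lambda>t. ?g t - C)" using g by simp
    then show "locally_integrable {\<alpha><..<\<beta>} (\<lambda>t. ?g t - C)"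
      unfolding locally_integrable_def M_def
      using integrable_lebesgue_on_subset[OF gC[unfolded M_def]] by (simp add: compact_imp_closed)
    fix a b :: real and n
    assume ab: "rational_point a" "rational_point b" "cbox a b \<subseteq> {\<alpha><..<\<beta>}"
    have "(LINT t|M. (?g t - C) * bump a b n t) = 0"
    proof (cases "a < b")
      case False
      then have "bump a b n t = 0" for t by (cases "t \<le> a") (auto simp: bump_zero_outside)
      then show ?thesis by simp
    next
      case True
      have "(LINT t|M. bump a b n t * ?g t) = C * bump_mass a b n"
      proof -
        have "{a, b, c0, d0} \<subseteq> \<rat>" using ab(1,2) c0(1) d0(1) by (simp add: rational_point_def)
        moreover have "{a, b} \<subseteq> cbox a b" using True by simp
        then have "{a, b, c0, d0} \<subseteq> {\<alpha><..<\<beta>}" using ab(3) c0 d0 by auto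
        ultimately have "bump_mass c0 d0 1 * (LINT t|M. bump a b n t * ?g t) = bump_mass a b n * (LINT t|M. bump c0 d0 1 t * ?g t)"
          by (rule key)
        then show ?thesis using mass by (simp add: C_def field_simps)
      qed
      moreover have "(\<lambda>t. (?g t - C) * bump a b n t) = (\<lambda>t. bump a b n t * ?g t - C * (bump a b n t * 1))"
        by (simp add: algebra_simps fun_eq_iff)
      moreover have "(LINT t|M. bump a b n t * ?g t - C * (bump a b n t * 1)) = (LINT t|M. bump a b n t * ?g t) - C * bump_mass a b n"
        using bg[OF g, of a b n] bg[OF one, of a b n] massM[of a b n] ab(3) by simp
      ultimately show ?thesis by simp
    qed
    then show "(LINT t|lebesgue_on {\<alpha><..<\<beta>}. (?g t - C) * bump a b n t) = 0" by (simp add: M_def)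
  qed simp
  then have "AE t in M. u t = C + primitive_on M v t"
    unfolding M_def by eventually_elim simp
  then show ?thesis by (rule that)
qed

end

section \<open>The energy of a scalar space-time field\<close>

lemma locally_integrable_imp_integrable_subinterval:
  fixes f :: "real \<Rightarrow> 'b::euclidean_space"
  assumes "locally_integrable {0<..<T} f" "0 < \<alpha>" "\<beta> < T"
  shows "integrable (lebesgue_on {\<alpha><..<\<beta>}) f"
proof -
  have "{\<alpha>..\<beta>} \<subseteq> {0<..<T}" using assms by auto
  then have "integrable (lebesgue_on {\<alpha>..\<beta>}) f" using assms(1) by (simp add: locally_integrable_def)
  then show ?thesis by (rule integrable_lebesgue_on_subset) auto
qed

text \<open>
  Locally \<open>u\<close> is a constant plus a primitive of \<open>v\<close>; only a compact interval around the support
  of \<open>\<phi>\<close> matters, and there \<open>u\<close> and \<open>v\<close> are integrable.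
\<close>

lemma weak_derivative_square:
  assumes T: "0 < T" and u: "locally_integrable {0<..<T} u" and v: "locally_integrable {0<..<T} v"
    and test: "\<And>a b n c d m. {a, b, c, d} \<subseteq> \<rat> \<Longrightarrow> {a, b, c, d} \<subseteq> {0<..<T} \<Longrightarrow>
      (LINT t|lebesgue_on {0<..<T}. deriv (bump_primitive a b n c d m) t * u t)
        = - (LINT t|lebesgue_on {0<..<T}. bump_primitive a b n c d m t * v t)"
    and \<phi>: "test_function {0<..<T} \<phi>"
  shows "(LINT t|lebesgue_on {0<..<T}. deriv \<phi> t * (u t)\<^sup>2) = - (LINT t|lebesgue_on {0<..<T}. \<phi> t * (2 * (u t * v t)))"
proof -
  have K: "compact (closure {t. \<phi> t \<noteq> 0})" "closure {t. \<phi> t \<noteq> 0} \<subseteq> {0<..<T}"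
    using \<phi> by (auto simp: test_function_def)
  obtain \<alpha> \<beta> where ab: "0 < \<alpha>" "\<alpha> < \<beta>" "\<beta> < T" and sub: "closure {t. \<phi> t \<noteq> 0} \<subseteq> {\<alpha><..<\<beta>}"
    by (rule compact_subset_open_interval[OF K T])
  have \<phi>': "test_function {\<alpha><..<\<beta>} \<phi>" using \<phi> sub by (simp add: test_function_def)
  define M where "M = lebesgue_on {\<alpha><..<\<beta>}"
  have iu: "integrable M u" and iv: "integrable M v"
    unfolding M_def by (rule locally_integrable_imp_integrable_subinterval[OF u ab(1,3)],
        rule locally_integrable_imp_integrable_subinterval[OF v ab(1,3)])
  have restr: "(LINT t|lebesgue_on {0<..<T}. \<psi> t * f t) = (LINT t|M. \<psi> t * f t)"
    if "test_function {\<alpha><..<\<beta>} \<psi>" for \<psi> f :: "real \<Rightarrow> real"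
    unfolding M_def
  proof (rule integral_lebesgue_on_subset)
    show "{\<alpha><..<\<beta>} \<subseteq> {0<..<T}" using ab by auto
    show "\<psi> t * f t = 0" if "t \<notin> {\<alpha><..<\<beta>}" for t
      using test_function_eq_0[OF \<open>test_function {\<alpha><..<\<beta>} \<psi>\<close> that] by simp
  qed simp_all
  have balanced: "(LINT t|M. balanced_bump a b n c d m t * u t) = - (LINT t|M. bump_primitive a b n c d m t * v t)"
    if r: "{a, b, c, d} \<subseteq> \<rat>" and s: "{a, b, c, d} \<subseteq> {\<alpha><..<\<beta>}" for a b n c d m
  proof -
    have B: "test_function {\<alpha><..<\<beta>} (bump_primitive a b n c d m)" by (rule test_function_bump_primitive[OF s])
    have "{a, b, c, d} \<subseteq> {0<..<T}" using s ab by auto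
    from test[OF r this, of n m] show ?thesis
      using restr[OF test_function_deriv(2)[OF B], of u] by (simp add: restr[OF B] deriv_bump_primitive)
  qed
  obtain c where "AE t in M. u t = c + primitive_on M v t"
    by (rule du_Bois_Reymond[OF M_def ab(2) iu iv balanced])
  then have "(LINT t|M. deriv \<phi> t * (u t)\<^sup>2) = - (LINT t|M. \<phi> t * (2 * (u t * v t)))"
    by (rule integral_deriv_mult_square[OF M_def \<phi>' iv borel_measurable_integrable[OF iu]])
  then show ?thesis by (simp add: restr[OF \<phi>'] restr[OF test_function_deriv(2)[OF \<phi>']])
qed

lemma countable_rational_bump_parameters:
  "countable {(a, b, n :: nat, c, d, m :: nat). {a, b, c, d} \<subseteq> \<rat> \<and> {a, b, c, d} \<subseteq> {0<..<T :: real}}"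
proof (rule countable_subset)
  show "{(a, b, n :: nat, c, d, m :: nat). {a, b, c, d} \<subseteq> \<rat> \<and> {a, b, c, d} \<subseteq> {0<..<T :: real}}
     \<subseteq> \<rat> \<times> \<rat> \<times> UNIV \<times> \<rat> \<times> \<rat> \<times> UNIV" by auto
  show "countable (\<rat> \<times> \<rat> \<times> (UNIV :: nat set) \<times> \<rat> \<times> \<rat> \<times> (UNIV :: nat set) :: (real \<times> real \<times> nat \<times> real \<times> real \<times> nat) set)"
    by (intro countable_SIGMA countable_rat) auto
qed

text \<open>
  Integrated over space, this bounds the \<open>L\<^sup>1\<close> norm of \<open>u v\<close> by a multiple of \<open>|n| + 1\<close> as soon
  as \<open>u\<close> is bounded in \<open>L\<^sup>2\<close> and \<open>v\<close> has \<open>L\<^sup>2\<close> norm at most \<open>|n|\<close>. It stands in for the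
  Cauchy-Schwarz inequality, and the summand 1 keeps the weight away from zero.
\<close>

lemma weighted_product_bound:
  fixes u v n :: real
  shows "\<bar>u * v\<bar> \<le> (\<bar>n\<bar> + 1) * u\<^sup>2 + v\<^sup>2 / (\<bar>n\<bar> + 1)"
proof -
  let ?m = "\<bar>n\<bar> + 1"
  have m: "?m > 0" by simp
  have "0 \<le> (?m * \<bar>u\<bar> - \<bar>v\<bar>)\<^sup>2" by simp
  then have "2 * (?m * (\<bar>u\<bar> * \<bar>v\<bar>)) \<le> ?m\<^sup>2 * u\<^sup>2 + v\<^sup>2"
    by (simp add: power2_diff power_mult_distrib mult.assoc)
  moreover have "0 \<le> ?m * (\<bar>u\<bar> * \<bar>v\<bar>)" using m by simp
  ultimately have "?m * (\<bar>u\<bar> * \<bar>v\<bar>) \<le> ?m\<^sup>2 * u\<^sup>2 + v\<^sup>2" by linarith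
  also have "\<dots> = ?m * (?m * u\<^sup>2 + v\<^sup>2 / ?m)"
    using m by (simp add: distrib_left power2_eq_square)
  finally show ?thesis using m by (simp add: abs_mult)
qed

text \<open>
  A scalar field \<open>U\<close> that is bounded in \<open>L\<^sup>2\<close> over space, together with a candidate \<open>V\<close> for its time
  derivative whose spatial \<open>L\<^sup>2\<close> norm is bounded by a locally integrable function of time. The
  components of a velocity field and of its gradient are instances with a common \<open>n\<close>.
\<close>

locale space_time_field = finite_measure N
  for N :: "'x measure" +
  fixes T :: real and U V :: "real \<Rightarrow> 'x \<Rightarrow> real" and C :: real and n :: "real \<Rightarrow> real"
  assumes T: "0 < T"
    and mU: "(\<lambda>(t, x). U t x) \<in> borel_measurable (lebesgue_on {0<..<T} \<Otimes>\<^sub>M N)"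
    and mV: "(\<lambda>(t, x). V t x) \<in> borel_measurable (lebesgue_on {0<..<T} \<Otimes>\<^sub>M N)"
    and bU: "AE t in lebesgue_on {0<..<T}. integrable N (\<lambda>x. (U t x)\<^sup>2) \<and> (LINT x|N. (U t x)\<^sup>2) \<le> C"
    and bV: "AE t in lebesgue_on {0<..<T}. integrable N (\<lambda>x. (V t x)\<^sup>2) \<and> (LINT x|N. (V t x)\<^sup>2) \<le> (n t)\<^sup>2"
    and n: "locally_integrable {0<..<T} n"
begin

abbreviation I where "I \<equiv> lebesgue_on {0<..<T}"
abbreviation IN where "IN \<equiv> I \<Otimes>\<^sub>M N"

lemma finite_measure_I: "finite_measure I"
  by (rule finite_measure_lebesgue_on_bounded) auto

sublocale P: pair_sigma_finite I N
proof -
  interpret I: finite_measure I by (rule finite_measure_I)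
  show "pair_sigma_finite I N" by unfold_locales
qed

lemma measurable_mult_time:
  fixes k :: "real \<Rightarrow> real" and F :: "real \<Rightarrow> 'x \<Rightarrow> real"
  assumes "k \<in> borel_measurable I" "(\<lambda>(t, x). F t x) \<in> borel_measurable IN"
  shows "(\<lambda>(t, x). k t * F t x) \<in> borel_measurable IN"
  using borel_measurable_times[OF measurable_compose[OF measurable_fst assms(1)] assms(2)]
  by (simp add: case_prod_beta')

lemma integrable_by_slices:
  fixes F :: "real \<Rightarrow> 'x \<Rightarrow> real" and g :: "real \<Rightarrow> real"
  assumes m: "(\<lambda>(t, x). F t x) \<in> borel_measurable IN"
    and g: "integrable I g"
    and b: "AE t in I. integrable N (F t) \<and> (LINT x|N. \<bar>F t x\<bar>) \<le> g t"
  shows "integrable IN (\<lambda>(t, x). F t x)"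
proof (rule P.Fubini_integrable[OF m])
  show "AE t in I. integrable N (\<lambda>x. case (t, x) of (t, x) \<Rightarrow> F t x)"
    using b by eventually_elim simp
  have "(\<lambda>(t, x). \<bar>F t x\<bar>) \<in> borel_measurable IN"
    using borel_measurable_abs[OF m] by (simp add: case_prod_beta')
  then have "(\<lambda>t. LINT x|N. \<bar>F t x\<bar>) \<in> borel_measurable I"
    by (rule borel_measurable_lebesgue_integral)
  then have "integrable I (\<lambda>t. LINT x|N. \<bar>F t x\<bar>)"
    by (rule Bochner_Integration.integrable_bound[OF g]) (use b in eventually_elim, simp add: order_trans[OF _ abs_ge_self])
  then show "integrable I (\<lambda>t. LINT x|N. norm (case (t, x) of (t, x) \<Rightarrow> F t x))" by simp
qed

lemma slices_measurable:
  fixes F :: "real \<Rightarrow> 'x \<Rightarrow> real"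
  assumes "(\<lambda>(t, x). F t x) \<in> borel_measurable IN" "t \<in> {0<..<T}"
  shows "F t \<in> borel_measurable N"
  using measurable_Pair2[OF assms(1), of t] assms(2) by simp

text \<open>
  A bounded weight with compact support in time makes everything integrable in space and time, because
  \<open>U\<close> is bounded in \<open>L\<^sup>2\<close> and the \<open>L\<^sup>2\<close> norm of \<open>V\<close> is locally integrable in time.
\<close>

lemma integrable_time_weight:
  assumes K: "compact K" "K \<subseteq> {0<..<T}" and k: "k \<in> borel_measurable I"
    and kB: "\<And>t. \<bar>k t\<bar> \<le> B" and k0: "\<And>t. t \<notin> K \<Longrightarrow> k t = 0"
  shows "integrable IN (\<lambda>(t, x). k t * U t x)"
    and "integrable IN (\<lambda>(t, x). k t * V t x)"
    and "integrable IN (\<lambda>(t, x). k t * (U t x)\<^sup>2)"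
    and "integrable IN (\<lambda>(t, x). k t * (U t x * V t x))"
proof -
  let ?m = "measure N (space N)"
  have mU2: "(\<lambda>(t, x). (U t x)\<^sup>2) \<in> borel_measurable IN"
    using borel_measurable_power[OF mU, of 2] by (simp add: case_prod_beta')
  have mUV: "(\<lambda>(t, x). U t x * V t x) \<in> borel_measurable IN"
    using borel_measurable_times[OF mU mV] by (simp add: case_prod_beta')
  have nK: "integrable I (\<lambda>t. \<bar>k t\<bar> * (\<bar>n t\<bar> + 1))"
  proof -
    have "locally_integrable {0<..<T} (\<lambda>t. \<bar>n t\<bar> + 1)"
      unfolding locally_integrable_def
    proof (intro allI impI)
      fix L :: "real set" assume L: "compact L \<and> L \<subseteq> {0<..<T}"
      then have "integrable (lebesgue_on L) n" "integrable (lebesgue_on L) (\<lambda>t. 1 :: real)"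
        using n continuous_integrable_lebesgue_on_compact[of L "\<lambda>t. 1 :: real"] by (simp_all add: locally_integrable_def)
      then show "integrable (lebesgue_on L) (\<lambda>t. \<bar>n t\<bar> + 1)" by simp
    qed
    then have "integrable I (\<lambda>t. (\<bar>n t\<bar> + 1) * \<bar>k t\<bar>)"
      using K k kB k0 by (intro integrable_mult_compact_support[where K=K and B=B]) simp_all
    then show ?thesis by (simp add: mult.commute)
  qed
  have slice: "AE t in I. t \<in> {0<..<T}"
    by (rule AE_I2) simp
  show "integrable IN (\<lambda>(t, x). k t * (U t x)\<^sup>2)"
  proof (rule integrable_by_slices[OF measurable_mult_time[OF k mU2]])
    show "integrable I (\<lambda>t. \<bar>k t\<bar> * (\<bar>n t\<bar> + 1) * C)" using nK by simp
    show "AE t in I. integrable N (\<lambda>x. k t * (U t x)\<^sup>2) \<and> (LINT x|N. \<bar>k t * (U t x)\<^sup>2\<bar>) \<le> \<bar>k t\<bar> * (\<bar>n t\<bar> + 1) * C"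
      using bU
    proof eventually_elim
      case (elim t)
      have "0 \<le> (LINT x|N. (U t x)\<^sup>2)" by (intro integral_nonneg_AE AE_I2) simp
      then have C: "0 \<le> C" using elim by linarith
      have "\<bar>k t\<bar> * (LINT x|N. (U t x)\<^sup>2) \<le> \<bar>k t\<bar> * ((\<bar>n t\<bar> + 1) * C)"
        using elim C mult_right_mono[of 1 "\<bar>n t\<bar> + 1" C] by (intro mult_left_mono) simp_all
      then show ?case using elim by (simp add: abs_mult mult.assoc)
    qed
  qed
  have lin: "\<bar>f\<bar> \<le> (\<bar>r\<bar> + 1) + f\<^sup>2 / (\<bar>r\<bar> + 1)" for f r :: real
    using weighted_product_bound[of 1 f r] by simp
  have prod: "integrable IN (\<lambda>(t, x). k t * (F t x * V t x))"
    if mF: "(\<lambda>(t, x). F t x) \<in> borel_measurable IN"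
      and bF: "AE t in I. integrable N (\<lambda>x. (F t x)\<^sup>2) \<and> (LINT x|N. (F t x)\<^sup>2) \<le> D"
    for F :: "real \<Rightarrow> 'x \<Rightarrow> real" and D
  proof (rule integrable_by_slices[OF measurable_mult_time[OF k]])
    show mFV: "(\<lambda>(t, x). F t x * V t x) \<in> borel_measurable IN"
      using borel_measurable_times[OF mF mV] by (simp add: case_prod_beta')
    show "integrable I (\<lambda>t. \<bar>k t\<bar> * (\<bar>n t\<bar> + 1) * (D + 1))" using nK by simp
    show "AE t in I. integrable N (\<lambda>x. k t * (F t x * V t x)) \<and> (LINT x|N. \<bar>k t * (F t x * V t x)\<bar>) \<le> \<bar>k t\<bar> * (\<bar>n t\<bar> + 1) * (D + 1)"
      using bF bV slice
    proof eventually_elim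
      case (elim t)
      let ?r = "\<bar>n t\<bar> + 1"
      let ?b = "\<lambda>x. ?r * (F t x)\<^sup>2 + (V t x)\<^sup>2 / ?r"
      have ib: "integrable N ?b" using elim by simp
      have i: "integrable N (\<lambda>x. F t x * V t x)"
      proof (rule Bochner_Integration.integrable_bound[OF ib])
        show "(\<lambda>x. F t x * V t x) \<in> borel_measurable N"
          using slices_measurable[OF mFV] elim(3) by simp
        show "AE x in N. norm (F t x * V t x) \<le> norm (?b x)"
          using weighted_product_bound by (intro AE_I2) (simp add: order_trans[OF _ abs_ge_self])
      qed
      have "(LINT x|N. \<bar>F t x * V t x\<bar>) \<le> integral\<^sup>L N ?b"
        using i ib weighted_product_bound by (intro integral_mono) simp_all
      also have "\<dots> = ?r * (LINT x|N. (F t x)\<^sup>2) + (LINT x|N. (V t x)\<^sup>2) / ?r"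
        using elim by simp
      also have "\<dots> \<le> ?r * D + ?r"
      proof (intro add_mono mult_left_mono)
        have "(LINT x|N. (V t x)\<^sup>2) / ?r \<le> (n t)\<^sup>2 / ?r" using elim by (intro divide_right_mono) simp_all
        also have "\<dots> \<le> ?r\<^sup>2 / ?r" by (intro divide_right_mono) (simp_all add: abs_le_square_iff[symmetric])
        also have "\<dots> = ?r" by (simp add: power2_eq_square)
        finally show "(LINT x|N. (V t x)\<^sup>2) / ?r \<le> ?r" .
      qed (use elim in simp_all)
      finally have "\<bar>k t\<bar> * (LINT x|N. \<bar>F t x * V t x\<bar>) \<le> \<bar>k t\<bar> * (?r * D + ?r)"
        by (intro mult_left_mono) simp_all
      then show ?case using i by (simp add: abs_mult[of "k t"] algebra_simps)
    qed
  qed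
  show "integrable IN (\<lambda>(t, x). k t * (U t x * V t x))" by (rule prod[OF mU bU])
  have "(\<lambda>(t, x). 1 :: real) \<in> borel_measurable IN" by simp
  from prod[OF this, of ?m] show "integrable IN (\<lambda>(t, x). k t * V t x)" by simp
  show "integrable IN (\<lambda>(t, x). k t * U t x)"
  proof (rule integrable_by_slices[OF measurable_mult_time[OF k mU]])
    show "integrable I (\<lambda>t. \<bar>k t\<bar> * (\<bar>n t\<bar> + 1) * (?m + C))" using nK by simp
    show "AE t in I. integrable N (\<lambda>x. k t * U t x) \<and> (LINT x|N. \<bar>k t * U t x\<bar>) \<le> \<bar>k t\<bar> * (\<bar>n t\<bar> + 1) * (?m + C)"
      using bU slice
    proof eventually_elim
      case (elim t)
      have "0 \<le> (LINT x|N. (U t x)\<^sup>2)" by (intro integral_nonneg_AE AE_I2) simp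
      then have C: "0 \<le> ?m + C" using elim measure_nonneg[of N "space N"] by linarith
      have ib: "integrable N (\<lambda>x. 1 + (U t x)\<^sup>2)" using elim by simp
      have le: "\<bar>U t x\<bar> \<le> 1 + (U t x)\<^sup>2" for x using lin[of "U t x" 0] by simp
      have i: "integrable N (U t)"
      proof (rule Bochner_Integration.integrable_bound[OF ib slices_measurable[OF mU elim(2)]])
        show "AE x in N. norm (U t x) \<le> norm (1 + (U t x)\<^sup>2)" using le by (intro AE_I2) simp
      qed
      have "(LINT x|N. \<bar>U t x\<bar>) \<le> (LINT x|N. 1 + (U t x)\<^sup>2)"
        using i ib le by (intro integral_mono) simp_all
      also have "\<dots> \<le> ?m + C" using elim by simp
      also have "\<dots> \<le> (\<bar>n t\<bar> + 1) * (?m + C)" using C mult_right_mono[of 1 "\<bar>n t\<bar> + 1"] by simp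
      finally have "\<bar>k t\<bar> * (LINT x|N. \<bar>U t x\<bar>) \<le> \<bar>k t\<bar> * ((\<bar>n t\<bar> + 1) * (?m + C))"
        by (intro mult_left_mono) simp_all
      then show ?case using i by (simp add: abs_mult mult.assoc)
    qed
  qed
qed


lemma integrable_test_weight:
  assumes k: "test_function {0<..<T} k"
  shows "integrable IN (\<lambda>(t, x). k t * U t x)" (is ?A)
    and "integrable IN (\<lambda>(t, x). k t * V t x)" (is ?B)
    and "integrable IN (\<lambda>(t, x). k t * (U t x)\<^sup>2)" (is ?C)
    and "integrable IN (\<lambda>(t, x). k t * (U t x * V t x))" (is ?D)
proof -
  have K: "compact (closure {t. k t \<noteq> 0})" "closure {t. k t \<noteq> 0} \<subseteq> {0<..<T}"
    using k by (auto simp: test_function_def)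
  have k0: "k t = 0" if "t \<notin> closure {t. k t \<noteq> 0}" for t
    using that closure_subset[of "{t. k t \<noteq> 0}"] by auto
  obtain B where B: "\<And>t. \<bar>k t\<bar> \<le> B" using test_function_bounded[OF k] by (metis real_norm_def)
  note * = integrable_time_weight[OF K test_function_measurable_lebesgue_on[OF k] B k0]
  show ?A by (rule *(1))
  show ?B by (rule *(2))
  show ?C by (rule *(3))
  show ?D by (rule *(4))
qed

lemma integrable_compact_weight:
  assumes K: "compact K" "K \<subseteq> {0<..<T}"
  shows "integrable IN (\<lambda>(t, x). indicator K t * U t x)" (is ?A)
    and "integrable IN (\<lambda>(t, x). indicator K t * V t x)" (is ?B)
    and "integrable IN (\<lambda>(t, x). indicator K t * (U t x)\<^sup>2)" (is ?C)
    and "integrable IN (\<lambda>(t, x). indicator K t * (U t x * V t x))" (is ?D)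
proof -
  have m: "(\<lambda>t. indicator K t :: real) \<in> borel_measurable I"
    by (rule measurable_restrict_space1, rule borel_measurable_indicator) (simp add: K compact_imp_closed)
  have b: "\<bar>indicator K t :: real\<bar> \<le> 1" and o: "t \<notin> K \<Longrightarrow> indicator K t = (0 :: real)" for t
    by (simp_all add: indicator_def)
  note * = integrable_time_weight[OF K m b o]
  show ?A by (rule *(1))
  show ?B by (rule *(2))
  show ?C by (rule *(3))
  show ?D by (rule *(4))
qed

lemma locally_integrable_time:
  fixes f :: "real \<Rightarrow> real"
  assumes "\<And>K. compact K \<Longrightarrow> K \<subseteq> {0<..<T} \<Longrightarrow> integrable I (\<lambda>t. indicator K t * f t)"
  shows "locally_integrable {0<..<T} f"
  unfolding locally_integrable_def
proof (intro allI impI)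
  fix K assume "compact K \<and> K \<subseteq> {0<..<T}"
  then have K: "compact K" "K \<subseteq> {0<..<T}" by auto
  have "integrable (lebesgue_on K) (\<lambda>t. indicator K t * f t)"
    by (rule integrable_lebesgue_on_subset[OF assms[OF K] K(2)]) (simp_all add: K compact_imp_closed)
  then show "integrable (lebesgue_on K) f"
    by (subst Bochner_Integration.integrable_cong[of "lebesgue_on K" "lebesgue_on K" f "\<lambda>t. indicator K t * f t"]) simp_all
qed

text \<open>
  Every compact subset of the time interval lies in one of countably many compact intervals, so
  one null set of \<open>x\<close> suffices.
\<close>

lemma AE_locally_integrable_time:
  "AE x in N. locally_integrable {0<..<T} (\<lambda>t. U t x) \<and> locally_integrable {0<..<T} (\<lambda>t. V t x)"
proof -
  \<comment> \<open>For small \<open>m\<close> these intervals may be empty.\<close>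
  define K where "K m = {inverse (real (Suc m)) .. T - inverse (real (Suc m))}" for m
  have K: "compact (K m)" "K m \<subseteq> {0<..<T}" for m
  proof -
    show "compact (K m)" unfolding K_def by (rule compact_Icc)
    define r where "r = inverse (real (Suc m))"
    have "0 < r" by (simp add: r_def)
    moreover have "K m = {r..T - r}" by (simp add: K_def r_def)
    ultimately show "K m \<subseteq> {0<..<T}" by auto
  qed
  have "AE x in N. \<forall>m. integrable I (\<lambda>t. indicator (K m) t * U t x) \<and> integrable I (\<lambda>t. indicator (K m) t * V t x)"
  proof (subst AE_all_countable, rule allI)
    fix m
    show "AE x in N. integrable I (\<lambda>t. indicator (K m) t * U t x) \<and> integrable I (\<lambda>t. indicator (K m) t * V t x)"
      using P.AE_integrable_snd[OF integrable_compact_weight(1)[OF K, of m]]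
        P.AE_integrable_snd[OF integrable_compact_weight(2)[OF K, of m]]
      by eventually_elim simp
  qed
  then show ?thesis
  proof eventually_elim
    case (elim x)
    have LL: "integrable I (\<lambda>t. indicator L t * U t x) \<and> integrable I (\<lambda>t. indicator L t * V t x)"
      if L: "compact L" "L \<subseteq> {0<..<T}" for L
    proof -
      obtain \<alpha> \<beta> where ab: "0 < \<alpha>" "\<alpha> < \<beta>" "\<beta> < T" "L \<subseteq> {\<alpha><..<\<beta>}"
        by (rule compact_subset_open_interval[OF L T])
      obtain m where m: "inverse (real (Suc m)) < min \<alpha> (T - \<beta>)"
        using reals_Archimedean[of "min \<alpha> (T - \<beta>)"] ab by auto
      have LK: "L \<subseteq> K m" using ab m unfolding K_def by fastforce
      have mL: "(\<lambda>t. indicator L t :: real) \<in> borel_measurable I"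
        by (rule measurable_restrict_space1, rule borel_measurable_indicator) (simp add: L compact_imp_closed)
      have *: "integrable I (\<lambda>t. indicator L t * f t)" if "integrable I (\<lambda>t. indicator (K m) t * f t)" for f :: "real \<Rightarrow> real"
      proof -
        have "integrable I (\<lambda>t. indicator L t * (indicator (K m) t * f t))"
          by (rule integrable_bounded_mult[OF that mL, of 1]) (simp add: indicator_def)
        moreover have "(\<lambda>t. indicator L t * (indicator (K m) t * f t)) = (\<lambda>t. indicator L t * f t)"
          using LK by (auto simp: indicator_def fun_eq_iff)
        ultimately show ?thesis by simp
      qed
      have e: "integrable I (\<lambda>t. indicator (K m) t * U t x) \<and> integrable I (\<lambda>t. indicator (K m) t * V t x)"
        using elim by (rule spec)
      show ?thesis by (rule conjI[OF *[OF conjunct1[OF e]] *[OF conjunct2[OF e]]])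
    qed
    show ?case
    proof
      show "locally_integrable {0<..<T} (\<lambda>t. U t x)" by (rule locally_integrable_time) (rule conjunct1[OF LL])
      show "locally_integrable {0<..<T} (\<lambda>t. V t x)" by (rule locally_integrable_time) (rule conjunct2[OF LL])
    qed
  qed
qed

lemma AE_integrable_product: "AE t in I. integrable N (\<lambda>x. U t x * V t x)"
proof -
  have "AE t in I. t \<in> {0<..<T}" by (rule AE_I2) simp
  with bU bV show ?thesis
  proof eventually_elim
    case (elim t)
    have m: "U t \<in> borel_measurable N" "V t \<in> borel_measurable N"
      using slices_measurable[OF mU elim(3)] slices_measurable[OF mV elim(3)] by simp_all
    have "integrable N (\<lambda>x. (U t x)\<^sup>2 + (V t x)\<^sup>2)" using elim by simp
    then show ?case
    proof (rule Bochner_Integration.integrable_bound)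
      show "(\<lambda>x. U t x * V t x) \<in> borel_measurable N" using m by (rule borel_measurable_times)
      show "AE x in N. norm (U t x * V t x) \<le> norm ((U t x)\<^sup>2 + (V t x)\<^sup>2)"
        using weighted_product_bound[of "U t x" "V t x" 0 for x] by (intro AE_I2) simp
    qed
  qed
qed

text \<open>
  The hypothesis has a null set of \<open>x\<close> for every test function. Used for the countably many
  primitives of balanced bumps, it holds for almost every \<open>x\<close> simultaneously, which gives the product
  rule at almost every \<open>x\<close>; Fubini's theorem then moves the integral over \<open>x\<close> inside.
\<close>

lemma energy_weak_derivative:
  assumes wd: "\<And>\<phi>. test_function {0<..<T} \<phi> \<Longrightarrow>
    AE x in N. (LINT t|I. deriv \<phi> t * U t x) = - (LINT t|I. \<phi> t * V t x)"
  shows "weak_derivative T (\<lambda>t. LINT x|N. (U t x)\<^sup>2) (\<lambda>t. 2 * (LINT x|N. U t x * V t x))"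
  unfolding weak_derivative_def
proof (intro conjI allI impI)
  show "locally_integrable {0<..<T} (\<lambda>t. LINT x|N. (U t x)\<^sup>2)"
  proof (rule locally_integrable_time)
    fix K :: "real set" assume "compact K" "K \<subseteq> {0<..<T}"
    from P.integrable_fst[OF integrable_compact_weight(3)[OF this]]
    show "integrable I (\<lambda>t. indicator K t * (LINT x|N. (U t x)\<^sup>2))" by simp
  qed
  show "locally_integrable {0<..<T} (\<lambda>t. 2 * (LINT x|N. U t x * V t x))"
  proof (rule locally_integrable_time)
    fix K :: "real set" assume "compact K" "K \<subseteq> {0<..<T}"
    from P.integrable_fst[OF integrable_compact_weight(4)[OF this]]
    have "integrable I (\<lambda>t. 2 * (indicator K t * (LINT x|N. U t x * V t x)))" by simp
    then show "integrable I (\<lambda>t. indicator K t * (2 * (LINT x|N. U t x * V t x)))" by (simp add: mult.left_commute)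
  qed
  fix \<phi> :: "real \<Rightarrow> real" assume \<phi>: "test_function {0<..<T} \<phi>"
  note D = test_function_deriv(2)[OF \<phi>]
  let ?A = "{(a :: real, b :: real, n :: nat, c :: real, d :: real, m :: nat). {a, b, c, d} \<subseteq> \<rat> \<and> {a, b, c, d} \<subseteq> {0<..<T}}"
  have "AE x in N. \<forall>(a, b, n, c, d, m)\<in>?A. (LINT t|I. deriv (bump_primitive a b n c d m) t * U t x)
      = - (LINT t|I. bump_primitive a b n c d m t * V t x)"
  proof (subst AE_ball_countable[OF countable_rational_bump_parameters], rule ballI)
    fix p assume p: "p \<in> ?A"
    obtain a b n c d m where eq: "p = (a, b, n, c, d, m)" by (rule prod_cases6)
    have "{a, b, c, d} \<subseteq> {0<..<T}" using p by (simp add: eq)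
    from wd[OF test_function_bump_primitive[OF this, of n m]]
    show "AE x in N. case p of (a, b, n, c, d, m) \<Rightarrow> (LINT t|I. deriv (bump_primitive a b n c d m) t * U t x)
      = - (LINT t|I. bump_primitive a b n c d m t * V t x)" by (simp add: eq)
  qed
  with AE_locally_integrable_time
  have sq: "AE x in N. (LINT t|I. deriv \<phi> t * (U t x)\<^sup>2) = - (LINT t|I. \<phi> t * (2 * (U t x * V t x)))"
  proof eventually_elim
    case (elim x)
    show ?case
    proof (rule weak_derivative_square[OF T _ _ _ \<phi>])
      show "locally_integrable {0<..<T} (\<lambda>t. U t x)" "locally_integrable {0<..<T} (\<lambda>t. V t x)" using elim(1) by auto
      fix a b c d :: real and n m :: nat
      assume "{a, b, c, d} \<subseteq> \<rat>" "{a, b, c, d} \<subseteq> {0<..<T}"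
      then have "(a, b, n, c, d, m) \<in> ?A" by simp
      from bspec[OF elim(2) this]
      show "(LINT t|I. deriv (bump_primitive a b n c d m) t * U t x) = - (LINT t|I. bump_primitive a b n c d m t * V t x)"
        by simp
    qed
  qed
  note i1 = integrable_test_weight(3)[OF D] and i2 = integrable_test_weight(4)[OF \<phi>]
  have "(LINT t|I. (LINT x|N. (U t x)\<^sup>2) * deriv \<phi> t) = (LINT t|I. LINT x|N. deriv \<phi> t * (U t x)\<^sup>2)"
    by (simp add: mult.commute)
  also have "\<dots> = (LINT x|N. LINT t|I. deriv \<phi> t * (U t x)\<^sup>2)"
    by (rule P.Fubini_integral[OF i1, symmetric])
  also have "\<dots> = (LINT x|N. - (LINT t|I. \<phi> t * (2 * (U t x * V t x))))"
  proof (rule integral_cong_AE[OF _ _ sq])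
    show "(\<lambda>x. LINT t|I. deriv \<phi> t * (U t x)\<^sup>2) \<in> borel_measurable N"
      by (rule borel_measurable_integrable[OF P.integrable_snd[OF i1]])
    have "(\<lambda>x. - (2 * (LINT t|I. \<phi> t * (U t x * V t x)))) \<in> borel_measurable N"
      using borel_measurable_integrable[OF P.integrable_snd[OF i2]] by simp
    then show "(\<lambda>x. - (LINT t|I. \<phi> t * (2 * (U t x * V t x)))) \<in> borel_measurable N"
      by (simp add: mult.left_commute[of _ 2])
  qed
  also have "\<dots> = - 2 * (LINT x|N. LINT t|I. \<phi> t * (U t x * V t x))"
    by (simp add: mult.left_commute[of _ 2])
  also have "(LINT x|N. LINT t|I. \<phi> t * (U t x * V t x)) = (LINT t|I. LINT x|N. \<phi> t * (U t x * V t x))"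
    by (rule P.Fubini_integral[OF i2])
  also have "\<dots> = (LINT t|I. \<phi> t * (LINT x|N. U t x * V t x))" by simp
  also have "- 2 * \<dots> = - (LINT t|I. 2 * (\<phi> t * (LINT x|N. U t x * V t x)))" by simp
  also have "\<dots> = - (LINT t|I. 2 * (LINT x|N. U t x * V t x) * \<phi> t)"
    by (simp only: mult.assoc mult.commute[of "\<phi> _"])
  finally show "(LINT t|I. (LINT x|N. (U t x)\<^sup>2) * deriv \<phi> t) = - (LINT t|I. 2 * (LINT x|N. U t x * V t x) * \<phi> t)" .
qed

end

lemma (in pair_sigma_finite) weighted_Fubini:
  fixes k \<psi> :: "_ \<Rightarrow> real"
  assumes i: "integrable (M1 \<Otimes>\<^sub>M M2) (\<lambda>(t, x). k t * F t x)"
    and \<psi>: "\<psi> \<in> borel_measurable M2" and B: "\<And>x. \<bar>\<psi> x\<bar> \<le> B"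
  shows "(LINT x|M2. \<psi> x * (LINT t|M1. k t * F t x)) = (LINT t|M1. k t * (LINT x|M2. F t x * \<psi> x))"
proof -
  have "integrable (M1 \<Otimes>\<^sub>M M2) (\<lambda>p. \<psi> (snd p) * (case p of (t, x) \<Rightarrow> k t * F t x))"
    by (rule integrable_bounded_mult[OF i measurable_compose[OF measurable_snd \<psi>] B])
  then have i': "integrable (M1 \<Otimes>\<^sub>M M2) (\<lambda>(t, x). \<psi> x * (k t * F t x))" by (simp add: case_prod_beta')
  have "(LINT x|M2. \<psi> x * (LINT t|M1. k t * F t x)) = (LINT x|M2. LINT t|M1. \<psi> x * (k t * F t x))" by simp
  also have "\<dots> = (LINT t|M1. LINT x|M2. \<psi> x * (k t * F t x))" by (rule Fubini_integral[OF i'])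
  also have "\<dots> = (LINT t|M1. k t * (LINT x|M2. F t x * \<psi> x))"
    by (simp add: mult.left_commute[of _ "k _"] mult.commute[of "\<psi> _"])
  finally show ?thesis .
qed

section \<open>The energy balance\<close>

text \<open>
  Here \<open>G\<close> and \<open>H\<close> are the derivatives of \<open>U\<close> and \<open>V\<close> in the direction \<open>e\<close>. The difference of
  the two sides is a function of \<open>x\<close>; against a bump, Fubini's theorem and the weak gradient move the
  derivative from \<open>G\<close> and \<open>H\<close> to the bump, where the hypothesis for \<open>U\<close> and \<open>V\<close> applies.
\<close>

lemma gradient_time_derivative:
  fixes \<Omega> :: "(real^'n) set" and U V G H :: "real \<Rightarrow> real^'n \<Rightarrow> real"
  assumes \<Omega>: "open \<Omega>"
    and UV: "space_time_field (lebesgue_on \<Omega>) T U V C n"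
    and GH: "space_time_field (lebesgue_on \<Omega>) T G H C' n'"
    and UG: "AE t in lebesgue_on {0<..<T}. \<forall>\<psi>. test_function \<Omega> \<psi> \<longrightarrow>
      (LINT x|lebesgue_on \<Omega>. U t x * frechet_derivative \<psi> (at x) e) = - (LINT x|lebesgue_on \<Omega>. G t x * \<psi> x)"
    and VH: "AE t in lebesgue_on {0<..<T}. \<forall>\<psi>. test_function \<Omega> \<psi> \<longrightarrow>
      (LINT x|lebesgue_on \<Omega>. V t x * frechet_derivative \<psi> (at x) e) = - (LINT x|lebesgue_on \<Omega>. H t x * \<psi> x)"
    and \<phi>: "test_function {0<..<T} \<phi>"
    and wd: "AE x in lebesgue_on \<Omega>. (LINT t|lebesgue_on {0<..<T}. deriv \<phi> t * U t x) = - (LINT t|lebesgue_on {0<..<T}. \<phi> t * V t x)"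
  shows "AE x in lebesgue_on \<Omega>. (LINT t|lebesgue_on {0<..<T}. deriv \<phi> t * G t x) = - (LINT t|lebesgue_on {0<..<T}. \<phi> t * H t x)"
proof -
  let ?I = "lebesgue_on {0<..<T}" and ?N = "lebesgue_on \<Omega>"
  interpret A: space_time_field ?N T U V C n by (rule UV)
  interpret B: space_time_field ?N T G H C' n' by (rule GH)
  have \<Omega>s: "\<Omega> \<in> sets lebesgue" using \<Omega> by auto
  note D = test_function_deriv(2)[OF \<phi>]
  let ?F = "\<lambda>x. (LINT t|?I. deriv \<phi> t * G t x) + (LINT t|?I. \<phi> t * H t x)"
  have iG: "integrable ?N (\<lambda>x. LINT t|?I. deriv \<phi> t * G t x)"
    by (rule A.P.integrable_snd[OF B.integrable_test_weight(1)[OF D]])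
  have iH: "integrable ?N (\<lambda>x. LINT t|?I. \<phi> t * H t x)"
    by (rule A.P.integrable_snd[OF B.integrable_test_weight(2)[OF \<phi>]])
  have iU: "integrable ?N (\<lambda>x. LINT t|?I. deriv \<phi> t * U t x)"
    by (rule A.P.integrable_snd[OF A.integrable_test_weight(1)[OF D]])
  have iV: "integrable ?N (\<lambda>x. LINT t|?I. \<phi> t * V t x)"
    by (rule A.P.integrable_snd[OF A.integrable_test_weight(2)[OF \<phi>]])
  have "AE x in ?N. ?F x = 0"
  proof (rule AE_zero_if_bump_integrals_zero[OF \<Omega>])
    have iF: "integrable ?N ?F" using iG iH by simp
    show "locally_integrable \<Omega> ?F"
      unfolding locally_integrable_def
      using integrable_lebesgue_on_subset[OF iF _ _ \<Omega>s] by (simp add: compact_imp_closed)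
    fix a b :: "real^'n" and m
    assume "cbox a b \<subseteq> \<Omega>"
    then have \<psi>: "test_function \<Omega> (bump a b m)" by (rule test_function_bump)
    define \<psi> where "\<psi> = bump a b m"
    let ?d = "\<lambda>x. frechet_derivative \<psi> (at x) e"
    have \<psi>: "test_function \<Omega> \<psi>" using \<psi> by (simp add: \<psi>_def)
    have d: "test_function \<Omega> ?d" by (rule test_function_frechet_derivative[OF \<psi>])
    obtain B where B: "\<And>x. \<bar>\<psi> x\<bar> \<le> B" using test_function_bounded[OF \<psi>] by (metis real_norm_def)
    obtain B' where B': "\<And>x. \<bar>?d x\<bar> \<le> B'" using test_function_bounded[OF d] by (metis real_norm_def)
    note m\<psi> = test_function_measurable_lebesgue_on[OF \<psi>, of \<Omega>] and md = test_function_measurable_lebesgue_on[OF d, of \<Omega>]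
    have parts: "(LINT x|?N. \<psi> x * (LINT t|?I. k t * P t x)) = - (LINT x|?N. ?d x * (LINT t|?I. k t * R t x))"
      if i: "integrable (?I \<Otimes>\<^sub>M ?N) (\<lambda>(t, x). k t * P t x)" "integrable (?I \<Otimes>\<^sub>M ?N) (\<lambda>(t, x). k t * R t x)"
        and g: "AE t in ?I. \<forall>\<psi>. test_function \<Omega> \<psi> \<longrightarrow>
          (LINT x|?N. R t x * frechet_derivative \<psi> (at x) e) = - (LINT x|?N. P t x * \<psi> x)"
      for k :: "real \<Rightarrow> real" and P R :: "real \<Rightarrow> real^'n \<Rightarrow> real"
    proof -
      have "integrable (?I \<Otimes>\<^sub>M ?N) (\<lambda>p. \<psi> (snd p) * (case p of (t, x) \<Rightarrow> k t * P t x))"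
        by (rule integrable_bounded_mult[OF i(1) measurable_compose[OF measurable_snd m\<psi>] B])
      then have "integrable (?I \<Otimes>\<^sub>M ?N) (\<lambda>(t, x). k t * (P t x * \<psi> x))" by (simp add: case_prod_beta' ac_simps)
      from borel_measurable_integrable[OF A.P.integrable_fst[OF this]]
      have m1: "(\<lambda>t. k t * (LINT x|?N. P t x * \<psi> x)) \<in> borel_measurable ?I" by simp
      have "(LINT x|?N. ?d x * (LINT t|?I. k t * R t x)) = (LINT t|?I. k t * (LINT x|?N. R t x * ?d x))"
        by (rule A.P.weighted_Fubini[OF i(2) md B'])
      also have "\<dots> = (LINT t|?I. - (k t * (LINT x|?N. P t x * \<psi> x)))"
      proof (rule integral_lebesgue_on_cong_AE[symmetric])
        show "AE t in ?I. - (k t * (LINT x|?N. P t x * \<psi> x)) = k t * (LINT x|?N. R t x * ?d x)"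
          using g
        proof eventually_elim
          case (elim t)
          from mp[OF spec[OF elim, of \<psi>] \<psi>] show ?case by simp
        qed
      qed (use m1 in simp_all)
      also have "\<dots> = - (LINT x|?N. \<psi> x * (LINT t|?I. k t * P t x))"
        by (simp add: A.P.weighted_Fubini[OF i(1) m\<psi> B])
      finally show ?thesis by simp
    qed
    have "(LINT x|?N. ?d x * (LINT t|?I. deriv \<phi> t * U t x)) = (LINT x|?N. ?d x * (- (LINT t|?I. \<phi> t * V t x)))"
    proof (rule integral_cong_AE)
      show "AE x in ?N. ?d x * (LINT t|?I. deriv \<phi> t * U t x) = ?d x * (- (LINT t|?I. \<phi> t * V t x))"
        using wd by eventually_elim simp
    qed (use md iU iV in simp_all)
    also have "\<dots> = - (LINT x|?N. ?d x * (LINT t|?I. \<phi> t * V t x))" by simp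
    finally have "(LINT x|?N. \<psi> x * (LINT t|?I. deriv \<phi> t * G t x)) + (LINT x|?N. \<psi> x * (LINT t|?I. \<phi> t * H t x)) = 0"
      using parts[OF B.integrable_test_weight(1)[OF D] A.integrable_test_weight(1)[OF D] UG]
        parts[OF B.integrable_test_weight(2)[OF \<phi>] A.integrable_test_weight(2)[OF \<phi>] VH] by simp
    moreover have "integrable ?N (\<lambda>x. \<psi> x * (LINT t|?I. deriv \<phi> t * G t x))" "integrable ?N (\<lambda>x. \<psi> x * (LINT t|?I. \<phi> t * H t x))"
      by (rule integrable_bounded_mult[OF iG m\<psi> B], rule integrable_bounded_mult[OF iH m\<psi> B])
    ultimately have "(LINT x|?N. \<psi> x * (LINT t|?I. deriv \<phi> t * G t x) + \<psi> x * (LINT t|?I. \<phi> t * H t x)) = 0" by simp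
    then show "(LINT x|?N. ?F x * bump a b m x) = 0"
      by (simp only: \<psi>_def distrib_right mult.commute[of "bump a b m _"])
  qed
  then show ?thesis by eventually_elim simp
qed

lemma weak_derivative_add:
  assumes "weak_derivative T e D" "weak_derivative T e' D'"
  shows "weak_derivative T (\<lambda>t. e t + e' t) (\<lambda>t. D t + D' t)"
  unfolding weak_derivative_def
proof (intro conjI allI impI)
  let ?I = "lebesgue_on {0<..<T}"
  have l: "locally_integrable {0<..<T} e" "locally_integrable {0<..<T} e'"
    "locally_integrable {0<..<T} D" "locally_integrable {0<..<T} D'"
    using assms by (simp_all add: weak_derivative_def)
  show "locally_integrable {0<..<T} (\<lambda>t. e t + e' t)" "locally_integrable {0<..<T} (\<lambda>t. D t + D' t)"
    using l by (simp_all add: locally_integrable_def)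
  fix \<phi> :: "real \<Rightarrow> real" assume \<phi>: "test_function {0<..<T} \<phi>"
  note d = test_function_deriv(2)[OF \<phi>]
  have i: "integrable ?I (\<lambda>t. e t * deriv \<phi> t)" "integrable ?I (\<lambda>t. e' t * deriv \<phi> t)"
    "integrable ?I (\<lambda>t. D t * \<phi> t)" "integrable ?I (\<lambda>t. D' t * \<phi> t)"
    by (rule integrable_mult_test_function[OF _ l(1) d] integrable_mult_test_function[OF _ l(2) d]
      integrable_mult_test_function[OF _ l(3) \<phi>] integrable_mult_test_function[OF _ l(4) \<phi>], simp)+
  show "(LINT t|?I. (e t + e' t) * deriv \<phi> t) = - (LINT t|?I. (D t + D' t) * \<phi> t)"
    using assms \<phi> i by (simp add: weak_derivative_def distrib_right)
qed

lemma weak_derivative_cmult: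
  assumes "weak_derivative T e D"
  shows "weak_derivative T (\<lambda>t. c * e t) (\<lambda>t. c * D t)"
  using assms by (simp add: weak_derivative_def locally_integrable_def mult.assoc)

lemma weak_derivative_sum:
  assumes "\<And>i. i \<in> S \<Longrightarrow> weak_derivative T (e i) (D i)"
  shows "weak_derivative T (\<lambda>t. \<Sum>i\<in>S. e i t) (\<lambda>t. \<Sum>i\<in>S. D i t)"
  using assms
proof (induction S rule: infinite_finite_induct)
  case (insert i S)
  then have "weak_derivative T (\<lambda>t. e i t + (\<Sum>i\<in>S. e i t)) (\<lambda>t. D i t + (\<Sum>i\<in>S. D i t))"
    by (intro weak_derivative_add) simp_all
  with insert show ?case by simp
qed (simp_all add: weak_derivative_def locally_integrable_def)

lemma locally_integrable_cong_AE:
  fixes e e' :: "real \<Rightarrow> real"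
  assumes "locally_integrable {0<..<T} e" and eq: "AE t in lebesgue_on {0<..<T}. e t = e' t"
  shows "locally_integrable {0<..<T} e'"
  unfolding locally_integrable_def
proof (intro allI impI)
  fix K :: "real set" assume K: "compact K \<and> K \<subseteq> {0<..<T}"
  then have K': "K \<in> sets lebesgue" by (simp add: compact_imp_closed)
  have "AE t in lebesgue. t \<in> {0<..<T} \<longrightarrow> e t = e' t"
    using eq by (simp add: AE_restrict_space_iff)
  then have "AE t in lebesgue. t \<in> K \<longrightarrow> e t = e' t"
  proof eventually_elim
    case (elim t)
    show ?case
    proof
      assume "t \<in> K"
      with K have "t \<in> {0<..<T}" by blast
      with elim show "e t = e' t" by (rule mp)
    qed
  qed
  then have eqK: "AE t in lebesgue_on K. e t = e' t" using K' by (simp add: AE_restrict_space_iff)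
  have "integrable (lebesgue_on K) e" using assms(1) K by (simp add: locally_integrable_def)
  then show "integrable (lebesgue_on K) e'" by (rule integrable_lebesgue_on_cong_AE[OF K' _ eqK])
qed

lemma weak_derivative_cong_AE:
  assumes wd: "weak_derivative T e D" and e: "AE t in lebesgue_on {0<..<T}. e t = e' t"
    and D: "AE t in lebesgue_on {0<..<T}. D t = D' t"
  shows "weak_derivative T e' D'"
  unfolding weak_derivative_def
proof (intro conjI allI impI)
  let ?I = "lebesgue_on {0<..<T}"
  have l: "locally_integrable {0<..<T} e" "locally_integrable {0<..<T} D"
    using wd by (simp_all add: weak_derivative_def)
  show "locally_integrable {0<..<T} e'" by (rule locally_integrable_cong_AE[OF l(1) e])
  show "locally_integrable {0<..<T} D'" by (rule locally_integrable_cong_AE[OF l(2) D])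
  fix \<phi> :: "real \<Rightarrow> real" assume \<phi>: "test_function {0<..<T} \<phi>"
  note d = test_function_deriv(2)[OF \<phi>]
  have S: "{0<..<T} \<in> sets lebesgue" by simp
  have "(LINT t|?I. e t * deriv \<phi> t) = (LINT t|?I. e' t * deriv \<phi> t)"
    by (rule integral_lebesgue_on_cong_AE[OF S borel_measurable_integrable[OF integrable_mult_test_function[OF S l(1) d]]])
      (use e in eventually_elim, simp)
  moreover have "(LINT t|?I. D t * \<phi> t) = (LINT t|?I. D' t * \<phi> t)"
    by (rule integral_lebesgue_on_cong_AE[OF S borel_measurable_integrable[OF integrable_mult_test_function[OF S l(2) \<phi>]]])
      (use D in eventually_elim, simp)
  ultimately show "(LINT t|?I. e' t * deriv \<phi> t) = - (LINT t|?I. D' t * \<phi> t)"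
    using wd \<phi> by (simp add: weak_derivative_def)
qed

lemma W12_slice_bounds:
  fixes \<Omega> :: "(real^'n) set"
  assumes \<Omega>: "open \<Omega>" and u: "u \<in> W1p_space \<Omega> 2" and G: "weak_gradient \<Omega> u G"
  shows "integrable (lebesgue_on \<Omega>) (\<lambda>x. (u x $ i)\<^sup>2)" "(LINT x|lebesgue_on \<Omega>. (u x $ i)\<^sup>2) \<le> (W1p_norm \<Omega> 2 u)\<^sup>2"
    "integrable (lebesgue_on \<Omega>) (\<lambda>x. (G x $ i $ j)\<^sup>2)" "(LINT x|lebesgue_on \<Omega>. (G x $ i $ j)\<^sup>2) \<le> (W1p_norm \<Omega> 2 u)\<^sup>2"
proof -
  let ?N = "lebesgue_on \<Omega>"
  have \<Omega>s: "\<Omega> \<in> sets lebesgue" using \<Omega> by auto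
  have u2: "u \<in> borel_measurable ?N" "integrable ?N (\<lambda>x. (norm (u x))\<^sup>2)"
    and g2: "grad \<Omega> u \<in> borel_measurable ?N" "integrable ?N (\<lambda>x. (norm (grad \<Omega> u x))\<^sup>2)"
    using u by (auto simp: W1p_space_def Lp_space_2_iff)
  have W: "(W1p_norm \<Omega> 2 u)\<^sup>2 = (LINT x|?N. (norm (u x))\<^sup>2) + (LINT x|?N. (norm (grad \<Omega> u x))\<^sup>2)"
    using W1p_norm_powr[of 2 \<Omega> u] by (simp add: W1p_norm_def)
  have nn: "0 \<le> (LINT x|?N. (norm (u x))\<^sup>2)" "0 \<le> (LINT x|?N. (norm (grad \<Omega> u x))\<^sup>2)"
    by (intro integral_nonneg_AE AE_I2; simp)+
  have comp: "integrable ?N (\<lambda>x. (f x)\<^sup>2) \<and> (LINT x|?N. (f x)\<^sup>2) \<le> (LINT x|?N. (norm (F x))\<^sup>2)"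
    if i: "integrable ?N (\<lambda>x. (norm (F x))\<^sup>2)" and m: "f \<in> borel_measurable ?N" and le: "\<And>x. \<bar>f x\<bar> \<le> norm (F x)"
    for f :: "real^'n \<Rightarrow> real" and F :: "real^'n \<Rightarrow> 'b::euclidean_space"
  proof -
    have le2: "(f x)\<^sup>2 \<le> (norm (F x))\<^sup>2" for x
      using power_mono[OF le[of x], of 2] by simp
    have "integrable ?N (\<lambda>x. (f x)\<^sup>2)"
    proof (rule Bochner_Integration.integrable_bound[OF i])
      show "(\<lambda>x. (f x)\<^sup>2) \<in> borel_measurable ?N" using m by simp
      show "AE x in ?N. norm ((f x)\<^sup>2) \<le> norm ((norm (F x))\<^sup>2)" using le2 by (intro AE_I2) simp
    qed
    then show ?thesis using i le2 by (intro conjI integral_mono)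
  qed
  have cu: "integrable ?N (\<lambda>x. (u x $ i)\<^sup>2) \<and> (LINT x|?N. (u x $ i)\<^sup>2) \<le> (LINT x|?N. (norm (u x))\<^sup>2)"
    by (rule comp[OF u2(2) borel_measurable_vec_nth[OF u2(1)] abs_nth_le_norm])
  have cg: "integrable ?N (\<lambda>x. (grad \<Omega> u x $ i $ j)\<^sup>2) \<and> (LINT x|?N. (grad \<Omega> u x $ i $ j)\<^sup>2) \<le> (LINT x|?N. (norm (grad \<Omega> u x))\<^sup>2)"
    by (rule comp[OF g2(2) borel_measurable_vec_nth[OF borel_measurable_vec_nth[OF g2(1)]] abs_nth_nth_le_norm])
  have eq: "AE x in ?N. (grad \<Omega> u x $ i $ j)\<^sup>2 = (G x $ i $ j)\<^sup>2"
    using grad_eq_weak_gradient[OF \<Omega> G] by eventually_elim simp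
  show "integrable ?N (\<lambda>x. (u x $ i)\<^sup>2)" using cu by simp
  show "(LINT x|?N. (u x $ i)\<^sup>2) \<le> (W1p_norm \<Omega> 2 u)\<^sup>2" using cu W nn by linarith
  show "integrable ?N (\<lambda>x. (G x $ i $ j)\<^sup>2)"
    by (rule integrable_lebesgue_on_cong_AE[OF \<Omega>s conjunct1[OF cg] eq])
  have "(LINT x|?N. (grad \<Omega> u x $ i $ j)\<^sup>2) = (LINT x|?N. (G x $ i $ j)\<^sup>2)"
    by (rule integral_lebesgue_on_cong_AE[OF \<Omega>s borel_measurable_integrable[OF conjunct1[OF cg]] eq])
  then show "(LINT x|?N. (G x $ i $ j)\<^sup>2) \<le> (W1p_norm \<Omega> 2 u)\<^sup>2" using cg W nn by linarith
qed


lemma strongly_measurable_W1_obtain: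
  assumes "strongly_measurable_W1 T \<Omega> u"
  obtains G where "jointly_measurable T \<Omega> u" "jointly_measurable T \<Omega> G"
    "AE t in lebesgue_on {0<..<T}. weak_gradient \<Omega> (u t) (G t)"
  using assms by (auto simp: strongly_measurable_W1_def)

lemma jointly_measurable_nth:
  fixes u :: "real \<Rightarrow> real^'n \<Rightarrow> 'b::euclidean_space^'m"
  assumes "jointly_measurable T \<Omega> u" shows "jointly_measurable T \<Omega> (\<lambda>t x. u t x $ i)"
  using borel_measurable_vec_nth[OF assms[unfolded jointly_measurable_def], of i]
  by (simp add: jointly_measurable_def case_prod_beta')

lemma integral_vec_nth:
  fixes f :: "'a \<Rightarrow> real^'n"
  assumes "\<And>i. integrable M (\<lambda>t. f t $ i)"
  shows "integral\<^sup>L M f $ i = (LINT t|M. f t $ i)"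
proof -
  have "integrable M (\<lambda>t. \<Sum>i\<in>UNIV. f t $ i *\<^sub>R axis i (1 :: real))"
    using assms by (intro Bochner_Integration.integrable_sum integrable_scaleR_left) simp
  moreover have "(\<lambda>t. \<Sum>i\<in>UNIV. f t $ i *\<^sub>R axis i (1 :: real)) = f"
  proof
    show "(\<Sum>i\<in>UNIV. f t $ i *\<^sub>R axis i 1) = f t" for t
      using basis_expansion[of "f t"] by (simp add: scalar_mult_eq_scaleR)
  qed
  ultimately have "integrable M f" by simp
  from integral_bounded_linear[OF bounded_linear_vec_nth this, of i] show ?thesis by simp
qed

lemma inner_L2_vec:
  fixes u v :: "real^'n \<Rightarrow> real^'m"
  assumes "\<And>i. integrable (lebesgue_on \<Omega>) (\<lambda>x. u x $ i * v x $ i)"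
  shows "inner_L2 \<Omega> u v = (\<Sum>i\<in>UNIV. LINT x|lebesgue_on \<Omega>. u x $ i * v x $ i)"
  using assms by (simp add: inner_L2_def inner_vec_def)

lemma inner_L2_mat:
  fixes A B :: "real^'n \<Rightarrow> real^'m^'k"
  assumes "\<And>i j. integrable (lebesgue_on \<Omega>) (\<lambda>x. A x $ i $ j * B x $ i $ j)"
  shows "inner_L2 \<Omega> A B = (\<Sum>i\<in>UNIV. \<Sum>j\<in>UNIV. LINT x|lebesgue_on \<Omega>. A x $ i $ j * B x $ i $ j)"
  using assms by (simp add: inner_L2_def inner_vec_def)

lemma inner_L2_cong_AE:
  fixes A B :: "real^'n \<Rightarrow> 'b::euclidean_space"
  assumes \<Omega>: "\<Omega> \<in> sets lebesgue" and m: "A \<in> borel_measurable (lebesgue_on \<Omega>)" "B \<in> borel_measurable (lebesgue_on \<Omega>)"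
    and "AE x in lebesgue_on \<Omega>. A x = A' x" "AE x in lebesgue_on \<Omega>. B x = B' x"
  shows "inner_L2 \<Omega> A B = inner_L2 \<Omega> A' B'"
  unfolding inner_L2_def
proof (rule integral_lebesgue_on_cong_AE[OF \<Omega>])
  show "(\<lambda>x. A x \<bullet> B x) \<in> borel_measurable (lebesgue_on \<Omega>)" using m by (rule borel_measurable_inner)
  show "AE x in lebesgue_on \<Omega>. A x \<bullet> B x = A' x \<bullet> B' x" using assms(4,5) by eventually_elim simp
qed

lemma Lp_norm_2_inner_L2: "(Lp_norm \<Omega> 2 f)\<^sup>2 = inner_L2 \<Omega> f f"
  by (simp add: Lp_norm_square inner_L2_def power2_norm_eq_inner)

text \<open>
  The energy and its derivative are, for almost every time, sums over the components of \<open>w\<close> and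
  of its gradient, to each of which the scalar result applies; the uniform bound in \<open>H\<^sup>1\<close> and the
  local integrability of the \<open>H\<^sup>1\<close> norm of \<open>wt\<close> provide the hypotheses.
\<close>

lemma solution_energy_derivative:
  fixes \<Omega> :: "(real^'n) set" and a :: real
  assumes \<Omega>: "open \<Omega>" "bounded \<Omega>" and T: "0 < T"
    and w: "w \<in> Linf_H1 T \<Omega>" and wt: "time_derivative T \<Omega> w wt"
  shows "weak_derivative T
     (\<lambda>t. (Lp_norm \<Omega> 2 (w t))\<^sup>2 + a * (Lp_norm \<Omega> 2 (grad \<Omega> (w t)))\<^sup>2)
     (\<lambda>t. 2 * inner_L2 \<Omega> (wt t) (w t) + a * (2 * inner_L2 \<Omega> (grad \<Omega> (wt t)) (grad \<Omega> (w t))))"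
proof -
  let ?I = "lebesgue_on {0<..<T}" and ?N = "lebesgue_on \<Omega>"
  have \<Omega>s: "\<Omega> \<in> sets lebesgue" using \<Omega>(1) by auto
  interpret N: finite_measure ?N by (rule finite_measure_lebesgue_on_bounded[OF \<Omega>])
  have inI: "AE t in ?I. t \<in> {0<..<T}" by (rule AE_I2) simp
  obtain G where G: "jointly_measurable T \<Omega> w" "jointly_measurable T \<Omega> G" "AE t in ?I. weak_gradient \<Omega> (w t) (G t)"
    using w by (auto simp: Linf_H1_def intro: strongly_measurable_W1_obtain)
  obtain H where H: "jointly_measurable T \<Omega> wt" "jointly_measurable T \<Omega> H" "AE t in ?I. weak_gradient \<Omega> (wt t) (H t)"
    using wt by (auto simp: time_derivative_def intro: strongly_measurable_W1_obtain)
  obtain C where C: "AE t in ?I. W1p_norm \<Omega> 2 (w t) \<le> C" using w by (auto simp: Linf_H1_def)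
  have w2: "AE t in ?I. w t \<in> W1p_space \<Omega> 2" using w by (simp add: Linf_H1_def)
  have wt2: "AE t in ?I. wt t \<in> W1p_space \<Omega> 2" and nl: "locally_integrable {0<..<T} (\<lambda>t. W1p_norm \<Omega> 2 (wt t))"
    using wt by (simp_all add: time_derivative_def)
  have W0: "0 \<le> W1p_norm \<Omega> 2 u" for u :: "real^'n \<Rightarrow> real^'n" by (simp add: W1p_norm_def)
  let ?n = "\<lambda>t. W1p_norm \<Omega> 2 (wt t)"
  have bw: "AE t in ?I. integrable ?N (\<lambda>x. (w t x $ i)\<^sup>2) \<and> (LINT x|?N. (w t x $ i)\<^sup>2) \<le> C\<^sup>2" for i
    using w2 G(3) C
  proof eventually_elim
    case (elim t)
    note B = W12_slice_bounds(1,2)[OF \<Omega>(1) elim(1,2), of i]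
    have "(W1p_norm \<Omega> 2 (w t))\<^sup>2 \<le> C\<^sup>2" by (rule power_mono[OF elim(3) W0])
    then show ?case using B by simp
  qed
  have bG: "AE t in ?I. integrable ?N (\<lambda>x. (G t x $ i $ j)\<^sup>2) \<and> (LINT x|?N. (G t x $ i $ j)\<^sup>2) \<le> C\<^sup>2" for i j
    using w2 G(3) C
  proof eventually_elim
    case (elim t)
    note B = W12_slice_bounds(3,4)[OF \<Omega>(1) elim(1,2), of i j]
    have "(W1p_norm \<Omega> 2 (w t))\<^sup>2 \<le> C\<^sup>2" by (rule power_mono[OF elim(3) W0])
    then show ?case using B by simp
  qed
  have bwt: "AE t in ?I. integrable ?N (\<lambda>x. (wt t x $ i)\<^sup>2) \<and> (LINT x|?N. (wt t x $ i)\<^sup>2) \<le> (?n t)\<^sup>2" for i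
    using wt2 H(3)
  proof eventually_elim
    case (elim t)
    show ?case using W12_slice_bounds(1,2)[OF \<Omega>(1) elim, of i] by simp
  qed
  have bH: "AE t in ?I. integrable ?N (\<lambda>x. (H t x $ i $ j)\<^sup>2) \<and> (LINT x|?N. (H t x $ i $ j)\<^sup>2) \<le> (?n t)\<^sup>2" for i j
    using wt2 H(3)
  proof eventually_elim
    case (elim t)
    show ?case using W12_slice_bounds(3,4)[OF \<Omega>(1) elim, of i j] by simp
  qed
  have A: "space_time_field ?N T (\<lambda>t x. w t x $ i) (\<lambda>t x. wt t x $ i) (C\<^sup>2) ?n" for i
  proof (unfold_locales)
    show "(\<lambda>(t, x). w t x $ i) \<in> borel_measurable (?I \<Otimes>\<^sub>M ?N)" "(\<lambda>(t, x). wt t x $ i) \<in> borel_measurable (?I \<Otimes>\<^sub>M ?N)"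
      using jointly_measurable_nth[OF G(1)] jointly_measurable_nth[OF H(1)] by (simp_all add: jointly_measurable_def)
  qed (rule T bw bwt nl)+
  have B: "space_time_field ?N T (\<lambda>t x. G t x $ i $ j) (\<lambda>t x. H t x $ i $ j) (C\<^sup>2) ?n" for i j
  proof (unfold_locales)
    show "(\<lambda>(t, x). G t x $ i $ j) \<in> borel_measurable (?I \<Otimes>\<^sub>M ?N)" "(\<lambda>(t, x). H t x $ i $ j) \<in> borel_measurable (?I \<Otimes>\<^sub>M ?N)"
      using jointly_measurable_nth[OF jointly_measurable_nth[OF G(2)]] jointly_measurable_nth[OF jointly_measurable_nth[OF H(2)]]
      by (simp_all add: jointly_measurable_def)
  qed (rule T bG bH nl)+
  have wdA: "AE x in ?N. (LINT t|?I. deriv \<phi> t * w t x $ i) = - (LINT t|?I. \<phi> t * wt t x $ i)"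
    if \<phi>: "test_function {0<..<T} \<phi>" for \<phi> :: "real \<Rightarrow> real" and i
  proof -
    interpret A: space_time_field ?N T "\<lambda>t x. w t x $ k" "\<lambda>t x. wt t x $ k" "C\<^sup>2" ?n for k by (rule A)
    note d = test_function_deriv(2)[OF \<phi>]
    have 1: "AE x in ?N. \<forall>i. integrable ?I (\<lambda>t. deriv \<phi> t * w t x $ i)"
      by (subst AE_all_countable, rule allI, rule A.P.AE_integrable_snd[OF A.integrable_test_weight(1)[OF d]])
    have 2: "AE x in ?N. \<forall>i. integrable ?I (\<lambda>t. \<phi> t * wt t x $ i)"
      by (subst AE_all_countable, rule allI, rule A.P.AE_integrable_snd[OF A.integrable_test_weight(2)[OF \<phi>]])
    have 3: "AE x in ?N. (LINT t|?I. deriv \<phi> t *\<^sub>R w t x) = - (LINT t|?I. \<phi> t *\<^sub>R wt t x)"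
      using wt \<phi> unfolding time_derivative_def by blast
    from 1 2 3 show ?thesis
    proof eventually_elim
      case (elim x)
      have "(LINT t|?I. deriv \<phi> t *\<^sub>R w t x) $ i = (LINT t|?I. deriv \<phi> t * w t x $ i)"
        using elim(1) by (subst integral_vec_nth) simp_all
      moreover have "(LINT t|?I. \<phi> t *\<^sub>R wt t x) $ i = (LINT t|?I. \<phi> t * wt t x $ i)"
        using elim(2) by (subst integral_vec_nth) simp_all
      ultimately show ?case using elim(3) by simp
    qed
  qed
  have wdB: "AE x in ?N. (LINT t|?I. deriv \<phi> t * G t x $ i $ j) = - (LINT t|?I. \<phi> t * H t x $ i $ j)"
    if \<phi>: "test_function {0<..<T} \<phi>" for \<phi> :: "real \<Rightarrow> real" and i j
  proof (rule gradient_time_derivative[OF \<Omega>(1) A B _ _ \<phi> wdA[OF \<phi>], where e = "axis j 1"])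
    show "AE t in ?I. \<forall>\<psi>. test_function \<Omega> \<psi> \<longrightarrow>
      (LINT x|?N. w t x $ i * frechet_derivative \<psi> (at x) (axis j 1)) = - (LINT x|?N. G t x $ i $ j * \<psi> x)"
      using G(3)
    proof eventually_elim
      case (elim t)
      show ?case by (intro allI impI weak_gradientD[OF elim])
    qed
    show "AE t in ?I. \<forall>\<psi>. test_function \<Omega> \<psi> \<longrightarrow>
      (LINT x|?N. wt t x $ i * frechet_derivative \<psi> (at x) (axis j 1)) = - (LINT x|?N. H t x $ i $ j * \<psi> x)"
      using H(3)
    proof eventually_elim
      case (elim t)
      show ?case by (intro allI impI weak_gradientD[OF elim])
    qed
  qed
  have EA: "weak_derivative T (\<lambda>t. LINT x|?N. (w t x $ i)\<^sup>2) (\<lambda>t. 2 * (LINT x|?N. w t x $ i * wt t x $ i))" for i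
    by (rule space_time_field.energy_weak_derivative[OF A wdA])
  have EB: "weak_derivative T (\<lambda>t. LINT x|?N. (G t x $ i $ j)\<^sup>2) (\<lambda>t. 2 * (LINT x|?N. G t x $ i $ j * H t x $ i $ j))" for i j
    by (rule space_time_field.energy_weak_derivative[OF B wdB])
  have wd: "weak_derivative T
     (\<lambda>t. (\<Sum>i\<in>UNIV. LINT x|?N. (w t x $ i)\<^sup>2) + a * (\<Sum>i\<in>UNIV. \<Sum>j\<in>UNIV. LINT x|?N. (G t x $ i $ j)\<^sup>2))
     (\<lambda>t. (\<Sum>i\<in>UNIV. 2 * (LINT x|?N. w t x $ i * wt t x $ i))
        + a * (\<Sum>i\<in>UNIV. \<Sum>j\<in>UNIV. 2 * (LINT x|?N. G t x $ i $ j * H t x $ i $ j)))"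
    by (intro weak_derivative_add weak_derivative_cmult weak_derivative_sum EA EB)
  have pA: "AE t in ?I. \<forall>i. integrable ?N (\<lambda>x. w t x $ i * wt t x $ i)"
    by (subst AE_all_countable, rule allI, rule space_time_field.AE_integrable_product[OF A])
  have pB: "AE t in ?I. \<forall>i j. integrable ?N (\<lambda>x. G t x $ i $ j * H t x $ i $ j)"
    by (subst AE_all_countable, rule allI, subst AE_all_countable, rule allI, rule space_time_field.AE_integrable_product[OF B])
  have "AE t in ?I. integrable ?N (\<lambda>x. (w t x $ i)\<^sup>2)" for i
    using bw[of i] by eventually_elim simp
  then have sA: "AE t in ?I. \<forall>i. integrable ?N (\<lambda>x. (w t x $ i)\<^sup>2)" by (simp add: AE_all_countable)
  have "AE t in ?I. integrable ?N (\<lambda>x. (G t x $ i $ j)\<^sup>2)" for i j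
    using bG[of i j] by eventually_elim simp
  then have sB: "AE t in ?I. \<forall>i j. integrable ?N (\<lambda>x. (G t x $ i $ j)\<^sup>2)" by (simp add: AE_all_countable)
  have gm: "AE t in ?I. G t \<in> borel_measurable ?N \<and> H t \<in> borel_measurable ?N"
  proof (rule AE_I2)
    fix t assume "t \<in> space ?I"
    then show "G t \<in> borel_measurable ?N \<and> H t \<in> borel_measurable ?N"
      using measurable_Pair2[OF G(2)[unfolded jointly_measurable_def], of t] measurable_Pair2[OF H(2)[unfolded jointly_measurable_def], of t]
      by simp
  qed
  show ?thesis
  proof (rule weak_derivative_cong_AE[OF wd])
    show "AE t in ?I. (\<Sum>i\<in>UNIV. LINT x|?N. (w t x $ i)\<^sup>2) + a * (\<Sum>i\<in>UNIV. \<Sum>j\<in>UNIV. LINT x|?N. (G t x $ i $ j)\<^sup>2)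
       = (Lp_norm \<Omega> 2 (w t))\<^sup>2 + a * (Lp_norm \<Omega> 2 (grad \<Omega> (w t)))\<^sup>2"
      using sA sB G(3) gm
    proof eventually_elim
      case (elim t)
      have g: "AE x in ?N. G t x = grad \<Omega> (w t) x"
        using grad_eq_weak_gradient[OF \<Omega>(1) elim(3)] by eventually_elim simp
      have "inner_L2 \<Omega> (w t) (w t) = (\<Sum>i\<in>UNIV. LINT x|?N. (w t x $ i)\<^sup>2)"
        using inner_L2_vec[of \<Omega> "w t" "w t"] elim(1) by (simp add: power2_eq_square)
      moreover have "inner_L2 \<Omega> (grad \<Omega> (w t)) (grad \<Omega> (w t)) = inner_L2 \<Omega> (G t) (G t)"
        by (rule inner_L2_cong_AE[OF \<Omega>s _ _ g g, symmetric]) (simp_all add: elim(4))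
      moreover have "inner_L2 \<Omega> (G t) (G t) = (\<Sum>i\<in>UNIV. \<Sum>j\<in>UNIV. LINT x|?N. (G t x $ i $ j)\<^sup>2)"
        using inner_L2_mat[of \<Omega> "G t" "G t"] elim(2) by (simp add: power2_eq_square)
      ultimately show ?case by (simp add: Lp_norm_2_inner_L2)
    qed
    show "AE t in ?I. (\<Sum>i\<in>UNIV. 2 * (LINT x|?N. w t x $ i * wt t x $ i))
        + a * (\<Sum>i\<in>UNIV. \<Sum>j\<in>UNIV. 2 * (LINT x|?N. G t x $ i $ j * H t x $ i $ j))
       = 2 * inner_L2 \<Omega> (wt t) (w t) + a * (2 * inner_L2 \<Omega> (grad \<Omega> (wt t)) (grad \<Omega> (w t)))"
      using pA pB G(3) H(3) gm
    proof eventually_elim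
      case (elim t)
      have g: "AE x in ?N. G t x = grad \<Omega> (w t) x"
        using grad_eq_weak_gradient[OF \<Omega>(1) elim(3)] by eventually_elim simp
      have h: "AE x in ?N. H t x = grad \<Omega> (wt t) x"
        using grad_eq_weak_gradient[OF \<Omega>(1) elim(4)] by eventually_elim simp
      have "inner_L2 \<Omega> (wt t) (w t) = (\<Sum>i\<in>UNIV. LINT x|?N. w t x $ i * wt t x $ i)"
        using inner_L2_vec[of \<Omega> "wt t" "w t"] elim(1) by (simp add: mult.commute)
      moreover have "inner_L2 \<Omega> (grad \<Omega> (wt t)) (grad \<Omega> (w t)) = inner_L2 \<Omega> (H t) (G t)"
        by (rule inner_L2_cong_AE[OF \<Omega>s _ _ h g, symmetric]) (simp_all add: elim(5))
      moreover have "inner_L2 \<Omega> (H t) (G t) = (\<Sum>i\<in>UNIV. \<Sum>j\<in>UNIV. LINT x|?N. G t x $ i $ j * H t x $ i $ j)"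
        using inner_L2_mat[of \<Omega> "H t" "G t"] elim(2) by (simp add: mult.commute)
      ultimately show ?case by (simp add: sum_distrib_left)
    qed
  qed
qed

theorem theorem4p1:
  fixes \<Omega> :: "(real^'n) set"
    and T \<nu> C\<^sub>s \<delta> \<mu> :: real
    and f w\<^sub>0 :: "real^'n \<Rightarrow> real^'n"
    and w :: "real \<Rightarrow> real^'n \<Rightarrow> real^'n"
  assumes "CARD('n) = 2 \<or> CARD('n) = 3"
    and "flow_domain \<Omega>"
    and "T > 0" and "\<nu> > 0" and "C\<^sub>s > 0" and "\<delta> > 0" and "\<mu> > 0"
    and "\<And>v. v \<in> velocity_space \<Omega> \<Longrightarrow> integrable (lebesgue_on \<Omega>) (\<lambda>x. f x \<bullet> v x)"
    and "strong_solution \<Omega> T \<nu> C\<^sub>s \<delta> \<mu> f w\<^sub>0 w"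
  shows "\<exists>dE. weak_derivative T
             (\<lambda>t. (Lp_norm \<Omega> 2 (w t))\<^sup>2
                + C\<^sub>s ^ 4 * \<delta>\<^sup>2 / \<mu>\<^sup>2 * (Lp_norm \<Omega> 2 (grad \<Omega> (w t)))\<^sup>2) dE \<and>
           (AE t in lebesgue_on {0<..<T}.
              1 / 2 * (1 / measure lebesgue \<Omega>) * dE t
              + 1 / measure lebesgue \<Omega> * \<nu> * (Lp_norm \<Omega> 2 (grad \<Omega> (w t)))\<^sup>2
              + 1 / measure lebesgue \<Omega> * (C\<^sub>s * \<delta>)\<^sup>2 * (Lp_norm \<Omega> 3 (grad \<Omega> (w t))) ^ 3
              = 1 / measure lebesgue \<Omega> * inner_L2 \<Omega> f (w t))"
proof -
  let ?I = "lebesgue_on {0<..<T}" and ?a = "C\<^sub>s ^ 4 * \<delta>\<^sup>2 / \<mu>\<^sup>2"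
  have \<Omega>: "open \<Omega>" "bounded \<Omega>" using assms(2) by (simp_all add: flow_domain_def)
  have wS: "w \<in> solution_class T \<Omega>" using assms(9) by (simp add: strong_solution_def)
  obtain wt p where wt: "time_derivative T \<Omega> w wt"
    and p: "AE t in ?I. p t \<in> pressure_space \<Omega>"
    and mom: "\<forall>v\<in>solution_class T \<Omega>. AE t in ?I. momentum_weak_form \<Omega> \<nu> C\<^sub>s \<delta> \<mu> f (w t) (wt t) (p t) (v t)"
    and div: "AE t in ?I. \<forall>q\<in>pressure_space \<Omega>. inner_L2 \<Omega> q (divergence \<Omega> (w t)) = 0"
    using assms(9) unfolding strong_solution_def by blast
  have wv: "AE t in ?I. w t \<in> velocity_space \<Omega>" and wL: "w \<in> Linf_H1 T \<Omega>"
    using wS by (simp_all add: solution_class_def)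
  define dE where "dE t = 2 * inner_L2 \<Omega> (wt t) (w t)
    + ?a * (2 * inner_L2 \<Omega> (grad \<Omega> (wt t)) (grad \<Omega> (w t)))" for t
  have "weak_derivative T (\<lambda>t. (Lp_norm \<Omega> 2 (w t))\<^sup>2 + ?a * (Lp_norm \<Omega> 2 (grad \<Omega> (w t)))\<^sup>2) dE"
    unfolding dE_def[abs_def] by (rule solution_energy_derivative[OF \<Omega> assms(3) wL wt])
  moreover have "AE t in ?I. 1 / 2 * (1 / measure lebesgue \<Omega>) * dE t
      + 1 / measure lebesgue \<Omega> * \<nu> * (Lp_norm \<Omega> 2 (grad \<Omega> (w t)))\<^sup>2
      + 1 / measure lebesgue \<Omega> * (C\<^sub>s * \<delta>)\<^sup>2 * (Lp_norm \<Omega> 3 (grad \<Omega> (w t))) ^ 3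
      = 1 / measure lebesgue \<Omega> * inner_L2 \<Omega> f (w t)"
    using p bspec[OF mom wS] div wv
  proof eventually_elim
    case (elim t)
    let ?G = "grad \<Omega> (w t)"
    have "inner_L2 \<Omega> (\<lambda>x. ?G x *v w t x) (w t) = 0"
      by (rule convective_term_zero[OF \<Omega> elim(4)]) (use elim(3) in blast)
    moreover have "inner_L2 \<Omega> (p t) (divergence \<Omega> (w t)) = 0" using elim(1,3) by blast
    moreover have "inner_L2 \<Omega> (\<lambda>x. ((C\<^sub>s * \<delta>)\<^sup>2 * norm (?G x)) *\<^sub>R ?G x) ?G = (C\<^sub>s * \<delta>)\<^sup>2 * (Lp_norm \<Omega> 3 ?G) ^ 3"
    proof -
      have "norm (?G x) * (?G x \<bullet> ?G x) = norm (?G x) ^ 3" for x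
        unfolding power2_norm_eq_inner[symmetric] power3_eq_cube power2_eq_square by simp
      then show ?thesis by (simp add: inner_L2_def Lp_norm_cube mult.assoc)
    qed
    ultimately have "1 / 2 * dE t + \<nu> * (Lp_norm \<Omega> 2 ?G)\<^sup>2 + (C\<^sub>s * \<delta>)\<^sup>2 * (Lp_norm \<Omega> 3 ?G) ^ 3 = inner_L2 \<Omega> f (w t)"
      using elim(2) by (simp add: momentum_weak_form_def dE_def Lp_norm_2_inner_L2 add_divide_distrib)
    then have "1 / measure lebesgue \<Omega> * (1 / 2 * dE t + \<nu> * (Lp_norm \<Omega> 2 ?G)\<^sup>2 + (C\<^sub>s * \<delta>)\<^sup>2 * (Lp_norm \<Omega> 3 ?G) ^ 3)
       = 1 / measure lebesgue \<Omega> * inner_L2 \<Omega> f (w t)" by (rule arg_cong)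
    then show ?case by (simp only: distrib_left mult.assoc mult.left_commute[of "1 / 2"])
  qed
  ultimately show ?thesis by blast
qed

end
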